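(* Let $(\mathcal{M}^n,g)$ be a Lorentzian manifold with a nowhere vanishing null 1-form $\kappa$, and let $\lambda,\phi\in\Omega^*_\kappa(\mathcal{M}^n)$ be null forms along $\kappa$. On each open set $U_\alpha$ of a local trivialisation with adapted coframe $(\mathbf{e}^-,\mathbf{e}^+,\mathbf{e}^i)$, $\mathbf{e}^-=\kappa$, define $$\lambda\,\bar{\curlywedge}\,\phi := \mathbf{e}^-\wedge i_{\vec{\breve\lambda}}\breve\phi,\qquad \lambda\curlywedge\phi := \lambda\wedge\breve\phi ,$$ where $\breve\lambda,\breve\phi$ are the local transverse forms representing $\lambda$ and $\phi$ on $U_\alpha$. Then both $\lambda\,\bar{\curlywedge}\,\phi$ and $\lambda\curlywedge\phi$ are globally defined forms on $\mathcal{M}^n$. Moreover, if $\kappa$, $\lambda$ and $\phi$ are covariantly constant with respect to a metric connection $\nabla^{\mathcal H}$ (so that its holonomy group satisfies $\mathcal{H}\subseteq SO(n-2)\ltimes\mathbb{R}^{n-2}$), then $\lambda\curlywedge\phi$ and $\lambda\,\bar{\curlywedge}\,\phi$ are also $\nabla^{\mathcal H}$-covariantly constant.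
   Context: All manifolds are smooth, oriented, spin, simply connected and, in Lorentzian signature, time-oriented. For a $k$-form $\chi$, $\vec\chi$ is the vector-valued $(k-1)$-form with $g(Y,\vec\chi(X_1,\dots,X_{k-1}))=\chi(Y,X_1,\dots,X_{k-1})$; in particular $\vec\kappa$ is the vector field dual to $\kappa$. For a vector-valued $\ell$-form $L$ and a $p$-form $\phi$, $i_L\phi=\frac{1}{\ell!(p-1)!}L^\mu{}_{\nu_1\dots\nu_\ell}\phi_{\mu\nu_{\ell+1}\dots\nu_{\ell+p-1}}dx^{\nu_1}\wedge\dots\wedge dx^{\nu_{\ell+p-1}}$ ($i_L f=0$ on functions). For forms, $\lambda\bar\wedge\chi:=i_{\vec\lambda}\chi$. A form $\phi$ is null along $\kappa$ (where $g(\vec\kappa,\vec\kappa)=0$) iff $\kappa\wedge\phi=0$ and $\kappa\bar\wedge\phi=0$; $\Omega^*_\kappa(\mathcal{M})$ is the space of all such forms. Since $\kappa$ is null and nowhere vanishing, there is an open cover $\{U_\alpha\}$ with local pseudo-orthonormal coframes $(\mathbf{e}^-_\alpha,\mathbf{e}^+_\alpha,\mathbf{e}^i_\alpha;\ i=1,\dots,n-2)$ with $\mathbf{e}^-_\alpha=\kappa$ and $g=2\mathbf{e}^-_\alpha\mathbf{e}^+_\alpha+\delta_{ij}\mathbf{e}_\alpha^i\mathbf{e}_\alpha^j$. On overlaps, $\mathbf{e}^-_\alpha=\mathbf{e}^-_\beta$, $\mathbf{e}^+_\alpha=\mathbf{e}^+_\beta-\frac12 w_{\alpha\beta}^2\mathbf{e}^-_\beta+(w_{\alpha\beta})_i\mathbf{e}^i_\beta$,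 $\mathbf{e}^i_\alpha=(O_{\alpha\beta}^{-1})^i{}_j(\mathbf{e}^j_\beta-w^j_{\alpha\beta}\mathbf{e}^-_\beta)$ with $(O_{\alpha\beta},w_{\alpha\beta})$ valued in $SO(n-2)\ltimes\mathbb{R}^{n-2}$. A form $\phi\in\Omega^*_\kappa$ is on $U_\alpha$ of the shape $\phi=\frac{1}{\ell!}\phi_{i_1\dots i_\ell}\mathbf{e}^-\wedge\mathbf{e}^{i_1}\wedge\dots\wedge\mathbf{e}^{i_\ell}$, and one sets $\breve\phi=\breve\phi_\alpha:=\frac{1}{\ell!}\phi_{i_1\dots i_\ell}\mathbf{e}^{i_1}\wedge\dots\wedge\mathbf{e}^{i_\ell}$; so $\phi=\mathbf{e}^-\wedge\breve\phi$. The local forms $\breve\phi_\alpha$ do not in general patch to a global form. If $\breve\lambda$ has degree $0$, $i_{\vec{\breve\lambda}}$ is taken to be zero. *)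

theory Defs
  imports "HOL-Analysis.Analysis"
begin

section \<open>Smooth functions on open sets of normed spaces\<close>

primrec Ck_on :: "nat \<Rightarrow> ('a::real_normed_vector \<Rightarrow> 'b::real_normed_vector) \<Rightarrow> 'a set \<Rightarrow> bool" where
  "Ck_on 0 f S = continuous_on S f"
| "Ck_on (Suc k) f S =
     (\<exists>f'. (\<forall>x\<in>S. (f has_derivative f' x) (at x)) \<and> (\<forall>v. Ck_on k (\<lambda>x. f' x v) S))"

definition smooth_on :: "('a::real_normed_vector \<Rightarrow> 'b::real_normed_vector) \<Rightarrow> 'a set \<Rightarrow> bool" where
  "smooth_on f S \<longleftrightarrow> (\<forall>k. Ck_on k f S)"


section \<open>Smooth manifolds and their tangent spaces\<close>

text \<open>
  The underlying topological space of the manifold is a type \<open>'m\<close>, Hausdorff and second countable;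
  the model space is a Euclidean space \<open>'e\<close>, so that the dimension is \<open>n = DIM('e)\<close>.
  A chart is a pair of its domain and its coordinate map.
\<close>

type_synonym ('m, 'e) chart = "'m set \<times> ('m \<Rightarrow> 'e)"

definition inv_chart :: "('m, 'e) chart \<Rightarrow> 'e \<Rightarrow> 'm" where
  "inv_chart c = inv_into (fst c) (snd c)"

definition is_chart :: "('m::topological_space, 'e::euclidean_space) chart \<Rightarrow> bool" where
  "is_chart c \<longleftrightarrow> open (fst c) \<and> open (snd c ` fst c) \<and>
     homeomorphism (fst c) (snd c ` fst c) (snd c) (inv_chart c)"

definition smooth_atlas :: "('m::{t2_space,second_countable_topology}, 'e::euclidean_space) chart set \<Rightarrow> bool" where
  "smooth_atlas A \<longleftrightarrow>
     (\<forall>c\<in>A. is_chart c) \<and> (\<Union>c\<in>A. fst c) = UNIV \<and>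
     (\<forall>c\<in>A. \<forall>d\<in>A. smooth_on (snd d \<circ> inv_chart c) (snd c ` (fst c \<inter> fst d)))"

text \<open>
  At every point \<open>p\<close> one chart around \<open>p\<close> is selected. The tangent space at \<open>p\<close> is modelled by
  the vector space \<open>'e\<close>: a vector \<open>v :: 'e\<close> at \<open>p\<close> stands for the tangent vector which has
  components \<open>v\<close> in the selected chart. The components in another chart \<open>c\<close> are obtained
  by applying the derivative of the change of coordinates (\<open>components_in\<close>), and
  \<open>vector_from\<close> is the inverse operation. All smoothness conditions are imposed on
  the representations in every chart of the atlas, so they do not depend on the selection.
\<close>

definition chart_at :: "('m, 'e) chart set \<Rightarrow> 'm \<Rightarrow> ('m, 'e) chart" where
  "chart_at A p = (SOME c. c \<in> A \<and> p \<in> fst c)"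

definition components_in ::
    "('m, 'e::euclidean_space) chart set \<Rightarrow> ('m, 'e) chart \<Rightarrow> 'm \<Rightarrow> 'e \<Rightarrow> 'e" where
  "components_in A c p v =
     frechet_derivative (snd c \<circ> inv_chart (chart_at A p)) (at (snd (chart_at A p) p)) v"

definition vector_from ::
    "('m, 'e::euclidean_space) chart set \<Rightarrow> ('m, 'e) chart \<Rightarrow> 'm \<Rightarrow> 'e \<Rightarrow> 'e" where
  "vector_from A c p v =
     frechet_derivative (snd (chart_at A p) \<circ> inv_chart c) (at (snd c p)) v"

definition smooth_function ::
    "('m, 'e::euclidean_space) chart set \<Rightarrow> 'm set \<Rightarrow> ('m \<Rightarrow> real) \<Rightarrow> bool" where
  "smooth_function A U f \<longleftrightarrow> (\<forall>c\<in>A. smooth_on (f \<circ> inv_chart c) (snd c ` (U \<inter> fst c)))"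

definition smooth_vector_field ::
    "('m, 'e::euclidean_space) chart set \<Rightarrow> 'm set \<Rightarrow> ('m \<Rightarrow> 'e) \<Rightarrow> bool" where
  "smooth_vector_field A U X \<longleftrightarrow>
     (\<forall>c\<in>A. smooth_on ((\<lambda>q. components_in A c q (X q)) \<circ> inv_chart c) (snd c ` (U \<inter> fst c)))"

definition directional_derivative ::
    "('m, 'e::euclidean_space) chart set \<Rightarrow> 'm \<Rightarrow> 'e \<Rightarrow> ('m \<Rightarrow> real) \<Rightarrow> real" where
  "directional_derivative A p v f =
     frechet_derivative (f \<circ> inv_chart (chart_at A p)) (at (snd (chart_at A p) p)) v"


section \<open>Exterior algebra\<close>

text \<open>
  An element of the full exterior algebra of the dual of \<open>'e\<close> is a function on lists of
  vectors; its component of degree \<open>k\<close> is the restriction to lists of length \<open>k\<close>.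
  All the operations below are thereby defined on inhomogeneous forms, as the bilinear extensions
  of the operations on homogeneous ones.
\<close>

type_synonym 'e form = "'e list \<Rightarrow> real"

definition alternating :: "'e::real_vector form \<Rightarrow> bool" where
  "alternating \<omega> \<longleftrightarrow>
     (\<forall>us ws. linear (\<lambda>v. \<omega> (us @ v # ws))) \<and>
     (\<forall>us v ws zs. \<omega> (us @ v # ws @ v # zs) = 0)"

definition has_degree :: "nat \<Rightarrow> 'e form \<Rightarrow> bool" where
  "has_degree k \<omega> \<longleftrightarrow> (\<forall>vs. length vs \<noteq> k \<longrightarrow> \<omega> vs = 0)"

text \<open>
  The sign of the permutation which moves the positions in \<open>S\<close> to the front and keeps the order
  within \<open>S\<close> and within its complement.
\<close>

definition shuffle_sign :: "nat set \<Rightarrow> real" where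
  "shuffle_sign S = (- 1) ^ card {(i, j). i \<in> S \<and> j < i \<and> j \<notin> S}"

text \<open>
  Convention \<open>(\<alpha> \<and> \<beta>)(u, v) = \<alpha>(u) \<beta>(v) - \<alpha>(v) \<beta>(u)\<close> for 1-forms.
\<close>

definition wedge :: "'e form \<Rightarrow> 'e form \<Rightarrow> 'e form" where
  "wedge \<alpha> \<beta> vs =
     (\<Sum>S \<in> Pow {..<length vs}. shuffle_sign S * \<alpha> (nths vs S) * \<beta> (nths vs (- S)))"

definition unit_form :: "'e form" where
  "unit_form vs = (if vs = [] then 1 else 0)"

definition wedge_list :: "'e form list \<Rightarrow> 'e form" where
  "wedge_list \<alpha>s = foldr wedge \<alpha>s unit_form"

text \<open>
  The algebraic derivation \<open>i_L\<close>: evaluating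
  \<open>1/(l! (p-1)!) L^\<mu>_{\<nu>\<^sub>1\<dots>\<nu>\<^sub>l} \<phi>_{\<mu>\<nu>\<dots>} dx^{\<nu>\<^sub>1} \<and> \<dots>\<close> on vectors gives a sum over all permutations,
  in which each \<open>(l, p-1)\<close>-shuffle occurs \<open>l! (p-1)!\<close> times. The component of
  \<open>\<phi>\<close> of degree 0 is never used, so \<open>i_L f = 0\<close> on functions.
\<close>

definition insertion :: "('e list \<Rightarrow> 'e) \<Rightarrow> 'e form \<Rightarrow> 'e form" where
  "insertion L \<phi> vs =
     (\<Sum>S \<in> Pow {..<length vs}. shuffle_sign S * \<phi> (L (nths vs S) # nths vs (- S)))"

text \<open>
  The vector-valued form \<open>L\<close> with \<open>g(Y, L(vs)) = \<alpha>(Y, vs)\<close>. The component of \<open>\<alpha>\<close> of degree 0 does not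
  contribute. For a 1-form \<open>\<alpha>\<close> the dual vector is \<open>raise g \<alpha> []\<close>.
\<close>

definition raise :: "('e \<Rightarrow> 'e \<Rightarrow> real) \<Rightarrow> 'e form \<Rightarrow> 'e list \<Rightarrow> 'e" where
  "raise g \<alpha> vs = (THE w. \<forall>Y. g Y w = \<alpha> (Y # vs))"

definition contraction :: "('e \<Rightarrow> 'e \<Rightarrow> real) \<Rightarrow> 'e form \<Rightarrow> 'e form \<Rightarrow> 'e form" where
  "contraction g \<alpha> \<phi> = insertion (raise g \<alpha>) \<phi>"

definition null_along :: "('e \<Rightarrow> 'e \<Rightarrow> real) \<Rightarrow> 'e form \<Rightarrow> 'e form \<Rightarrow> bool" where
  "null_along g \<kappa> \<phi> \<longleftrightarrow> wedge \<kappa> \<phi> = (\<lambda>_. 0) \<and> contraction g \<kappa> \<phi> = (\<lambda>_. 0)"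


section \<open>Differential forms\<close>

definition smooth_form ::
    "('m, 'e::euclidean_space) chart set \<Rightarrow> 'm set \<Rightarrow> ('m \<Rightarrow> 'e form) \<Rightarrow> bool" where
  "smooth_form A U \<omega> \<longleftrightarrow>
     (\<forall>p\<in>U. alternating (\<omega> p)) \<and>
     (\<forall>c\<in>A. \<forall>vs. smooth_on ((\<lambda>q. \<omega> q (map (vector_from A c q) vs)) \<circ> inv_chart c)
                   (snd c ` (U \<inter> fst c)))"

definition smooth_form_deg ::
    "('m, 'e::euclidean_space) chart set \<Rightarrow> 'm set \<Rightarrow> nat \<Rightarrow> ('m \<Rightarrow> 'e form) \<Rightarrow> bool" where
  "smooth_form_deg A U k \<omega> \<longleftrightarrow> smooth_form A U \<omega> \<and> (\<forall>p\<in>U. has_degree k (\<omega> p))"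

definition null_forms ::
    "('m, 'e::euclidean_space) chart set \<Rightarrow> ('m \<Rightarrow> 'e \<Rightarrow> 'e \<Rightarrow> real) \<Rightarrow> ('m \<Rightarrow> 'e form)
       \<Rightarrow> ('m \<Rightarrow> 'e form) set" where
  "null_forms A g \<kappa> = {\<phi>. smooth_form A UNIV \<phi> \<and> (\<forall>p. null_along (g p) (\<kappa> p) (\<phi> p))}"


section \<open>Lorentzian metrics, orientation, time orientation\<close>

definition eta :: "nat \<Rightarrow> nat \<Rightarrow> real" where
  "eta i j = (if i = j then (if i = 0 then - 1 else 1) else 0)"

definition lorentzian_product :: "('e::euclidean_space \<Rightarrow> 'e \<Rightarrow> real) \<Rightarrow> bool" where
  "lorentzian_product h \<longleftrightarrow>
     bilinear h \<and> (\<forall>u v. h u v = h v u) \<and>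
     (\<exists>b. \<forall>i<DIM('e). \<forall>j<DIM('e). h (b i) (b j) = eta i j)"

definition lorentzian_metric ::
    "('m, 'e::euclidean_space) chart set \<Rightarrow> ('m \<Rightarrow> 'e \<Rightarrow> 'e \<Rightarrow> real) \<Rightarrow> bool" where
  "lorentzian_metric A g \<longleftrightarrow>
     (\<forall>p. lorentzian_product (g p)) \<and>
     (\<forall>c\<in>A. \<forall>u v. smooth_on ((\<lambda>q. g q (vector_from A c q u) (vector_from A c q v)) \<circ> inv_chart c)
                    (snd c ` fst c))"

definition orientation_form ::
    "('m, 'e::euclidean_space) chart set \<Rightarrow> ('m \<Rightarrow> 'e form) \<Rightarrow> bool" where
  "orientation_form A vol \<longleftrightarrow>
     smooth_form_deg A UNIV DIM('e) vol \<and> (\<forall>p. vol p \<noteq> (\<lambda>_. 0))"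

definition time_orientation ::
    "('m, 'e::euclidean_space) chart set \<Rightarrow> ('m \<Rightarrow> 'e \<Rightarrow> 'e \<Rightarrow> real) \<Rightarrow> ('m \<Rightarrow> 'e) \<Rightarrow> bool" where
  "time_orientation A g T \<longleftrightarrow> smooth_vector_field A UNIV T \<and> (\<forall>p. g p (T p) (T p) < 0)"


section \<open>Spin structures\<close>

text \<open>
  The Clifford algebra with generators \<open>e\<^sub>0, \<dots>, e\<^sub>n\<^sub>-\<^sub>1\<close> and relations \<open>e\<^sub>i e\<^sub>j + e\<^sub>j e\<^sub>i = 2 eta i j\<close>. An element
  is given by its coefficients in the basis \<open>e\<^sub>S\<close>, \<open>S \<subseteq> {..<n}\<close>, of ordered products of generators.
\<close>

type_synonym clifford = "nat set \<Rightarrow> real"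

definition clifford_sign :: "nat set \<Rightarrow> nat set \<Rightarrow> real" where
  "clifford_sign S T = (- 1) ^ card {(i, j). i \<in> S \<and> j \<in> T \<and> j < i} * (\<Prod>i \<in> S \<inter> T. eta i i)"

definition clifford_mult :: "nat \<Rightarrow> clifford \<Rightarrow> clifford \<Rightarrow> clifford" where
  "clifford_mult n a b R =
     (\<Sum>S \<in> Pow {..<n}. \<Sum>T \<in> Pow {..<n}.
        if (S - T) \<union> (T - S) = R then clifford_sign S T * a S * b T else 0)"

definition clifford_unit :: clifford where
  "clifford_unit R = (if R = {} then 1 else 0)"

definition clifford_vector :: "nat \<Rightarrow> (nat \<Rightarrow> real) \<Rightarrow> clifford" where
  "clifford_vector n x R = (\<Sum>i<n. if R = {i} then x i else 0)"

definition minkowski_square :: "nat \<Rightarrow> (nat \<Rightarrow> real) \<Rightarrow> real" where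
  "minkowski_square n x = (\<Sum>i<n. eta i i * (x i)\<^sup>2)"

text \<open>
  The subgroup of \<open>Spin(1, n-1)\<close> lying over the group of proper orthochronous Lorentz
  transformations: products of an even number of unit vectors, an even number of them timelike.
\<close>

definition spin_plus :: "nat \<Rightarrow> clifford set" where
  "spin_plus n =
     {foldr (clifford_mult n) (map (clifford_vector n) xs) clifford_unit | xs.
        even (length xs) \<and>
        (\<forall>x \<in> set xs. minkowski_square n x = 1 \<or> minkowski_square n x = - 1) \<and>
        even (length (filter (\<lambda>x. minkowski_square n x = - 1) xs))}"

definition oriented_orthonormal_frame ::
    "('m::topological_space, 'e::euclidean_space) chart set \<Rightarrow> ('m \<Rightarrow> 'e \<Rightarrow> 'e \<Rightarrow> real) \<Rightarrow> ('m \<Rightarrow> 'e form)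
       \<Rightarrow> ('m \<Rightarrow> 'e) \<Rightarrow> 'm set \<Rightarrow> (nat \<Rightarrow> 'm \<Rightarrow> 'e) \<Rightarrow> bool" where
  "oriented_orthonormal_frame A g vol T V E \<longleftrightarrow>
     open V \<and> (\<forall>i<DIM('e). smooth_vector_field A V (E i)) \<and>
     (\<forall>p\<in>V. (\<forall>i<DIM('e). \<forall>j<DIM('e). g p (E i p) (E j p) = eta i j) \<and>
        0 < vol p (map (\<lambda>i. E i p) [0..<DIM('e)]) \<and> g p (E 0 p) (T p) < 0)"

text \<open>
  On overlaps \<open>E' j = (\<Sum>i. \<Lambda>\<^sub>i\<^sub>j E i)\<close> with \<open>\<Lambda>\<^sub>i\<^sub>j = eta i i * g (E i) (E' j)\<close>. The element \<open>s\<close> is a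
  lift of this matrix to the spin group when \<open>s e\<^sub>j s\<inverse> = (\<Sum>i. \<Lambda>\<^sub>i\<^sub>j e\<^sub>i)\<close>.
\<close>

definition spin_lift ::
    "('e::euclidean_space \<Rightarrow> 'e \<Rightarrow> real) \<Rightarrow> (nat \<Rightarrow> 'e) \<Rightarrow> (nat \<Rightarrow> 'e) \<Rightarrow> clifford \<Rightarrow> bool" where
  "spin_lift h b b' s \<longleftrightarrow>
     s \<in> spin_plus DIM('e) \<and>
     (\<forall>j<DIM('e).
        clifford_mult DIM('e) s (clifford_vector DIM('e) (\<lambda>i. if i = j then 1 else 0)) =
        clifford_mult DIM('e) (clifford_vector DIM('e) (\<lambda>i. eta i i * h (b i) (b' j))) s)"

text \<open>
  A spin structure, given as a cocycle with values in the spin group which lifts the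
  transition functions of the bundle of oriented and time-oriented orthonormal frames.
\<close>

definition spin_manifold ::
    "('m::topological_space, 'e::euclidean_space) chart set \<Rightarrow> ('m \<Rightarrow> 'e \<Rightarrow> 'e \<Rightarrow> real) \<Rightarrow> ('m \<Rightarrow> 'e form)
       \<Rightarrow> ('m \<Rightarrow> 'e) \<Rightarrow> bool" where
  "spin_manifold A g vol T \<longleftrightarrow>
     (\<exists>(F :: ('m set \<times> (nat \<Rightarrow> 'm \<Rightarrow> 'e)) set) s.
        (\<forall>(V, E) \<in> F. oriented_orthonormal_frame A g vol T V E) \<and>
        (\<Union>(V, E) \<in> F. V) = UNIV \<and>
        (\<forall>a\<in>F. \<forall>b\<in>F.
           (\<forall>R. smooth_function A (fst a \<inter> fst b) (\<lambda>p. s a b p R)) \<and>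
           (\<forall>p \<in> fst a \<inter> fst b.
              spin_lift (g p) (\<lambda>i. snd a i p) (\<lambda>i. snd b i p) (s a b p))) \<and>
        (\<forall>a\<in>F. \<forall>b\<in>F. \<forall>c\<in>F. \<forall>p \<in> fst a \<inter> fst b \<inter> fst c.
           clifford_mult DIM('e) (s a b p) (s b c p) = s a c p))"


section \<open>Lorentzian manifolds subject to the standing assumptions\<close>

definition lorentzian_spin_manifold ::
    "('m::{t2_space,second_countable_topology}, 'e::euclidean_space) chart set
       \<Rightarrow> ('m \<Rightarrow> 'e \<Rightarrow> 'e \<Rightarrow> real) \<Rightarrow> ('m \<Rightarrow> 'e form) \<Rightarrow> ('m \<Rightarrow> 'e) \<Rightarrow> bool" where
  "lorentzian_spin_manifold A g vol T \<longleftrightarrow>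
     smooth_atlas A \<and> lorentzian_metric A g \<and>
     orientation_form A vol \<and> time_orientation A g T \<and> spin_manifold A g vol T \<and>
     simply_connected (UNIV :: 'm set)"

definition nowhere_vanishing_null_1form ::
    "('m, 'e::euclidean_space) chart set \<Rightarrow> ('m \<Rightarrow> 'e \<Rightarrow> 'e \<Rightarrow> real) \<Rightarrow> ('m \<Rightarrow> 'e form) \<Rightarrow> bool" where
  "nowhere_vanishing_null_1form A g \<kappa> \<longleftrightarrow>
     smooth_form_deg A UNIV 1 \<kappa> \<and>
     (\<forall>p. \<kappa> p \<noteq> (\<lambda>_. 0) \<and> g p (raise (g p) (\<kappa> p) []) (raise (g p) (\<kappa> p) []) = 0)"


section \<open>Adapted coframes and the two products\<close>

text \<open>
  A local pseudo-orthonormal coframe \<open>(e\<^sup>-, e\<^sup>+, e\<^sup>i)\<close> on \<open>U\<close> with \<open>e\<^sup>- = \<kappa>\<close>; the transverse indices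
  run over \<open>0, \<dots>, n-3\<close>. The symmetric product is
  \<open>2 e\<^sup>- e\<^sup>+ = e\<^sup>- \<otimes> e\<^sup>+ + e\<^sup>+ \<otimes> e\<^sup>-\<close>. That the forms are a basis at every point
  follows from the nondegeneracy of \<open>g\<close>.
\<close>

definition adapted_coframe ::
    "('m::topological_space, 'e::euclidean_space) chart set \<Rightarrow> ('m \<Rightarrow> 'e \<Rightarrow> 'e \<Rightarrow> real) \<Rightarrow> ('m \<Rightarrow> 'e form)
       \<Rightarrow> 'm set \<Rightarrow> ('m \<Rightarrow> 'e form) \<Rightarrow> (nat \<Rightarrow> 'm \<Rightarrow> 'e form) \<Rightarrow> bool" where
  "adapted_coframe A g \<kappa> U ep et \<longleftrightarrow>
     open U \<and> smooth_form_deg A U 1 ep \<and> (\<forall>i<DIM('e) - 2. smooth_form_deg A U 1 (et i)) \<and>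
     (\<forall>p\<in>U. \<forall>u v. g p u v =
        \<kappa> p [u] * ep p [v] + ep p [u] * \<kappa> p [v] + (\<Sum>i<DIM('e) - 2. et i p [u] * et i p [v]))"

text \<open>
  The vectors \<open>e\<^sub>-\<close> and \<open>e\<^sub>i\<close> of the dual frame, at one point.
\<close>

definition dual_minus :: "'e::euclidean_space form \<Rightarrow> 'e form \<Rightarrow> (nat \<Rightarrow> 'e form) \<Rightarrow> 'e" where
  "dual_minus em ep et =
     (THE v. em [v] = 1 \<and> ep [v] = 0 \<and> (\<forall>j<DIM('e) - 2. et j [v] = 0))"

definition dual_transverse ::
    "'e::euclidean_space form \<Rightarrow> 'e form \<Rightarrow> (nat \<Rightarrow> 'e form) \<Rightarrow> nat \<Rightarrow> 'e" where
  "dual_transverse em ep et i =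
     (THE v. em [v] = 0 \<and> ep [v] = 0 \<and> (\<forall>j<DIM('e) - 2. et j [v] = (if j = i then 1 else 0)))"

text \<open>
  The coefficients \<open>\<phi>_{i\<^sub>1\<dots>i\<^sub>l}\<close> in \<open>\<phi> = 1/l! \<phi>_{i\<^sub>1\<dots>i\<^sub>l} e\<^sup>- \<and> e^{i\<^sub>1} \<and> \<dots> \<and> e^{i\<^sub>l}\<close> are the values
  \<open>\<phi>(e\<^sub>-, e_{i\<^sub>1}, \<dots>, e_{i\<^sub>l})\<close>, and \<open>breve\<close> is \<open>1/l! \<phi>_{i\<^sub>1\<dots>i\<^sub>l} e^{i\<^sub>1} \<and> \<dots> \<and> e^{i\<^sub>l}\<close>. Only the summand
  with \<open>l\<close> equal to the number of arguments is nonzero.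
\<close>

definition breve ::
    "'e::euclidean_space form \<Rightarrow> 'e form \<Rightarrow> (nat \<Rightarrow> 'e form) \<Rightarrow> 'e form \<Rightarrow> 'e form" where
  "breve em ep et \<phi> vs =
     1 / fact (length vs) *
     (\<Sum>is \<in> {is. length is = length vs \<and> set is \<subseteq> {..<DIM('e) - 2}}.
        \<phi> (dual_minus em ep et # map (dual_transverse em ep et) is) * wedge_list (map et is) vs)"

definition bar_curlywedge_local ::
    "('e::euclidean_space \<Rightarrow> 'e \<Rightarrow> real) \<Rightarrow> 'e form \<Rightarrow> 'e form \<Rightarrow> (nat \<Rightarrow> 'e form) \<Rightarrow> 'e form \<Rightarrow> 'e form
       \<Rightarrow> 'e form" where
  "bar_curlywedge_local g em ep et lam \<phi> =
     wedge em (insertion (raise g (breve em ep et lam)) (breve em ep et \<phi>))"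

definition curlywedge_local ::
    "'e::euclidean_space form \<Rightarrow> 'e form \<Rightarrow> (nat \<Rightarrow> 'e form) \<Rightarrow> 'e form \<Rightarrow> 'e form \<Rightarrow> 'e form" where
  "curlywedge_local em ep et lam \<phi> = wedge lam (breve em ep et \<phi>)"

text \<open>
  A global form is the product of \<open>lam\<close> and \<open>\<phi>\<close> when it is given by the local expression in every
  adapted coframe, on the whole domain of that coframe.
\<close>

definition is_bar_curlywedge ::
    "('m::topological_space, 'e::euclidean_space) chart set \<Rightarrow> ('m \<Rightarrow> 'e \<Rightarrow> 'e \<Rightarrow> real) \<Rightarrow> ('m \<Rightarrow> 'e form)
       \<Rightarrow> ('m \<Rightarrow> 'e form) \<Rightarrow> ('m \<Rightarrow> 'e form) \<Rightarrow> ('m \<Rightarrow> 'e form) \<Rightarrow> bool" where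
  "is_bar_curlywedge A g \<kappa> lam \<phi> \<psi> \<longleftrightarrow>
     smooth_form A UNIV \<psi> \<and>
     (\<forall>U ep et. adapted_coframe A g \<kappa> U ep et \<longrightarrow>
        (\<forall>p\<in>U. \<psi> p = bar_curlywedge_local (g p) (\<kappa> p) (ep p) (\<lambda>i. et i p) (lam p) (\<phi> p)))"

definition is_curlywedge ::
    "('m::topological_space, 'e::euclidean_space) chart set \<Rightarrow> ('m \<Rightarrow> 'e \<Rightarrow> 'e \<Rightarrow> real) \<Rightarrow> ('m \<Rightarrow> 'e form)
       \<Rightarrow> ('m \<Rightarrow> 'e form) \<Rightarrow> ('m \<Rightarrow> 'e form) \<Rightarrow> ('m \<Rightarrow> 'e form) \<Rightarrow> bool" where
  "is_curlywedge A g \<kappa> lam \<phi> \<psi> \<longleftrightarrow>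
     smooth_form A UNIV \<psi> \<and>
     (\<forall>U ep et. adapted_coframe A g \<kappa> U ep et \<longrightarrow>
        (\<forall>p\<in>U. \<psi> p = curlywedge_local (\<kappa> p) (ep p) (\<lambda>i. et i p) (lam p) (\<phi> p)))"


section \<open>Metric connections\<close>

text \<open>
  \<open>D p v Y\<close> is the covariant derivative at \<open>p\<close>, in the direction of the tangent vector \<open>v\<close>, of a vector field
  \<open>Y\<close> which is smooth on a neighbourhood of \<open>p\<close>; the connection thus acts on
  local vector fields. Its values on other \<open>Y\<close> are irrelevant. No condition is imposed on
  the torsion.
\<close>

type_synonym ('m, 'e) cov_derivative = "'m \<Rightarrow> 'e \<Rightarrow> ('m \<Rightarrow> 'e) \<Rightarrow> 'e"

definition affine_connection ::
    "('m::topological_space, 'e::euclidean_space) chart set \<Rightarrow> ('m, 'e) cov_derivative \<Rightarrow> bool" where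
  "affine_connection A D \<longleftrightarrow>
     (\<forall>U Y. open U \<and> smooth_vector_field A U Y \<longrightarrow>
        (\<forall>p\<in>U. linear (\<lambda>v. D p v Y)) \<and>
        (\<forall>Z. (\<forall>q\<in>U. Z q = Y q) \<longrightarrow> (\<forall>p\<in>U. \<forall>v. D p v Z = D p v Y)) \<and>
        (\<forall>Z. smooth_vector_field A U Z \<longrightarrow>
           (\<forall>p\<in>U. \<forall>v. D p v (\<lambda>q. Y q + Z q) = D p v Y + D p v Z)) \<and>
        (\<forall>f. smooth_function A U f \<longrightarrow>
           (\<forall>p\<in>U. \<forall>v. D p v (\<lambda>q. f q *\<^sub>R Y q) =
              directional_derivative A p v f *\<^sub>R Y p + f p *\<^sub>R D p v Y)) \<and>
        (\<forall>X. smooth_vector_field A U X \<longrightarrow> smooth_vector_field A U (\<lambda>q. D q (X q) Y)))"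

definition metric_connection ::
    "('m::topological_space, 'e::euclidean_space) chart set \<Rightarrow> ('m \<Rightarrow> 'e \<Rightarrow> 'e \<Rightarrow> real)
       \<Rightarrow> ('m, 'e) cov_derivative \<Rightarrow> bool" where
  "metric_connection A g D \<longleftrightarrow>
     affine_connection A D \<and>
     (\<forall>U Y Z. open U \<and> smooth_vector_field A U Y \<and> smooth_vector_field A U Z \<longrightarrow>
        (\<forall>p\<in>U. \<forall>v. directional_derivative A p v (\<lambda>q. g q (Y q) (Z q)) =
           g p (D p v Y) (Z p) + g p (Y p) (D p v Z)))"

text \<open>
  The value of the covariant derivative of \<open>\<omega>\<close> on the vector fields \<open>Ys\<close>.
\<close>

definition cov_derivative_form ::
    "('m, 'e::euclidean_space) chart set \<Rightarrow> ('m, 'e) cov_derivative \<Rightarrow> ('m \<Rightarrow> 'e form)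
       \<Rightarrow> 'm \<Rightarrow> 'e \<Rightarrow> ('m \<Rightarrow> 'e) list \<Rightarrow> real" where
  "cov_derivative_form A D \<omega> p v Ys =
     directional_derivative A p v (\<lambda>q. \<omega> q (map (\<lambda>Y. Y q) Ys)) -
     (\<Sum>i<length Ys. \<omega> p ((map (\<lambda>Y. Y p) Ys)[i := D p v (Ys ! i)]))"

definition covariantly_constant ::
    "('m::topological_space, 'e::euclidean_space) chart set \<Rightarrow> ('m, 'e) cov_derivative
       \<Rightarrow> ('m \<Rightarrow> 'e form) \<Rightarrow> bool" where
  "covariantly_constant A D \<omega> \<longleftrightarrow>
     (\<forall>U Ys. open U \<and> (\<forall>Y \<in> set Ys. smooth_vector_field A U Y) \<longrightarrow>
        (\<forall>p\<in>U. \<forall>v. cov_derivative_form A D \<omega> p v Ys = 0))"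

end

theory Submission
  imports Defs
begin

text \<open>
  The local transverse forms depend on the coframe, but the products do not, because both have a description in
  which the coframe enters only through one vector. Let \<open>N\<close> be a vector with \<open>\<kappa>(N) = 1\<close>. As
  \<open>\<kappa> \<and> \<phi> = 0\<close>, contraction with \<open>N\<close> gives \<open>\<phi> = \<kappa> \<and> i\<^sub>N \<phi>\<close>. When \<open>N\<close> is the vector
  \<open>e\<^sub>-\<close> of the dual frame of an adapted coframe, \<open>i\<^sub>N \<phi>\<close> is exactly the local transverse form:
  \<open>\<phi>\<close> is also annihilated by the vector dual to \<open>\<kappa>\<close>, so only the transverse components of the remaining
  arguments matter (\<open>breve_eq_interior_product\<close>). Another \<open>N\<close> with \<open>\<kappa>(N) = 1\<close> changes \<open>i\<^sub>N \<phi>\<close> by a multiple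
  of \<open>\<kappa>\<close>. In \<open>\<lambda> \<and> i\<^sub>N \<phi>\<close> this change is killed by \<open>\<lambda>\<close>, which is itself a multiple of \<open>\<kappa>\<close>
  (\<open>curlywedge_independent\<close>). In the other product, where \<open>i\<^sub>N \<lambda>\<close> and \<open>i\<^sub>N \<phi>\<close> are contracted over one index
  and then multiplied by \<open>\<kappa>\<close>, the change either meets the factor \<open>\<kappa>\<close>, or it contracts the other form with
  the vector dual to \<open>\<kappa>\<close>, which gives 0 (\<open>bar_curlywedge_independent\<close>). Hence both products may be computed
  with any \<open>N\<close>.

  A global smooth choice is the time orientation divided by its pairing with \<open>\<kappa>\<close>, which is nonzero since a
  timelike vector is never orthogonal to a null one. This gives globally defined smooth forms. They are the only ones
  with the prescribed local expressions because there is an adapted coframe around every point: it is obtained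
  from an orthonormal frame, as provided by the spin structure, by a reflection
  that turns the spatial part of \<open>\<kappa>\<close> into the direction of a coordinate axis (\<open>reflected_coframe\<close>).

  For the covariant derivative, a form is parallel exactly if, evaluated on vector fields along a
  coordinate line through \<open>p\<close>, it agrees to first order with its value at \<open>p\<close> on the vectors
  \<open>Y(p) + t D\<^sub>v Y\<close> (\<open>cov_derivative_form_eq_0_iff_contact\<close>). Agreement to first order is compatible with
  sums, exterior products and interior products. So each product of parallel forms agrees to first order with the product
  formed at \<open>p\<close> with \<open>N(p) + t D\<^sub>v N\<close>. Since \<open>\<kappa>\<close> is parallel, \<open>\<kappa>\<close> has the value 1 on this vector as well, and by the
  independence of \<open>N\<close> the product formed with it is the product at \<open>p\<close>, for every \<open>t\<close>. For the second product
  one needs in addition that the derivative of an orthonormal frame is skew, which is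
  the compatibility of the connection with the metric.
\<close>

section \<open>Calculus of smooth functions\<close>

lemma Ck_on_cong:
  assumes "open S" "Ck_on k f S" "\<And>x. x \<in> S \<Longrightarrow> f x = h x"
  shows "Ck_on k h S"
proof (cases k)
  case 0
  then show ?thesis using assms by (simp cong: continuous_on_cong)
next
  case (Suc m)
  then obtain f' where "\<forall>x\<in>S. (f has_derivative f' x) (at x)" "\<forall>v. Ck_on m (\<lambda>x. f' x v) S"
    using assms by auto
  moreover from this have "\<forall>x\<in>S. (h has_derivative f' x) (at x)"
    using assms has_derivative_transform_within_open by blast
  ultimately show ?thesis using Suc by auto
qed

lemma Ck_on_subset: "Ck_on k f S \<Longrightarrow> S' \<subseteq> S \<Longrightarrow> Ck_on k f S'"
proof (induction k arbitrary: f)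
  case 0
  then show ?case by (simp add: continuous_on_subset)
next
  case (Suc k)
  then obtain f' where "\<forall>x\<in>S. (f has_derivative f' x) (at x)" "\<forall>v. Ck_on k (\<lambda>x. f' x v) S"
    by auto
  with Suc show ?case by (auto intro!: exI[of _ f'])
qed

lemma Ck_on_Suc_imp_Ck_on: "Ck_on (Suc k) f S \<Longrightarrow> Ck_on k f S"
proof (induction k arbitrary: f)
  case 0
  then obtain f' where "\<forall>x\<in>S. (f has_derivative f' x) (at x)" by auto
  then have "\<forall>x\<in>S. isCont f x" using has_derivative_continuous by blast
  then show ?case by (simp add: continuous_at_imp_continuous_on)
next
  case (Suc k)
  then obtain f' where "\<forall>x\<in>S. (f has_derivative f' x) (at x)" "\<forall>v. Ck_on (Suc k) (\<lambda>x. f' x v) S"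
    using Ck_on.simps(2)[of "Suc k" f S] by blast
  with Suc.IH show ?case unfolding Ck_on.simps(2)[of k f S] by blast
qed

lemma Ck_on_const: "Ck_on k (\<lambda>x. a) S"
proof (induction k arbitrary: a)
  case (Suc k)
  then show ?case by (auto intro!: exI[of _ "\<lambda>x v. 0"])
qed simp

lemma Ck_on_add: "Ck_on k f S \<Longrightarrow> Ck_on k h S \<Longrightarrow> Ck_on k (\<lambda>x. f x + h x) S"
proof (induction k arbitrary: f h)
  case 0
  then show ?case by (simp add: continuous_on_add)
next
  case (Suc k)
  then obtain f' h' where f': "\<forall>x\<in>S. (f has_derivative f' x) (at x)" "\<forall>v. Ck_on k (\<lambda>x. f' x v) S"
    and h': "\<forall>x\<in>S. (h has_derivative h' x) (at x)" "\<forall>v. Ck_on k (\<lambda>x. h' x v) S"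
    by auto
  show ?case
    using f' h' Suc.IH by (auto intro!: exI[of _ "\<lambda>x v. f' x v + h' x v"] has_derivative_add)
qed

lemma Ck_on_bounded_linear: "bounded_linear L \<Longrightarrow> Ck_on k f S \<Longrightarrow> Ck_on k (\<lambda>x. L (f x)) S"
proof (induction k arbitrary: f)
  case 0
  then show ?case by (simp add: bounded_linear.continuous_on)
next
  case (Suc k)
  then obtain f' where f': "\<forall>x\<in>S. (f has_derivative f' x) (at x)" "\<forall>v. Ck_on k (\<lambda>x. f' x v) S"
    by auto
  have "\<forall>x\<in>S. ((\<lambda>x. L (f x)) has_derivative (\<lambda>v. L (f' x v))) (at x)"
    using f' bounded_linear.has_derivative[OF Suc.prems(1)] by blast
  moreover have "\<forall>v. Ck_on k (\<lambda>x. L (f' x v)) S"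
    using f' Suc.IH[OF Suc.prems(1)] by blast
  ultimately show ?case
    unfolding Ck_on.simps by (intro exI[of _ "\<lambda>x v. L (f' x v)"]) blast
qed

lemma Ck_on_scaleR:
  fixes f :: "'a::real_normed_vector \<Rightarrow> real" and h :: "'a \<Rightarrow> 'b::real_normed_vector"
  shows "Ck_on k f S \<Longrightarrow> Ck_on k h S \<Longrightarrow> Ck_on k (\<lambda>x. f x *\<^sub>R h x) S"
proof (induction k arbitrary: f h)
  case 0
  then show ?case by (simp add: continuous_on_scaleR)
next
  case (Suc k)
  then obtain f' h' where f': "\<forall>x\<in>S. (f has_derivative f' x) (at x)" "\<forall>v. Ck_on k (\<lambda>x. f' x v) S"
    and h': "\<forall>x\<in>S. (h has_derivative h' x) (at x)" "\<forall>v. Ck_on k (\<lambda>x. h' x v) S"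
    by auto
  have "Ck_on k f S" "Ck_on k h S"
    using Suc.prems Ck_on_Suc_imp_Ck_on by blast+
  then have "Ck_on k (\<lambda>x. f x *\<^sub>R h' x v + f' x v *\<^sub>R h x) S" for v
    using f' h' Suc.IH by (intro Ck_on_add) auto
  moreover have "\<forall>x\<in>S. ((\<lambda>x. f x *\<^sub>R h x) has_derivative (\<lambda>v. f x *\<^sub>R h' x v + f' x v *\<^sub>R h x)) (at x)"
    using f' h' by (auto intro!: has_derivative_scaleR)
  ultimately show ?case
    by (auto intro!: exI[of _ "\<lambda>x v. f x *\<^sub>R h' x v + f' x v *\<^sub>R h x"])
qed

lemma Ck_on_inverse:
  fixes f :: "'a::real_normed_vector \<Rightarrow> real"
  assumes "\<And>x. x \<in> S \<Longrightarrow> f x \<noteq> 0"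
  shows "Ck_on k f S \<Longrightarrow> Ck_on k (\<lambda>x. inverse (f x)) S"
proof (induction k)
  case 0
  then show ?case using assms by (simp add: continuous_on_inverse)
next
  case (Suc k)
  then obtain f' where f': "\<forall>x\<in>S. (f has_derivative f' x) (at x)" "\<forall>v. Ck_on k (\<lambda>x. f' x v) S"
    by auto
  have inv: "Ck_on k (\<lambda>x. inverse (f x)) S"
    using Suc Ck_on_Suc_imp_Ck_on by blast
  have "Ck_on k (\<lambda>x. (-1) *\<^sub>R (inverse (f x) *\<^sub>R f' x v *\<^sub>R inverse (f x))) S" for v
    using f' inv by (intro Ck_on_scaleR Ck_on_const) auto
  then have "Ck_on k (\<lambda>x. - (inverse (f x) * f' x v * inverse (f x))) S" for v
    by (simp add: mult.assoc)
  moreover have "\<forall>x\<in>S. ((\<lambda>x. inverse (f x)) has_derivative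
      (\<lambda>v. - (inverse (f x) * f' x v * inverse (f x)))) (at x)"
    using f' assms by (auto intro!: has_derivative_inverse)
  ultimately show ?case
    by (auto intro!: exI[of _ "\<lambda>x v. - (inverse (f x) * f' x v * inverse (f x))"])
qed

text \<open>The derivatives on overlapping neighbourhoods agree because derivatives are unique.\<close>

lemma Ck_on_locally:
  assumes "open S" "\<And>x. x \<in> S \<Longrightarrow> \<exists>W. open W \<and> x \<in> W \<and> Ck_on k f (S \<inter> W)"
  shows "Ck_on k f S"
  using assms(2)
proof (induction k arbitrary: f)
  case 0
  have "continuous (at x) f" if x: "x \<in> S" for x
  proof -
    obtain W where "open W" "x \<in> W" "continuous_on (S \<inter> W) f"
      using 0[OF x] by auto
    then show ?thesis
      using x \<open>open S\<close> continuous_on_eq_continuous_at[of "S \<inter> W" f] by auto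
  qed
  then show ?case by (simp add: continuous_at_imp_continuous_on)
next
  case (Suc k)
  let ?f' = "\<lambda>x. frechet_derivative f (at x)"
  have loc: "\<exists>W. open W \<and> x \<in> W \<and> (\<forall>y\<in>S \<inter> W. (f has_derivative ?f' y) (at y)) \<and>
      (\<forall>v. Ck_on k (\<lambda>y. ?f' y v) (S \<inter> W))" if x: "x \<in> S" for x
  proof -
    obtain W f' where W: "open W" "x \<in> W" and f': "\<forall>y\<in>S \<inter> W. (f has_derivative f' y) (at y)"
      "\<forall>v. Ck_on k (\<lambda>x. f' x v) (S \<inter> W)"
      using Suc.prems[OF x] by auto
    have eq: "f' y = ?f' y" if "y \<in> S \<inter> W" for y
      using f' that frechet_derivative_at by blast
    have "Ck_on k (\<lambda>y. ?f' y v) (S \<inter> W)" for v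
      using Ck_on_cong[of "S \<inter> W" k "\<lambda>x. f' x v" "\<lambda>x. ?f' x v"] f'(2) eq W \<open>open S\<close> by auto
    then show ?thesis using W f' eq by auto
  qed
  have "\<forall>x\<in>S. (f has_derivative ?f' x) (at x)"
    using loc by blast
  moreover have "Ck_on k (\<lambda>x. ?f' x v) S" for v
    by (rule Suc.IH) (use loc in blast)
  ultimately show ?case by auto
qed

lemma smooth_on_cong:
  "open S \<Longrightarrow> smooth_on f S \<Longrightarrow> (\<And>x. x \<in> S \<Longrightarrow> f x = h x) \<Longrightarrow> smooth_on h S"
  unfolding smooth_on_def by (blast intro: Ck_on_cong)

lemma smooth_on_subset: "smooth_on f S \<Longrightarrow> S' \<subseteq> S \<Longrightarrow> smooth_on f S'"
  unfolding smooth_on_def by (blast intro: Ck_on_subset)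

lemma smooth_on_const: "smooth_on (\<lambda>x. a) S"
  unfolding smooth_on_def by (simp add: Ck_on_const)

lemma smooth_on_add: "smooth_on f S \<Longrightarrow> smooth_on h S \<Longrightarrow> smooth_on (\<lambda>x. f x + h x) S"
  unfolding smooth_on_def by (blast intro: Ck_on_add)

lemma smooth_on_bounded_linear: "bounded_linear L \<Longrightarrow> smooth_on f S \<Longrightarrow> smooth_on (\<lambda>x. L (f x)) S"
  unfolding smooth_on_def by (blast intro: Ck_on_bounded_linear)

lemma smooth_on_scaleR:
  fixes f :: "'a::real_normed_vector \<Rightarrow> real" and h :: "'a \<Rightarrow> 'b::real_normed_vector"
  shows "smooth_on f S \<Longrightarrow> smooth_on h S \<Longrightarrow> smooth_on (\<lambda>x. f x *\<^sub>R h x) S"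
  unfolding smooth_on_def by (blast intro: Ck_on_scaleR)

lemma smooth_on_inverse:
  fixes f :: "'a::real_normed_vector \<Rightarrow> real"
  shows "smooth_on f S \<Longrightarrow> (\<And>x. x \<in> S \<Longrightarrow> f x \<noteq> 0) \<Longrightarrow> smooth_on (\<lambda>x. inverse (f x)) S"
  unfolding smooth_on_def by (blast intro: Ck_on_inverse)

lemma smooth_on_locally:
  assumes "open S" "\<And>x. x \<in> S \<Longrightarrow> \<exists>W. open W \<and> x \<in> W \<and> smooth_on f (S \<inter> W)"
  shows "smooth_on f S"
  unfolding smooth_on_def
proof (intro allI Ck_on_locally[OF assms(1)])
  show "\<exists>W. open W \<and> x \<in> W \<and> Ck_on k f (S \<inter> W)" if x: "x \<in> S" for k x
    using assms(2)[OF x] unfolding smooth_on_def by blast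
qed

lemma smooth_on_imp_continuous_on: "smooth_on f S \<Longrightarrow> continuous_on S f"
  unfolding smooth_on_def using Ck_on.simps(1)[of f S] by blast

lemma smooth_on_imp_differentiable:
  assumes "smooth_on f S" "x \<in> S" shows "f differentiable (at x)"
proof -
  have "Ck_on (Suc 0) f S" using assms(1) unfolding smooth_on_def by blast
  then show ?thesis using assms(2) by (auto simp: differentiable_def)
qed


section \<open>Exterior algebra\<close>

definition interior_product :: "'e \<Rightarrow> 'e form \<Rightarrow> 'e form" where
  "interior_product v \<alpha> = (\<lambda>vs. \<alpha> (v # vs))"

text \<open>The grading automorphism, which supplies the signs in the antiderivation rule.\<close>

definition parity :: "'e form \<Rightarrow> 'e form" where
  "parity \<alpha> = (\<lambda>vs. (- 1) ^ length vs * \<alpha> vs)"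

lemma interior_product_apply: "interior_product v \<alpha> vs = \<alpha> (v # vs)"
  by (simp add: interior_product_def)

lemma shuffle_sign_insert_0: "shuffle_sign (insert 0 (Suc ` S)) = shuffle_sign S"
proof -
  have "{(i, j). i \<in> insert 0 (Suc ` S) \<and> j < i \<and> j \<notin> insert 0 (Suc ` S)}
      = map_prod Suc Suc ` {(i, j). i \<in> S \<and> j < i \<and> j \<notin> S}" (is "?L = ?R")
  proof
    show "?L \<subseteq> ?R"
    proof (rule subrelI)
      fix i j assume "(i, j) \<in> ?L"
      then have a: "i \<in> insert 0 (Suc ` S)" "j < i" "j \<notin> insert 0 (Suc ` S)" by auto
      then obtain i' j' where "i = Suc i'" "j = Suc j'" by (cases i; cases j) auto
      with a have "(i', j') \<in> {(i, j). i \<in> S \<and> j < i \<and> j \<notin> S}" "(i, j) = map_prod Suc Suc (i', j')"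
        by auto
      then show "(i, j) \<in> ?R" by blast
    qed
  qed auto
  moreover have "inj (map_prod Suc Suc)" by (simp add: prod.inj_map)
  ultimately show ?thesis
    unfolding shuffle_sign_def by (simp add: card_image inj_on_subset)
qed

lemma shuffle_sign_Suc_image:
  assumes "finite S" shows "shuffle_sign (Suc ` S) = (- 1) ^ card S * shuffle_sign S"
proof -
  let ?K = "{(i, j). i \<in> S \<and> j < i \<and> j \<notin> S}"
  have fin: "finite ?K"
  proof (rule finite_subset)
    show "?K \<subseteq> S \<times> {..Max S}"
      using assms by (auto intro: order_trans[OF less_imp_le Max_ge])
  qed (use assms in simp)
  have "{(i, j). i \<in> Suc ` S \<and> j < i \<and> j \<notin> Suc ` S}
      = (\<lambda>i. (Suc i, 0)) ` S \<union> map_prod Suc Suc ` ?K" (is "?L = ?A \<union> ?B")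
  proof
    show "?L \<subseteq> ?A \<union> ?B"
    proof (rule subrelI)
      fix i j assume "(i, j) \<in> ?L"
      then obtain i' where a: "i = Suc i'" "i' \<in> S" "j < Suc i'" "j \<notin> Suc ` S" by auto
      show "(i, j) \<in> ?A \<union> ?B"
      proof (cases j)
        case 0
        with a show ?thesis by auto
      next
        case (Suc j')
        with a have "(i', j') \<in> ?K" "(i, j) = map_prod Suc Suc (i', j')" by auto
        then show ?thesis by blast
      qed
    qed
  qed auto
  moreover have "card (?A \<union> ?B) = card ?A + card ?B"
    by (rule card_Un_disjoint) (use assms fin in auto)
  moreover have "card ?A = card S" by (rule card_image) (auto simp: inj_on_def)
  moreover have "card ?B = card ?K"
    by (rule card_image) (simp add: inj_on_subset[OF prod.inj_map[of Suc Suc]])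
  ultimately show ?thesis
    unfolding shuffle_sign_def by (simp add: power_add)
qed

lemma wedge_Nil: "wedge \<alpha> \<beta> [] = \<alpha> [] * \<beta> []"
  by (simp add: wedge_def shuffle_sign_def)

text \<open>
  The first argument goes either to the first factor or to the second one; in the latter case
  it is moved past all the arguments of the first factor, which gives the sign.
  This recursion is the antiderivation rule for the interior product, and it reduces
  the algebra of shuffles to inductions on the list of arguments.
\<close>

lemma wedge_Cons:
  "wedge \<alpha> \<beta> (v # vs) =
     wedge (interior_product v \<alpha>) \<beta> vs + wedge (parity \<alpha>) (interior_product v \<beta>) vs"
proof -
  let ?n = "length vs"
  let ?P = "Pow {..<?n}"
  let ?t = "\<lambda>S. shuffle_sign S * \<alpha> (nths (v # vs) S) * \<beta> (nths (v # vs) (- S))"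
  have split: "Pow {..<Suc ?n} = ((`) Suc) ` ?P \<union> (insert 0 \<circ> (`) Suc) ` ?P"
    by (simp add: lessThan_Suc_eq_insert_0 Pow_insert image_Pow_surj[symmetric] image_comp)
  have "wedge \<alpha> \<beta> (v # vs) = (\<Sum>S\<in>Pow {..<Suc ?n}. ?t S)"
    by (simp add: wedge_def)
  also have "\<dots> = (\<Sum>S\<in>((`) Suc) ` ?P. ?t S) + (\<Sum>S\<in>(insert 0 \<circ> (`) Suc) ` ?P. ?t S)"
    unfolding split by (rule sum.union_disjoint) auto
  also have "(\<Sum>S\<in>((`) Suc) ` ?P. ?t S) = (\<Sum>S\<in>?P. ?t (Suc ` S))"
    by (subst sum.reindex) (auto simp: inj_on_def inj_image_eq_iff)
  also have "(\<Sum>S\<in>(insert 0 \<circ> (`) Suc) ` ?P. ?t S) = (\<Sum>S\<in>?P. ?t (insert 0 (Suc ` S)))"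
    by (subst sum.reindex) (auto simp: inj_on_def inj_image_eq_iff insert_ident)
  also have "(\<Sum>S\<in>?P. ?t (insert 0 (Suc ` S))) = wedge (interior_product v \<alpha>) \<beta> vs"
    unfolding wedge_def
  proof (rule sum.cong)
    fix S assume "S \<in> ?P"
    have "{j. Suc j \<in> insert 0 (Suc ` S)} = S" "{j. Suc j \<in> - insert 0 (Suc ` S)} = - S" by auto
    then show "?t (insert 0 (Suc ` S)) =
        shuffle_sign S * interior_product v \<alpha> (nths vs S) * \<beta> (nths vs (- S))"
      by (simp add: nths_Cons shuffle_sign_insert_0 interior_product_def)
  qed simp
  also have "(\<Sum>S\<in>?P. ?t (Suc ` S)) = wedge (parity \<alpha>) (interior_product v \<beta>) vs"
    unfolding wedge_def
  proof (rule sum.cong)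
    fix S assume S: "S \<in> ?P"
    then have "finite S" by (auto intro: finite_subset)
    moreover have "{j. Suc j \<in> Suc ` S} = S" "{j. Suc j \<in> - (Suc ` S)} = - S" by auto
    moreover have "length (nths vs S) = card S"
      using S by (auto simp: length_nths intro!: arg_cong[where f = card])
    ultimately show "?t (Suc ` S) =
        shuffle_sign S * parity \<alpha> (nths vs S) * interior_product v \<beta> (nths vs (- S))"
      by (simp add: nths_Cons shuffle_sign_Suc_image interior_product_def parity_def)
  qed simp
  finally show ?thesis by simp
qed

lemma interior_product_wedge:
  "interior_product v (wedge \<alpha> \<beta>) =
     (\<lambda>vs. wedge (interior_product v \<alpha>) \<beta> vs + wedge (parity \<alpha>) (interior_product v \<beta>) vs)"
  by (simp add: interior_product_def wedge_Cons[unfolded interior_product_def])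

lemma wedge_add_left: "wedge (\<lambda>vs. \<alpha> vs + \<beta> vs) \<gamma> = (\<lambda>vs. wedge \<alpha> \<gamma> vs + wedge \<beta> \<gamma> vs)"
  and wedge_add_right: "wedge \<gamma> (\<lambda>vs. \<alpha> vs + \<beta> vs) = (\<lambda>vs. wedge \<gamma> \<alpha> vs + wedge \<gamma> \<beta> vs)"
  and wedge_diff_left: "wedge (\<lambda>vs. \<alpha> vs - \<beta> vs) \<gamma> = (\<lambda>vs. wedge \<alpha> \<gamma> vs - wedge \<beta> \<gamma> vs)"
  and wedge_diff_right: "wedge \<gamma> (\<lambda>vs. \<alpha> vs - \<beta> vs) = (\<lambda>vs. wedge \<gamma> \<alpha> vs - wedge \<gamma> \<beta> vs)"
  and wedge_scale_left: "wedge (\<lambda>vs. r * \<alpha> vs) \<gamma> = (\<lambda>vs. r * wedge \<alpha> \<gamma> vs)"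
  and wedge_scale_right: "wedge \<gamma> (\<lambda>vs. r * \<alpha> vs) = (\<lambda>vs. r * wedge \<gamma> \<alpha> vs)"
  and wedge_minus_left: "wedge (\<lambda>vs. - \<alpha> vs) \<gamma> = (\<lambda>vs. - wedge \<alpha> \<gamma> vs)"
  and wedge_minus_right: "wedge \<gamma> (\<lambda>vs. - \<alpha> vs) = (\<lambda>vs. - wedge \<gamma> \<alpha> vs)"
  and wedge_zero_left: "wedge (\<lambda>vs. 0) \<gamma> = (\<lambda>vs. 0)"
  and wedge_zero_right: "wedge \<gamma> (\<lambda>vs. 0) = (\<lambda>vs. 0)"
  by (simp_all add: fun_eq_iff wedge_def algebra_simps sum.distrib sum_subtractf sum_distrib_left sum_negf)

lemma wedge_sum_left: "wedge (\<lambda>vs. \<Sum>i\<in>I. \<alpha> i vs) \<gamma> = (\<lambda>vs. \<Sum>i\<in>I. wedge (\<alpha> i) \<gamma> vs)"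
  unfolding fun_eq_iff wedge_def sum_distrib_left sum_distrib_right by (intro allI sum.swap)

lemma wedge_sum_right: "wedge \<gamma> (\<lambda>vs. \<Sum>i\<in>I. \<alpha> i vs) = (\<lambda>vs. \<Sum>i\<in>I. wedge \<gamma> (\<alpha> i) vs)"
  unfolding fun_eq_iff wedge_def sum_distrib_left by (intro allI sum.swap)

lemma interior_product_parity:
  "interior_product v (parity \<alpha>) = (\<lambda>vs. - parity (interior_product v \<alpha>) vs)"
  by (simp add: interior_product_def parity_def)

lemma parity_wedge: "parity (wedge \<alpha> \<beta>) = wedge (parity \<alpha>) (parity \<beta>)"
proof
  show "parity (wedge \<alpha> \<beta>) vs = wedge (parity \<alpha>) (parity \<beta>) vs" for vs
  proof (induction vs arbitrary: \<alpha> \<beta>)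
    case Nil
    then show ?case by (simp add: parity_def wedge_Nil)
  next
    case (Cons v vs)
    have "parity (wedge \<alpha> \<beta>) (v # vs) =
        - (parity (wedge (interior_product v \<alpha>) \<beta>) vs + parity (wedge (parity \<alpha>) (interior_product v \<beta>)) vs)"
      by (simp add: parity_def wedge_Cons algebra_simps)
    also have "\<dots> = wedge (parity \<alpha>) (parity \<beta>) (v # vs)"
      by (simp add: Cons wedge_Cons interior_product_parity wedge_minus_left wedge_minus_right)
    finally show ?case .
  qed
qed

lemma wedge_assoc: "wedge (wedge \<alpha> \<beta>) \<gamma> = wedge \<alpha> (wedge \<beta> \<gamma>)"
proof
  show "wedge (wedge \<alpha> \<beta>) \<gamma> vs = wedge \<alpha> (wedge \<beta> \<gamma>) vs" for vs
  proof (induction vs arbitrary: \<alpha> \<beta> \<gamma>)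
    case Nil
    then show ?case by (simp add: wedge_Nil)
  next
    case (Cons v vs)
    show ?case
      by (simp add: wedge_Cons interior_product_wedge wedge_add_left wedge_add_right parity_wedge Cons)
  qed
qed

lemma adjacent_swap:
  fixes \<omega> :: "'e::real_vector form"
  assumes lin: "\<And>us ws. linear (\<lambda>v. \<omega> (us @ v # ws))" and adj: "\<And>us v ws. \<omega> (us @ v # v # ws) = 0"
  shows "\<omega> (us @ v # w # ws) = - \<omega> (us @ w # v # ws)"
proof -
  have l1: "\<omega> (us @ (x + y) # z # ws) = \<omega> (us @ x # z # ws) + \<omega> (us @ y # z # ws)" for x y z
    using linear_add[OF lin[of us "z # ws"]] .
  have l2: "\<omega> (us @ z # (x + y) # ws) = \<omega> (us @ z # x # ws) + \<omega> (us @ z # y # ws)" for x y z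
    using linear_add[OF lin[of "us @ [z]" ws], of x y] by simp
  show ?thesis using adj[of us "v + w" ws] adj[of us v ws] adj[of us w ws] unfolding l1 l2 by linarith
qed

text \<open>
  It is enough to test equal neighbours: these give antisymmetry under transpositions of
  neighbours, and such transpositions bring any two equal arguments together.
\<close>

lemma alternating_iff_adjacent:
  "alternating \<omega> \<longleftrightarrow>
     (\<forall>us ws. linear (\<lambda>v. \<omega> (us @ v # ws))) \<and> (\<forall>us v ws. \<omega> (us @ v # v # ws) = 0)"
  (is "_ \<longleftrightarrow> ?lin \<and> ?adj")
proof
  assume a: "alternating \<omega>"
  then have "\<omega> (us @ v # [] @ v # ws) = 0" for us v ws
    unfolding alternating_def by blast
  with a show "?lin \<and> ?adj" by (simp add: alternating_def)
next
  assume a: "?lin \<and> ?adj"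
  have "\<omega> (us @ v # ws @ v # zs) = 0" for us v ws zs
  proof (induction ws arbitrary: us)
    case Nil
    then show ?case using a by simp
  next
    case (Cons w ws)
    have "\<omega> (us @ v # (w # ws) @ v # zs) = - \<omega> ((us @ [w]) @ v # ws @ v # zs)"
      using adjacent_swap[of \<omega> us v w "ws @ v # zs"] a by simp
    then show ?case by (simp only: Cons)
  qed
  with a show "alternating \<omega>" by (simp add: alternating_def)
qed

lemma alternating_linear: "alternating \<omega> \<Longrightarrow> linear (\<lambda>v. \<omega> (us @ v # ws))"
  by (simp add: alternating_def)

lemma alternating_linear_head: "alternating \<omega> \<Longrightarrow> linear (\<lambda>v. \<omega> (v # ws))"
  using alternating_linear[of \<omega> "[]"] by simp

lemma alternating_repeat_head: "alternating \<omega> \<Longrightarrow> \<omega> (v # v # ws) = 0"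
  unfolding alternating_iff_adjacent by (metis append_Nil)

lemma alternating_swap:
  "alternating \<omega> \<Longrightarrow> \<omega> (us @ v # w # ws) = - \<omega> (us @ w # v # ws)"
  by (rule adjacent_swap) (simp_all add: alternating_iff_adjacent)

lemma alternating_move_to_front:
  assumes "alternating \<omega>"
  shows "\<omega> (us @ v # ws) = (- 1) ^ length us * \<omega> (v # us @ ws)"
proof (induction us arbitrary: ws rule: rev_induct)
  case (snoc u us)
  have "\<omega> ((us @ [u]) @ v # ws) = - \<omega> (us @ v # u # ws)"
    using alternating_swap[OF assms, of us u v ws] by simp
  then show ?case by (simp add: snoc)
qed simp

lemma alternating_interior_product:
  assumes "alternating \<omega>" shows "alternating (interior_product u \<omega>)"
proof -
  have "linear (\<lambda>v. interior_product u \<omega> (us @ v # ws))" for us ws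
    using alternating_linear[OF assms, of "u # us" ws] by (simp add: interior_product_def)
  moreover have "\<omega> ((u # us) @ v # v # ws) = 0" for us v ws
    using assms alternating_iff_adjacent by blast
  ultimately show ?thesis by (simp add: alternating_iff_adjacent interior_product_def)
qed

lemma interior_product_linear:
  assumes "alternating \<omega>"
  shows "interior_product (u + v) \<omega> = (\<lambda>vs. interior_product u \<omega> vs + interior_product v \<omega> vs)"
    and "interior_product (r *\<^sub>R u) \<omega> = (\<lambda>vs. r * interior_product u \<omega> vs)"
  unfolding interior_product_def
  using linear_add[OF alternating_linear_head[OF assms]] linear_scale[OF alternating_linear_head[OF assms]]
  by auto

lemma interior_product_anticommute:
  "alternating \<omega> \<Longrightarrow>
     interior_product u (interior_product v \<omega>) = (\<lambda>vs. - interior_product v (interior_product u \<omega>) vs)"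
  unfolding interior_product_def using alternating_swap[of \<omega> "[]" v u] by auto

lemma interior_product_twice:
  "alternating \<omega> \<Longrightarrow> interior_product v (interior_product v \<omega>) = (\<lambda>vs. 0)"
  by (simp add: interior_product_def alternating_repeat_head)

lemma alternating_parity:
  assumes "alternating \<omega>" shows "alternating (parity \<omega>)"
proof -
  have "linear (\<lambda>v. parity \<omega> (us @ v # ws))" for us ws
    using linear_compose_scale_right[OF alternating_linear[OF assms, of us ws], of "(- 1) ^ Suc (length us + length ws)"]
    by (simp add: parity_def)
  moreover have "\<omega> (us @ v # v # ws) = 0" for us v ws
    using assms alternating_iff_adjacent by blast
  ultimately show ?thesis by (simp add: alternating_iff_adjacent parity_def)
qed

lemma alternating_wedge:
  assumes "alternating \<alpha>" "alternating \<beta>" shows "alternating (wedge \<alpha> \<beta>)"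
proof -
  have "linear (\<lambda>v. wedge \<alpha> \<beta> (us @ v # ws))" for us ws
    using assms
  proof (induction us arbitrary: \<alpha> \<beta>)
    case Nil
    show ?case
      unfolding append_Nil wedge_Cons
      by (auto intro!: linearI simp: interior_product_linear Nil wedge_add_left wedge_add_right
          wedge_scale_left wedge_scale_right algebra_simps)
  next
    case (Cons u us)
    have "linear (\<lambda>v. wedge (interior_product u \<alpha>) \<beta> (us @ v # ws) +
        wedge (parity \<alpha>) (interior_product u \<beta>) (us @ v # ws))"
      by (intro linear_compose_add Cons alternating_interior_product alternating_parity)
    then show ?case by (simp add: wedge_Cons)
  qed
  moreover have "wedge \<alpha> \<beta> (us @ v # v # ws) = 0" for us v ws
    using assms
  proof (induction us arbitrary: \<alpha> \<beta>)
    case Nil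
    show ?case
      by (simp add: wedge_Cons interior_product_twice Nil interior_product_parity wedge_minus_left
          wedge_zero_left wedge_zero_right)
  next
    case (Cons u us)
    then show ?case
      by (simp add: wedge_Cons alternating_interior_product alternating_parity)
  qed
  ultimately show ?thesis by (simp add: alternating_iff_adjacent)
qed

lemma alternating_sum:
  assumes "\<And>i. i \<in> I \<Longrightarrow> alternating (\<alpha> i)" shows "alternating (\<lambda>vs. \<Sum>i\<in>I. r i * \<alpha> i vs)"
  unfolding alternating_iff_adjacent
proof (intro conjI allI)
  show "linear (\<lambda>v. \<Sum>i\<in>I. r i * \<alpha> i (us @ v # ws))" for us ws
    using alternating_linear[OF assms]
    by (intro linear_compose_sum ballI) (simp add: linear_iff algebra_simps)
  show "(\<Sum>i\<in>I. r i * \<alpha> i (us @ v # v # ws)) = 0" for us v ws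
    using assms by (intro sum.neutral ballI) (simp add: alternating_iff_adjacent)
qed

lemma interior_product_1form:
  "has_degree 1 \<theta> \<Longrightarrow> interior_product v \<theta> = (\<lambda>vs. \<theta> [v] * unit_form vs)"
  by (auto simp: has_degree_def interior_product_def unit_form_def fun_eq_iff)

lemma parity_1form: "has_degree 1 \<theta> \<Longrightarrow> parity \<theta> = (\<lambda>vs. - \<theta> vs)"
  by (rule ext, case_tac "length vs = 1") (auto simp: has_degree_def parity_def)

lemma unit_form_simps:
  "interior_product v unit_form = (\<lambda>vs. 0)" "parity unit_form = unit_form"
  by (auto simp: interior_product_def unit_form_def parity_def)

lemma wedge_unit_left: "wedge unit_form \<alpha> = \<alpha>"
proof
  show "wedge unit_form \<alpha> vs = \<alpha> vs" for vs
    by (induction vs arbitrary: \<alpha>)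
      (simp_all add: wedge_Nil wedge_Cons unit_form_simps wedge_zero_left, simp_all add: unit_form_def interior_product_def)
qed

lemma wedge_unit_right: "wedge \<alpha> unit_form = \<alpha>"
proof
  show "wedge \<alpha> unit_form vs = \<alpha> vs" for vs
    by (induction vs arbitrary: \<alpha>)
      (simp_all add: wedge_Nil wedge_Cons unit_form_simps wedge_zero_right, simp_all add: unit_form_def interior_product_def)
qed

lemma interior_product_wedge_1form:
  assumes "has_degree 1 \<theta>"
  shows "interior_product v (wedge \<theta> \<alpha>) = (\<lambda>vs. \<theta> [v] * \<alpha> vs - wedge \<theta> (interior_product v \<alpha>) vs)"
  by (simp add: interior_product_wedge interior_product_1form[OF assms] parity_1form[OF assms]
      wedge_scale_left wedge_unit_left wedge_minus_left)

lemma wedge_1form_commute: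
  assumes "has_degree 1 \<theta>" shows "wedge \<alpha> \<theta> = wedge \<theta> (parity \<alpha>)"
proof
  show "wedge \<alpha> \<theta> vs = wedge \<theta> (parity \<alpha>) vs" for vs
  proof (induction vs arbitrary: \<alpha>)
    case Nil
    then show ?case by (simp add: wedge_Nil parity_def)
  next
    case (Cons v vs)
    show ?case
      by (simp add: wedge_Cons interior_product_1form[OF assms] parity_1form[OF assms]
          wedge_scale_left wedge_scale_right wedge_unit_left wedge_unit_right wedge_minus_left
          wedge_minus_right interior_product_parity Cons)
  qed
qed

lemma wedge_1form_self: "has_degree 1 \<theta> \<Longrightarrow> wedge \<theta> \<theta> = (\<lambda>vs. 0)"
  using wedge_1form_commute[of \<theta> \<theta>]
  by (auto simp: parity_1form wedge_minus_right fun_eq_iff)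

lemma wedge_1form_sandwich:
  assumes "has_degree 1 \<theta>" shows "wedge \<theta> (wedge \<alpha> (wedge \<theta> \<beta>)) = (\<lambda>vs. 0)"
proof -
  have "wedge \<theta> (wedge \<alpha> (wedge \<theta> \<beta>)) = wedge (wedge \<theta> (wedge \<alpha> \<theta>)) \<beta>"
    by (simp only: wedge_assoc)
  also have "\<dots> = wedge (wedge (wedge \<theta> \<theta>) (parity \<alpha>)) \<beta>"
    by (simp only: wedge_1form_commute[OF assms, of \<alpha>] wedge_assoc)
  also have "\<dots> = (\<lambda>vs. 0)"
    by (simp add: wedge_1form_self[OF assms] wedge_zero_left)
  finally show ?thesis .
qed

lemma wedge_1form_expand:
  assumes "has_degree 1 \<theta>"
  shows "wedge \<theta> \<beta> vs =
    (\<Sum>j<length vs. (- 1) ^ j * \<theta> [vs ! j] * \<beta> (take j vs @ drop (Suc j) vs))"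
proof (induction vs arbitrary: \<beta>)
  case Nil
  then show ?case using assms by (simp add: wedge_Nil has_degree_def)
next
  case (Cons v vs)
  have "wedge \<theta> \<beta> (v # vs) = \<theta> [v] * \<beta> vs - wedge \<theta> (interior_product v \<beta>) vs"
    using interior_product_wedge_1form[OF assms, of v \<beta>] by (simp add: interior_product_def fun_eq_iff)
  also have "\<dots> = (\<Sum>j<length (v # vs). (- 1) ^ j * \<theta> [(v # vs) ! j] *
      \<beta> (take j (v # vs) @ drop (Suc j) (v # vs)))"
    unfolding Cons length_Cons sum.lessThan_Suc_shift
    by (simp add: interior_product_def sum_negf)
  finally show ?case .
qed


section \<open>Fields in a chart\<close>

text \<open>
  All fields are compared in one fixed chart. The chart enters only through the coordinate fields, so
  no smooth map has to be composed with a change of coordinates.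
\<close>

definition chart_smooth :: "('m, 'e::euclidean_space) chart \<Rightarrow> 'm set \<Rightarrow> ('m \<Rightarrow> 'b::real_normed_vector) \<Rightarrow> bool" where
  "chart_smooth c U f \<longleftrightarrow> smooth_on (f \<circ> inv_chart c) (snd c ` (U \<inter> fst c))"

definition chart_smooth_field ::
    "('m, 'e::euclidean_space) chart set \<Rightarrow> ('m, 'e) chart \<Rightarrow> 'm set \<Rightarrow> ('m \<Rightarrow> 'e) \<Rightarrow> bool" where
  "chart_smooth_field A c U X \<longleftrightarrow> chart_smooth c U (\<lambda>q. components_in A c q (X q))"

text \<open>
  Smoothness of a form tested on all smooth vector fields, not only on coordinate fields; in this
  form it passes to the exterior product, and to the interior product with a vector field.
\<close>

definition chart_smooth_form ::
    "('m, 'e::euclidean_space) chart set \<Rightarrow> ('m, 'e) chart \<Rightarrow> 'm set \<Rightarrow> ('m \<Rightarrow> 'e form) \<Rightarrow> bool" where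
  "chart_smooth_form A c U \<omega> \<longleftrightarrow>
     (\<forall>Xs. (\<forall>X\<in>set Xs. chart_smooth_field A c U X) \<longrightarrow> chart_smooth c U (\<lambda>q. \<omega> q (map (\<lambda>X. X q) Xs)))"

lemma smooth_vector_field_iff_chart_smooth_field:
  "smooth_vector_field A U X \<longleftrightarrow> (\<forall>c\<in>A. chart_smooth_field A c U X)"
  by (simp add: smooth_vector_field_def chart_smooth_field_def chart_smooth_def)

lemma chart_smooth_subset: "chart_smooth c U f \<Longrightarrow> W \<subseteq> U \<Longrightarrow> chart_smooth c W f"
  unfolding chart_smooth_def by (rule smooth_on_subset) auto

lemma chart_smooth_field_subset: "chart_smooth_field A c U X \<Longrightarrow> W \<subseteq> U \<Longrightarrow> chart_smooth_field A c W X"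
  unfolding chart_smooth_field_def by (rule chart_smooth_subset)

lemma smooth_vector_field_subset: "smooth_vector_field A U X \<Longrightarrow> W \<subseteq> U \<Longrightarrow> smooth_vector_field A W X"
  unfolding smooth_vector_field_iff_chart_smooth_field using chart_smooth_field_subset by blast

lemma smooth_form_subset: "smooth_form A U \<omega> \<Longrightarrow> W \<subseteq> U \<Longrightarrow> smooth_form A W \<omega>"
  unfolding smooth_form_def by (blast intro: smooth_on_subset)

lemma chart_smooth_const: "chart_smooth c U (\<lambda>q. a)"
  unfolding chart_smooth_def comp_def by (rule smooth_on_const)

lemma chart_smooth_add: "chart_smooth c U f \<Longrightarrow> chart_smooth c U h \<Longrightarrow> chart_smooth c U (\<lambda>q. f q + h q)"
  unfolding chart_smooth_def comp_def by (rule smooth_on_add)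

lemma chart_smooth_scaleR:
  "chart_smooth c U f \<Longrightarrow> chart_smooth c U h \<Longrightarrow> chart_smooth c U (\<lambda>q. f q *\<^sub>R h q)"
  unfolding chart_smooth_def comp_def by (rule smooth_on_scaleR)

lemma chart_smooth_mult:
  fixes f h :: "'m \<Rightarrow> real"
  shows "chart_smooth c U f \<Longrightarrow> chart_smooth c U h \<Longrightarrow> chart_smooth c U (\<lambda>q. f q * h q)"
  using chart_smooth_scaleR[of c U f h] by simp

lemma chart_smooth_sum:
  "(\<And>i. i \<in> I \<Longrightarrow> chart_smooth c U (f i)) \<Longrightarrow> chart_smooth c U (\<lambda>q. \<Sum>i\<in>I. f i q)"
  by (induction I rule: infinite_finite_induct) (simp_all add: chart_smooth_const chart_smooth_add)

lemma chart_smooth_bounded_linear: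
  "bounded_linear L \<Longrightarrow> chart_smooth c U f \<Longrightarrow> chart_smooth c U (\<lambda>q. L (f q))"
  unfolding chart_smooth_def comp_def by (rule smooth_on_bounded_linear)

lemma chart_smooth_form_apply:
  "chart_smooth_form A c U \<omega> \<Longrightarrow> (\<And>X. X \<in> set Xs \<Longrightarrow> chart_smooth_field A c U X) \<Longrightarrow>
     chart_smooth c U (\<lambda>q. \<omega> q (map (\<lambda>X. X q) Xs))"
  unfolding chart_smooth_form_def by blast

lemma chart_smooth_form_wedge:
  assumes "chart_smooth_form A c U \<alpha>" "chart_smooth_form A c U \<beta>"
  shows "chart_smooth_form A c U (\<lambda>q. wedge (\<alpha> q) (\<beta> q))"
  unfolding chart_smooth_form_def
proof (intro allI impI)
  fix Xs assume Xs: "\<forall>X\<in>set Xs. chart_smooth_field A c U X"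
  have "chart_smooth c U (\<lambda>q. \<Sum>S\<in>Pow {..<length Xs}. shuffle_sign S *
      \<alpha> q (map (\<lambda>X. X q) (nths Xs S)) * \<beta> q (map (\<lambda>X. X q) (nths Xs (- S))))"
    using Xs by (intro chart_smooth_sum chart_smooth_mult chart_smooth_const
        chart_smooth_form_apply[OF assms(1)] chart_smooth_form_apply[OF assms(2)])
      (auto dest: in_set_nthsD)
  then show "chart_smooth c U (\<lambda>q. wedge (\<alpha> q) (\<beta> q) (map (\<lambda>X. X q) Xs))"
    by (simp add: wedge_def nths_map)
qed

lemma chart_smooth_form_interior_product:
  assumes "chart_smooth_form A c U \<alpha>" "chart_smooth_field A c U X"
  shows "chart_smooth_form A c U (\<lambda>q. interior_product (X q) (\<alpha> q))"
  unfolding chart_smooth_form_def interior_product_apply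
proof (intro allI impI)
  fix Xs assume Xs: "\<forall>X\<in>set Xs. chart_smooth_field A c U X"
  show "chart_smooth c U (\<lambda>q. \<alpha> q (X q # map (\<lambda>X. X q) Xs))"
    using chart_smooth_form_apply[OF assms(1), of "X # Xs"] Xs assms(2) by auto
qed

lemma chart_smooth_form_sum:
  assumes "\<And>i. i \<in> I \<Longrightarrow> chart_smooth_form A c U (\<alpha> i)"
  shows "chart_smooth_form A c U (\<lambda>q vs. \<Sum>i\<in>I. r i * \<alpha> i q vs)"
  unfolding chart_smooth_form_def
  by (intro allI impI chart_smooth_sum chart_smooth_mult chart_smooth_const
      chart_smooth_form_apply[OF assms]) auto

locale manifold_atlas =
  fixes A :: "('m::{t2_space,second_countable_topology}, 'e::euclidean_space) chart set"
  assumes atlas: "smooth_atlas A"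
begin

lemma open_chart_domain: "c \<in> A \<Longrightarrow> open (fst c)"
  using atlas by (simp add: smooth_atlas_def is_chart_def)

lemma chart_homeomorphism: "c \<in> A \<Longrightarrow> homeomorphism (fst c) (snd c ` fst c) (snd c) (inv_chart c)"
  using atlas by (simp add: smooth_atlas_def is_chart_def)

lemma inv_chart_chart: "c \<in> A \<Longrightarrow> p \<in> fst c \<Longrightarrow> inv_chart c (snd c p) = p"
  using chart_homeomorphism homeomorphism_apply1 by blast

lemma open_chart_image:
  assumes "c \<in> A" "open U" shows "open (snd c ` (U \<inter> fst c))"
proof -
  have "open (snd c ` fst c)" using assms atlas by (simp add: smooth_atlas_def is_chart_def)
  moreover have "continuous_on (snd c ` fst c) (inv_chart c)"
    using chart_homeomorphism[OF assms(1)] homeomorphism_cont2 by blast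
  ultimately have "open (snd c ` fst c \<inter> inv_chart c -` U)"
    using assms(2) continuous_open_preimage by blast
  moreover have "snd c ` (U \<inter> fst c) = snd c ` fst c \<inter> inv_chart c -` U"
    by (auto simp: inv_chart_chart[OF assms(1)])
  ultimately show ?thesis by simp
qed

lemma chart_at_props: "chart_at A p \<in> A" "p \<in> fst (chart_at A p)"
proof -
  have "p \<in> (\<Union>c\<in>A. fst c)"
    using atlas by (simp add: smooth_atlas_def)
  then have "\<exists>c. c \<in> A \<and> p \<in> fst c" by blast
  then have "chart_at A p \<in> A \<and> p \<in> fst (chart_at A p)"
    unfolding chart_at_def by (rule someI_ex)
  then show "chart_at A p \<in> A" "p \<in> fst (chart_at A p)" by auto
qed

lemma transition_differentiable:
  assumes "c \<in> A" "d \<in> A" "p \<in> fst c" "p \<in> fst d"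
  shows "(snd d \<circ> inv_chart c) differentiable at (snd c p)"
proof (rule smooth_on_imp_differentiable)
  show "smooth_on (snd d \<circ> inv_chart c) (snd c ` (fst c \<inter> fst d))"
    using atlas assms by (simp add: smooth_atlas_def)
qed (use assms in auto)

text \<open>The two changes of coordinates are mutually inverse near the point, so their derivatives are inverse by the chain rule.\<close>

lemma transition_derivative_inverse:
  assumes "c \<in> A" "d \<in> A" "p \<in> fst c" "p \<in> fst d"
  shows "frechet_derivative (snd d \<circ> inv_chart c) (at (snd c p))
      (frechet_derivative (snd c \<circ> inv_chart d) (at (snd d p)) v) = v"
proof -
  let ?f = "snd d \<circ> inv_chart c" and ?h = "snd c \<circ> inv_chart d"
  have h: "(?h has_derivative frechet_derivative ?h (at (snd d p))) (at (snd d p))"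
    using transition_differentiable[OF assms(2,1,4,3)] frechet_derivative_works by blast
  have hp: "?h (snd d p) = snd c p" using assms by (simp add: inv_chart_chart)
  have f: "(?f has_derivative frechet_derivative ?f (at (snd c p))) (at (snd c p))"
    using transition_differentiable[OF assms] frechet_derivative_works by blast
  have comp: "(?f \<circ> ?h has_derivative
      frechet_derivative ?f (at (snd c p)) \<circ> frechet_derivative ?h (at (snd d p))) (at (snd d p))"
    using diff_chain_at[OF h] f hp by simp
  have "((\<lambda>x. x) has_derivative
      frechet_derivative ?f (at (snd c p)) \<circ> frechet_derivative ?h (at (snd d p))) (at (snd d p))"
  proof (rule has_derivative_transform_within_open[OF comp])
    show "open (snd d ` (fst c \<inter> fst d))"
      using open_chart_image[OF assms(2) open_chart_domain[OF assms(1)]] .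
    show "snd d p \<in> snd d ` (fst c \<inter> fst d)" using assms by auto
    show "(?f \<circ> ?h) x = x" if "x \<in> snd d ` (fst c \<inter> fst d)" for x
      using that assms by (auto simp: inv_chart_chart)
  qed
  then have "frechet_derivative ?f (at (snd c p)) \<circ> frechet_derivative ?h (at (snd d p)) = (\<lambda>x. x)"
    using has_derivative_ident has_derivative_unique by blast
  then show ?thesis by (metis comp_apply)
qed

lemma components_in_vector_from:
  "c \<in> A \<Longrightarrow> p \<in> fst c \<Longrightarrow> components_in A c p (vector_from A c p v) = v"
  unfolding components_in_def vector_from_def
  by (rule transition_derivative_inverse) (simp_all add: chart_at_props)

lemma vector_from_components_in:
  "c \<in> A \<Longrightarrow> p \<in> fst c \<Longrightarrow> vector_from A c p (components_in A c p v) = v"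
  unfolding components_in_def vector_from_def
  by (rule transition_derivative_inverse) (simp_all add: chart_at_props)

lemma linear_components_in: "c \<in> A \<Longrightarrow> p \<in> fst c \<Longrightarrow> linear (components_in A c p)"
  unfolding components_in_def
  by (intro linear_frechet_derivative transition_differentiable chart_at_props)

lemma linear_vector_from: "c \<in> A \<Longrightarrow> p \<in> fst c \<Longrightarrow> linear (vector_from A c p)"
  unfolding vector_from_def
  by (intro linear_frechet_derivative transition_differentiable chart_at_props)

lemma field_in_chart_basis:
  assumes "c \<in> A" "p \<in> fst c"
  shows "v = (\<Sum>b\<in>Basis. (components_in A c p v \<bullet> b) *\<^sub>R vector_from A c p b)"
proof -
  have "v = vector_from A c p (\<Sum>b\<in>Basis. (components_in A c p v \<bullet> b) *\<^sub>R b)"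
    by (simp add: euclidean_representation vector_from_components_in[OF assms])
  then show ?thesis
    by (simp add: linear_sum[OF linear_vector_from[OF assms]] linear_scale[OF linear_vector_from[OF assms]])
qed

lemma chart_smooth_cong:
  assumes "c \<in> A" "open U" "chart_smooth c U f" "\<And>q. q \<in> U \<Longrightarrow> q \<in> fst c \<Longrightarrow> f q = h q"
  shows "chart_smooth c U h"
  unfolding chart_smooth_def
proof (rule smooth_on_cong[OF open_chart_image[OF assms(1,2)]])
  show "smooth_on (f \<circ> inv_chart c) (snd c ` (U \<inter> fst c))"
    using assms(3) by (simp add: chart_smooth_def)
  show "(f \<circ> inv_chart c) x = (h \<circ> inv_chart c) x" if "x \<in> snd c ` (U \<inter> fst c)" for x
    using that assms(1,4) by (auto simp: inv_chart_chart)
qed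

lemma chart_smooth_inverse:
  assumes "c \<in> A" "chart_smooth c U f" "\<And>q. q \<in> U \<Longrightarrow> f q \<noteq> (0::real)"
  shows "chart_smooth c U (\<lambda>q. inverse (f q))"
  using assms(2) unfolding chart_smooth_def comp_def
  by (rule smooth_on_inverse) (use assms in \<open>auto simp: inv_chart_chart\<close>)

lemma chart_smooth_locally:
  assumes "c \<in> A" "open U"
    and loc: "\<And>p. p \<in> U \<Longrightarrow> p \<in> fst c \<Longrightarrow> \<exists>W. open W \<and> p \<in> W \<and> chart_smooth c (U \<inter> W) f"
  shows "chart_smooth c U f"
  unfolding chart_smooth_def
proof (rule smooth_on_locally[OF open_chart_image[OF assms(1,2)]])
  fix x assume "x \<in> snd c ` (U \<inter> fst c)"
  then obtain p where p: "p \<in> U" "p \<in> fst c" "x = snd c p" by auto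
  then obtain W where W: "open W" "p \<in> W" "chart_smooth c (U \<inter> W) f" using loc by blast
  have "inj_on (snd c) (fst c)"
    using inv_chart_chart[OF assms(1)] by (metis inj_onI)
  then have "snd c ` (U \<inter> W \<inter> fst c) = snd c ` (U \<inter> fst c) \<inter> snd c ` (W \<inter> fst c)"
    unfolding inj_on_def by blast
  with W(3) have "smooth_on (f \<circ> inv_chart c) (snd c ` (U \<inter> fst c) \<inter> snd c ` (W \<inter> fst c))"
    by (simp add: chart_smooth_def)
  then show "\<exists>T. open T \<and> x \<in> T \<and> smooth_on (f \<circ> inv_chart c) (snd c ` (U \<inter> fst c) \<inter> T)"
    using open_chart_image[OF assms(1) W(1)] p W(2) by blast
qed

lemma chart_smooth_field_coordinate:
  assumes "c \<in> A" "open U" shows "chart_smooth_field A c U (\<lambda>q. vector_from A c q v)"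
  unfolding chart_smooth_field_def
  by (rule chart_smooth_cong[OF assms chart_smooth_const[of c U v]])
    (simp add: components_in_vector_from[OF assms(1)])

lemma chart_smooth_field_add:
  assumes "c \<in> A" "open U" "chart_smooth_field A c U X" "chart_smooth_field A c U Y"
  shows "chart_smooth_field A c U (\<lambda>q. X q + Y q)"
  unfolding chart_smooth_field_def
  by (rule chart_smooth_cong[OF assms(1,2) chart_smooth_add[OF assms(3,4)[unfolded chart_smooth_field_def]]])
    (simp add: linear_add[OF linear_components_in[OF assms(1)]])

lemma chart_smooth_field_scaleR:
  assumes "c \<in> A" "open U" "chart_smooth c U f" "chart_smooth_field A c U X"
  shows "chart_smooth_field A c U (\<lambda>q. f q *\<^sub>R X q)"
  unfolding chart_smooth_field_def
  by (rule chart_smooth_cong[OF assms(1,2) chart_smooth_scaleR[OF assms(3) assms(4)[unfolded chart_smooth_field_def]]])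
    (simp add: linear_scale[OF linear_components_in[OF assms(1)]])

lemma chart_smooth_field_sum:
  assumes "c \<in> A" "open U" "finite I" "\<And>i. i \<in> I \<Longrightarrow> chart_smooth_field A c U (X i)"
  shows "chart_smooth_field A c U (\<lambda>q. \<Sum>i\<in>I. X i q)"
  using assms(3,4)
proof (induction I rule: finite_induct)
  case empty
  then show ?case
    using chart_smooth_field_scaleR[OF assms(1,2) chart_smooth_const[of c U 0]
        chart_smooth_field_coordinate[OF assms(1,2), of 0]] by simp
next
  case (insert i I)
  then show ?case using chart_smooth_field_add[OF assms(1,2), of "X i" "\<lambda>q. \<Sum>i\<in>I. X i q"] by simp
qed

text \<open>
  The vector fields are replaced by coordinate fields one after the other, by expanding them in
  the coordinate basis.
\<close>

lemma smooth_form_imp_chart_smooth_form: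
  assumes "smooth_form A U \<omega>" "c \<in> A" "open U"
  shows "chart_smooth_form A c U \<omega>"
  unfolding chart_smooth_form_def
proof (intro allI impI)
  fix Xs assume Xs: "\<forall>X\<in>set Xs. chart_smooth_field A c U X"
  have "chart_smooth c U (\<lambda>q. \<omega> q (map (vector_from A c q) vs @ map (\<lambda>X. X q) Xs))" for vs
    using Xs
  proof (induction Xs arbitrary: vs)
    case Nil
    then show ?case using assms by (simp add: smooth_form_def chart_smooth_def)
  next
    case (Cons X Xs)
    let ?t = "\<lambda>b q. \<omega> q (map (vector_from A c q) (vs @ [b]) @ map (\<lambda>X. X q) Xs)"
    have X: "chart_smooth c U (\<lambda>q. components_in A c q (X q) \<bullet> b)" for b
      using Cons.prems by (intro chart_smooth_bounded_linear[OF bounded_linear_inner_left])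
        (simp add: chart_smooth_field_def)
    have "chart_smooth c U (\<lambda>q. \<Sum>b\<in>Basis. (components_in A c q (X q) \<bullet> b) * ?t b q)"
      using Cons.prems by (intro chart_smooth_sum chart_smooth_mult X Cons.IH) simp
    then show ?case
    proof (rule chart_smooth_cong[OF assms(2,3)])
      fix q assume q: "q \<in> U" "q \<in> fst c"
      have lin: "linear (\<lambda>v. \<omega> q (map (vector_from A c q) vs @ v # map (\<lambda>X. X q) Xs))"
        using assms(1) q alternating_linear by (auto simp: smooth_form_def)
      have "\<omega> q (map (vector_from A c q) vs @ X q # map (\<lambda>X. X q) Xs) =
          \<omega> q (map (vector_from A c q) vs @
            (\<Sum>b\<in>Basis. (components_in A c q (X q) \<bullet> b) *\<^sub>R vector_from A c q b) # map (\<lambda>X. X q) Xs)"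
        using field_in_chart_basis[OF assms(2) q(2), of "X q"] by simp
      also have "\<dots> = (\<Sum>b\<in>Basis. (components_in A c q (X q) \<bullet> b) * ?t b q)"
        by (simp add: linear_sum[OF lin] linear_scale[OF lin])
      finally show "(\<Sum>b\<in>Basis. (components_in A c q (X q) \<bullet> b) * ?t b q) =
          \<omega> q (map (vector_from A c q) vs @ map (\<lambda>X. X q) (X # Xs))" by simp
    qed
  qed
  from this[of "[]"] show "chart_smooth c U (\<lambda>q. \<omega> q (map (\<lambda>X. X q) Xs))" by simp
qed

lemma smooth_formI:
  assumes "open U" "\<And>p. p \<in> U \<Longrightarrow> alternating (\<omega> p)" "\<And>c. c \<in> A \<Longrightarrow> chart_smooth_form A c U \<omega>"
  shows "smooth_form A U \<omega>"
  unfolding smooth_form_def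
proof (intro conjI ballI allI)
  fix c vs assume c: "c \<in> A"
  have "chart_smooth c U (\<lambda>q. \<omega> q (map (\<lambda>X. X q) (map (\<lambda>v q. vector_from A c q v) vs)))"
    by (rule chart_smooth_form_apply[OF assms(3)[OF c]])
      (auto intro: chart_smooth_field_coordinate[OF c assms(1)])
  then show "smooth_on ((\<lambda>q. \<omega> q (map (vector_from A c q) vs)) \<circ> inv_chart c) (snd c ` (U \<inter> fst c))"
    by (simp add: chart_smooth_def comp_def)
qed (rule assms(2))

lemma chart_smooth_metric:
  assumes g: "lorentzian_metric A g" and c: "c \<in> A" "open U"
    and X: "chart_smooth_field A c U X" and Y: "chart_smooth_field A c U Y"
  shows "chart_smooth c U (\<lambda>q. g q (X q) (Y q))"
proof -
  have coeff: "chart_smooth c U (\<lambda>q. components_in A c q (Z q) \<bullet> b)"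
    if "chart_smooth_field A c U Z" for Z b
    using that by (intro chart_smooth_bounded_linear[OF bounded_linear_inner_left])
      (simp add: chart_smooth_field_def)
  have "chart_smooth c UNIV (\<lambda>q. g q (vector_from A c q a) (vector_from A c q b))" for a b
    using g c by (simp add: lorentzian_metric_def chart_smooth_def)
  then have "chart_smooth c U (\<lambda>q. \<Sum>a\<in>Basis. \<Sum>b\<in>Basis. (components_in A c q (X q) \<bullet> a) *
      ((components_in A c q (Y q) \<bullet> b) * g q (vector_from A c q a) (vector_from A c q b)))"
    by (intro chart_smooth_sum chart_smooth_mult coeff X Y) (rule chart_smooth_subset, auto)
  then show ?thesis
  proof (rule chart_smooth_cong[OF c])
    fix q assume q: "q \<in> U" "q \<in> fst c"
    have bil: "bilinear (g q)" using g by (simp add: lorentzian_metric_def lorentzian_product_def)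
    then have l: "linear (\<lambda>v. g q v w)" "linear (\<lambda>v. g q w v)" for w by (simp_all add: bilinear_def)
    have "g q (X q) (Y q) =
        g q (\<Sum>a\<in>Basis. (components_in A c q (X q) \<bullet> a) *\<^sub>R vector_from A c q a)
          (\<Sum>b\<in>Basis. (components_in A c q (Y q) \<bullet> b) *\<^sub>R vector_from A c q b)"
      using field_in_chart_basis[OF c(1) q(2), of "X q"] field_in_chart_basis[OF c(1) q(2), of "Y q"]
      by simp
    then show "(\<Sum>a\<in>Basis. \<Sum>b\<in>Basis. (components_in A c q (X q) \<bullet> a) *
        ((components_in A c q (Y q) \<bullet> b) * g q (vector_from A c q a) (vector_from A c q b))) = g q (X q) (Y q)"
      by (subst sum.swap) (simp add: linear_sum[OF l(1)] linear_sum[OF l(2)] linear_scale[OF l(1)]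
          linear_scale[OF l(2)] sum_distrib_left mult.left_commute)
  qed
qed

lemma chart_smooth_nonzero_near:
  fixes f :: "'m \<Rightarrow> real"
  assumes "c \<in> A" "open U" "chart_smooth c U f" "p \<in> U" "p \<in> fst c" "f p \<noteq> 0"
  obtains W where "open W" "p \<in> W" "W \<subseteq> U" "\<And>q. q \<in> W \<Longrightarrow> f q \<noteq> 0"
proof
  let ?V = "U \<inter> fst c"
  have "continuous_on ?V (snd c)"
    using homeomorphism_cont1[OF chart_homeomorphism[OF assms(1)]] continuous_on_subset by blast
  moreover have "continuous_on (snd c ` ?V) (f \<circ> inv_chart c)"
    using assms(3) unfolding chart_smooth_def by (rule smooth_on_imp_continuous_on)
  ultimately have "continuous_on ?V ((f \<circ> inv_chart c) \<circ> snd c)"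
    by (rule continuous_on_compose)
  then have "continuous_on ?V f"
    by (rule continuous_on_eq) (simp add: inv_chart_chart[OF assms(1)])
  then show "open (?V \<inter> f -` (- {0}))"
    using open_Int[OF assms(2) open_chart_domain[OF assms(1)]]
    by (intro continuous_open_preimage) auto
qed (use assms in auto)

lemma chart_smooth_imp_differentiable:
  assumes "chart_smooth c U f" "p \<in> U" "p \<in> fst c"
  shows "(f \<circ> inv_chart c) differentiable at (snd c p)"
  using assms smooth_on_imp_differentiable by (auto simp: chart_smooth_def)

end


section \<open>Lorentzian frames and null forms at a point\<close>

lemma eta_square: "eta i i * eta i i = 1"
  by (simp add: eta_def)

locale lorentz_frame =
  fixes h :: "'e::euclidean_space \<Rightarrow> 'e \<Rightarrow> real" and E :: "nat \<Rightarrow> 'e"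
  assumes bilinear: "bilinear h" and symmetric: "h u v = h v u"
    and orthonormal: "i < DIM('e) \<Longrightarrow> j < DIM('e) \<Longrightarrow> h (E i) (E j) = eta i j"
begin

lemma linear_left: "linear (\<lambda>v. h v w)" and linear_right: "linear (\<lambda>v. h w v)"
  using bilinear by (simp_all add: bilinear_def)

text \<open>
  The vectors are linearly independent by orthonormality, and there are as many of them as the
  dimension, so they are a basis.
\<close>

lemma frame_expansion: "v = (\<Sum>i<DIM('e). (eta i i * h (E i) v) *\<^sub>R E i)"
proof -
  obtain ix where ix: "bij_betw ix (Basis :: 'e set) {0..<DIM('e)}"
    using ex_bij_betw_finite_nat[OF finite_Basis] by blast
  then have ix': "bij_betw ix (Basis :: 'e set) {..<DIM('e)}" by (simp add: atLeast0LessThan)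
  have less: "ix b < DIM('e)" if "b \<in> Basis" for b
    using ix' that by (auto dest: bij_betwE)
  define \<Psi> where "\<Psi> w = (\<Sum>b\<in>Basis. (w \<bullet> b) *\<^sub>R E (ix b))" for w
  have "linear \<Psi>"
    unfolding \<Psi>_def by (rule linearI) (simp_all add: inner_add_left scaleR_add_left sum.distrib scaleR_right.sum)
  have h\<Psi>: "h (E (ix b)) (\<Psi> w) = eta (ix b) (ix b) * (w \<bullet> b)" if b: "b \<in> Basis" for b w
  proof -
    have "h (E (ix b)) (\<Psi> w) = (\<Sum>b'\<in>Basis. (w \<bullet> b') * eta (ix b) (ix b'))"
      unfolding \<Psi>_def using less b
      by (simp add: linear_sum[OF linear_right] linear_scale[OF linear_right] orthonormal)
    also have "\<dots> = (\<Sum>b'\<in>Basis. if b' = b then (w \<bullet> b) * eta (ix b) (ix b) else 0)"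
      using bij_betw_imp_inj_on[OF ix'] b by (intro sum.cong) (auto simp: eta_def inj_on_def)
    finally show ?thesis using b by simp
  qed
  have "inj \<Psi>"
    unfolding linear_injective_0[OF \<open>linear \<Psi>\<close>]
  proof (intro allI impI)
    fix w assume "\<Psi> w = 0"
    then have "eta (ix b) (ix b) * (w \<bullet> b) = 0" if "b \<in> Basis" for b
      using h\<Psi>[OF that, of w] linear_0[OF linear_right] by simp
    then have "w \<bullet> b = 0" if "b \<in> Basis" for b
      using that eta_square[of "ix b"] by fastforce
    then show "w = 0" using euclidean_all_zero_iff by blast
  qed
  then have "surj \<Psi>" using \<open>linear \<Psi>\<close> linear_injective_imp_surjective by blast
  then obtain w where v: "v = \<Psi> w" by blast
  have "(\<Sum>i<DIM('e). (eta i i * h (E i) v) *\<^sub>R E i) =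
      (\<Sum>b\<in>Basis. (eta (ix b) (ix b) * h (E (ix b)) v) *\<^sub>R E (ix b))"
    by (rule sum.reindex_bij_betw[OF ix', symmetric])
  also have "\<dots> = \<Psi> w"
    unfolding \<Psi>_def v by (intro sum.cong) (simp_all add: h\<Psi>[unfolded \<Psi>_def] mult.assoc[symmetric] eta_square)
  finally show ?thesis using v by simp
qed

lemma metric_expansion: "h v w = (\<Sum>i<DIM('e). eta i i * (h (E i) v * h (E i) w))"
proof -
  have "h v w = h (\<Sum>i<DIM('e). (eta i i * h (E i) v) *\<^sub>R E i) w" using frame_expansion[of v] by simp
  then show ?thesis
    by (simp add: linear_sum[OF linear_left] linear_scale[OF linear_left] mult.assoc)
qed

lemma nondegenerate: "(\<And>Y. h Y u = h Y v) \<Longrightarrow> u = v"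
  using frame_expansion[of u] frame_expansion[of v] by simp

lemma raise_eq_frame_sum:
  assumes "alternating \<alpha>"
  shows "raise h \<alpha> vs = (\<Sum>i<DIM('e). (eta i i * \<alpha> (E i # vs)) *\<^sub>R E i)" (is "_ = ?w")
    and metric_raise: "h Y (raise h \<alpha> vs) = \<alpha> (Y # vs)"
proof -
  note lin = alternating_linear_head[OF assms, of vs]
  have w: "h Y ?w = \<alpha> (Y # vs)" for Y
  proof -
    have "\<alpha> (Y # vs) = \<alpha> ((\<Sum>i<DIM('e). (eta i i * h (E i) Y) *\<^sub>R E i) # vs)"
      using frame_expansion[of Y] by simp
    also have "\<dots> = h Y ?w"
      by (simp add: linear_sum[OF lin] linear_scale[OF lin] linear_sum[OF linear_right]
          linear_scale[OF linear_right] symmetric[of Y] algebra_simps)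
    finally show ?thesis by simp
  qed
  show "raise h \<alpha> vs = ?w"
    unfolding raise_def
  proof (rule the_equality)
    show "\<forall>Y. h Y ?w = \<alpha> (Y # vs)" using w by blast
    show "\<And>w. \<forall>Y. h Y w = \<alpha> (Y # vs) \<Longrightarrow> w = ?w" using nondegenerate w by metis
  qed
  then show "h Y (raise h \<alpha> vs) = \<alpha> (Y # vs)" using w by simp
qed

text \<open>
  Raising an index and inserting the result amounts to contracting one index of each factor with
  the inverse metric, which the orthonormal frame diagonalises. Properties of the exterior product thus
  carry over to the insertion.
\<close>

lemma insertion_raise_eq_frame_sum:
  assumes "alternating \<alpha>" "alternating \<beta>"
  shows "insertion (raise h \<alpha>) \<beta> =
    (\<lambda>vs. \<Sum>i<DIM('e). eta i i * wedge (interior_product (E i) \<alpha>) (interior_product (E i) \<beta>) vs)"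
proof
  fix vs
  have "\<beta> (raise h \<alpha> us # ws) = (\<Sum>i<DIM('e). eta i i * \<alpha> (E i # us) * \<beta> (E i # ws))" for us ws
    unfolding raise_eq_frame_sum(1)[OF assms(1)]
    by (simp add: linear_sum[OF alternating_linear_head[OF assms(2)]]
        linear_scale[OF alternating_linear_head[OF assms(2)]])
  then have "insertion (raise h \<alpha>) \<beta> vs = (\<Sum>S\<in>Pow {..<length vs}. \<Sum>i<DIM('e).
      eta i i * (shuffle_sign S * \<alpha> (E i # nths vs S) * \<beta> (E i # nths vs (- S))))"
    by (simp add: insertion_def sum_distrib_left algebra_simps)
  also have "\<dots> = (\<Sum>i<DIM('e). eta i i * wedge (interior_product (E i) \<alpha>) (interior_product (E i) \<beta>) vs)"
    unfolding wedge_def interior_product_apply sum_distrib_left by (rule sum.swap)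
  finally show "insertion (raise h \<alpha>) \<beta> vs =
      (\<Sum>i<DIM('e). eta i i * wedge (interior_product (E i) \<alpha>) (interior_product (E i) \<beta>) vs)" .
qed

lemma alternating_insertion_raise:
  assumes "alternating \<alpha>" "alternating \<beta>" shows "alternating (insertion (raise h \<alpha>) \<beta>)"
  unfolding insertion_raise_eq_frame_sum[OF assms]
  by (intro alternating_sum alternating_wedge alternating_interior_product assms)

text \<open>
  An infinitesimal change of the frame which keeps it orthonormal to first order leaves the contraction with
  the inverse metric unchanged to first order: it pairs a skew matrix with a symmetric one.
\<close>

lemma frame_contraction_infinitesimally_invariant:
  assumes F: "\<And>i j. i < DIM('e) \<Longrightarrow> j < DIM('e) \<Longrightarrow> h (F i) (E j) + h (E i) (F j) = 0"
    and B: "\<And>w. linear (\<lambda>v. B v w)" "\<And>w. linear (\<lambda>v. B w v)"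
  shows "(\<Sum>i<DIM('e). eta i i * (B (E i) (F i) + B (F i) (E i))) = (0::real)"
proof -
  let ?s = "\<lambda>i j. eta i i * eta j j * h (E j) (F i) * (B (E i) (E j) + B (E j) (E i))"
  have FE: "F i = (\<Sum>j<DIM('e). (eta j j * h (E j) (F i)) *\<^sub>R E j)" for i by (rule frame_expansion)
  have "eta i i * (B (E i) (F i) + B (F i) (E i)) = (\<Sum>j<DIM('e). ?s i j)" for i
  proof -
    have "B (E i) (F i) = (\<Sum>j<DIM('e). eta j j * h (E j) (F i) * B (E i) (E j))"
      by (subst FE) (simp add: linear_sum[OF B(2)] linear_scale[OF B(2)])
    moreover have "B (F i) (E i) = (\<Sum>j<DIM('e). eta j j * h (E j) (F i) * B (E j) (E i))"
      by (subst FE) (simp add: linear_sum[OF B(1)] linear_scale[OF B(1)])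
    ultimately show ?thesis
      by (simp add: sum_distrib_left sum.distrib[symmetric] algebra_simps)
  qed
  then have eq: "(\<Sum>i<DIM('e). eta i i * (B (E i) (F i) + B (F i) (E i))) = (\<Sum>i<DIM('e). \<Sum>j<DIM('e). ?s i j)"
    by simp
  have "(\<Sum>i<DIM('e). \<Sum>j<DIM('e). ?s i j) = (\<Sum>i<DIM('e). \<Sum>j<DIM('e). ?s j i)" by (rule sum.swap)
  also have "\<dots> = (\<Sum>i<DIM('e). \<Sum>j<DIM('e). - ?s i j)"
  proof (intro sum.cong refl)
    fix i j assume "i \<in> {..<DIM('e)}" "j \<in> {..<DIM('e)}"
    then have "h (E i) (F j) = - h (E j) (F i)" using F[of i j] symmetric[of "F i"] by simp
    then show "?s j i = - ?s i j" by (simp add: algebra_simps)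
  qed
  finally show ?thesis unfolding eq by (simp add: sum_negf)
qed

end

locale null_covector = lorentz_frame h E
  for h :: "'e::euclidean_space \<Rightarrow> 'e \<Rightarrow> real" and E :: "nat \<Rightarrow> 'e" +
  fixes \<kappa> :: "'e form"
  assumes alternating_null: "alternating \<kappa>" and degree_null: "has_degree 1 \<kappa>" and nonzero: "\<kappa> \<noteq> (\<lambda>_. 0)"
    and null: "h (raise h \<kappa> []) (raise h \<kappa> []) = 0"
begin

definition K where "K = raise h \<kappa> []"

lemma metric_K: "h Y K = \<kappa> [Y]"
  unfolding K_def by (rule metric_raise[OF alternating_null])

lemma linear_null: "linear (\<lambda>v. \<kappa> [v])"
  using alternating_linear_head[OF alternating_null] .

lemma null_eval_K: "\<kappa> [K] = 0"
  using null metric_K[of K] by (simp add: K_def)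

lemma K_nonzero: "K \<noteq> 0"
proof
  assume "K = 0"
  then have 1: "\<kappa> [Y] = 0" for Y using metric_K[of Y] linear_0[OF linear_right[of Y]] by simp
  have "\<kappa> vs = 0" for vs
  proof (cases "length vs = 1")
    case True
    then obtain v where "vs = [v]" by (auto simp: length_Suc_conv)
    then show ?thesis using 1 by simp
  next
    case False
    then show ?thesis using degree_null by (simp add: has_degree_def)
  qed
  then show False using nonzero by blast
qed

lemma interior_product_K:
  assumes "alternating \<alpha>"
  shows "interior_product K \<alpha> vs = (\<Sum>i<DIM('e). eta i i * (\<kappa> [E i] * interior_product (E i) \<alpha> vs))"
  unfolding K_def raise_eq_frame_sum(1)[OF alternating_null] interior_product_apply
  by (simp add: linear_sum[OF alternating_linear_head[OF assms]]
      linear_scale[OF alternating_linear_head[OF assms]] mult.assoc)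

lemma null_alongD:
  assumes "null_along h \<kappa> \<alpha>" "alternating \<alpha>"
  shows "wedge \<kappa> \<alpha> = (\<lambda>vs. 0)" "interior_product K \<alpha> = (\<lambda>vs. 0)"
proof -
  show "wedge \<kappa> \<alpha> = (\<lambda>vs. 0)" using assms by (simp add: null_along_def)
  have "contraction h \<kappa> \<alpha> = interior_product K \<alpha>"
    unfolding contraction_def insertion_raise_eq_frame_sum[OF alternating_null assms(2)]
      interior_product_1form[OF degree_null]
    by (simp add: interior_product_K[OF assms(2)] wedge_scale_left wedge_unit_left fun_eq_iff)
  then show "interior_product K \<alpha> = (\<lambda>vs. 0)" using assms by (simp add: null_along_def)
qed

text \<open>A form with \<open>\<kappa> \<and> \<phi> = 0\<close> is divisible by \<open>\<kappa>\<close>; contracting this equation with \<open>N\<close> gives the quotient.\<close>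

lemma null_factor:
  assumes "wedge \<kappa> \<alpha> = (\<lambda>vs. 0)" "\<kappa> [N] = 1"
  shows "\<alpha> = wedge \<kappa> (interior_product N \<alpha>)"
  using interior_product_wedge_1form[OF degree_null, of N \<alpha>] assms
  by (simp add: fun_eq_iff interior_product_apply)

lemma interior_product_change:
  assumes "wedge \<kappa> \<alpha> = (\<lambda>vs. 0)" "alternating \<alpha>" "\<kappa> [N] = 1" "\<kappa> [N'] = 1"
  shows "interior_product N' \<alpha> =
    (\<lambda>vs. interior_product N \<alpha> vs - wedge \<kappa> (interior_product (N' - N) (interior_product N \<alpha>)) vs)"
proof -
  have "\<kappa> [N' - N] = 0" using linear_diff[OF linear_null] assms by simp
  then have "interior_product (N' - N) (wedge \<kappa> (interior_product N \<alpha>)) =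
      (\<lambda>vs. - wedge \<kappa> (interior_product (N' - N) (interior_product N \<alpha>)) vs)"
    by (simp add: interior_product_wedge_1form[OF degree_null])
  moreover have "interior_product (N' - N) (wedge \<kappa> (interior_product N \<alpha>)) = interior_product (N' - N) \<alpha>"
    using null_factor[OF assms(1,3)] by simp
  ultimately show ?thesis
    using interior_product_linear(1)[OF assms(2), of N "N' - N"] by simp
qed

text \<open>
  Another choice of \<open>N\<close> changes the quotient by a multiple of \<open>\<kappa>\<close>, which the other factor,
  itself a multiple of \<open>\<kappa>\<close>, annihilates.
\<close>

lemma curlywedge_independent:
  assumes "wedge \<kappa> \<alpha> = (\<lambda>vs. 0)" "wedge \<kappa> \<beta> = (\<lambda>vs. 0)" "alternating \<beta>" "\<kappa> [N] = 1" "\<kappa> [N'] = 1"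
  shows "wedge \<alpha> (interior_product N' \<beta>) = wedge \<alpha> (interior_product N \<beta>)"
proof -
  have "wedge \<kappa> (parity \<alpha>) = (\<lambda>vs. - parity (wedge \<kappa> \<alpha>) vs)"
    by (simp add: parity_wedge parity_1form[OF degree_null] wedge_minus_left)
  then have "wedge \<alpha> \<kappa> = (\<lambda>vs. 0)"
    using assms(1) by (simp add: wedge_1form_commute[OF degree_null] parity_def)
  then have "wedge \<alpha> (wedge \<kappa> \<gamma>) vs = 0" for \<gamma> vs
    by (simp add: wedge_assoc[symmetric] wedge_zero_left)
  then show ?thesis
    by (simp add: interior_product_change[OF assms(2-5)] wedge_diff_right fun_eq_iff)
qed

text \<open>
  The expression \<open>g\<^sup>a\<^sup>b \<kappa> \<and> \<alpha>\<^sub>a \<and> \<beta>\<^sub>b\<close>, with \<open>\<alpha>\<^sub>a\<close> the contraction of \<open>\<alpha>\<close> with the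
  basis vector of index \<open>a\<close>, written in the orthonormal frame.
\<close>

definition metric_wedge :: "'e form \<Rightarrow> 'e form \<Rightarrow> 'e form" where
  "metric_wedge \<alpha> \<beta> vs =
     (\<Sum>i<DIM('e). eta i i * wedge \<kappa> (wedge (interior_product (E i) \<alpha>) (interior_product (E i) \<beta>)) vs)"

lemma wedge_null_insertion_raise:
  assumes "alternating \<alpha>" "alternating \<beta>"
  shows "wedge \<kappa> (insertion (raise h \<alpha>) \<beta>) = metric_wedge \<alpha> \<beta>"
  unfolding insertion_raise_eq_frame_sum[OF assms] metric_wedge_def
  by (rule ext) (simp add: wedge_sum_right wedge_scale_right)

lemma metric_wedge_null_right:
  assumes "alternating \<alpha>" "interior_product K \<alpha> = (\<lambda>vs. 0)"
  shows "metric_wedge \<alpha> (wedge \<kappa> \<gamma>) vs = 0"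
proof -
  have 1: "wedge \<kappa> (wedge (interior_product v \<alpha>) (interior_product v (wedge \<kappa> \<gamma>))) vs =
      wedge \<kappa> (wedge (\<lambda>vs. \<kappa> [v] * interior_product v \<alpha> vs) \<gamma>) vs" for v
    unfolding interior_product_wedge_1form[OF degree_null]
    by (simp add: wedge_diff_right wedge_scale_right wedge_scale_left wedge_1form_sandwich[OF degree_null])
  have "metric_wedge \<alpha> (wedge \<kappa> \<gamma>) vs = wedge \<kappa> (wedge (interior_product K \<alpha>) \<gamma>) vs"
    unfolding metric_wedge_def 1 interior_product_K[OF assms(1), abs_def]
    by (simp add: wedge_sum_right wedge_sum_left wedge_scale_left wedge_scale_right)
  then show ?thesis by (simp add: assms(2) wedge_zero_left wedge_zero_right)
qed

lemma metric_wedge_null_left: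
  assumes "alternating \<beta>" "interior_product K \<beta> = (\<lambda>vs. 0)"
  shows "metric_wedge (wedge \<kappa> \<gamma>) \<beta> vs = 0"
proof -
  have 1: "wedge \<kappa> (wedge (interior_product v (wedge \<kappa> \<gamma>)) (interior_product v \<beta>)) vs =
      wedge \<kappa> (wedge \<gamma> (\<lambda>vs. \<kappa> [v] * interior_product v \<beta> vs)) vs" for v
  proof -
    have "wedge \<kappa> (wedge (wedge \<kappa> \<delta>) \<delta>') vs = 0" for \<delta> \<delta>'
      by (simp add: wedge_assoc[symmetric] wedge_1form_self[OF degree_null] wedge_zero_left)
    then show ?thesis
      unfolding interior_product_wedge_1form[OF degree_null]
      by (simp add: wedge_diff_left wedge_diff_right wedge_scale_right wedge_scale_left)
  qed
  have "metric_wedge (wedge \<kappa> \<gamma>) \<beta> vs = wedge \<kappa> (wedge \<gamma> (interior_product K \<beta>)) vs"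
    unfolding metric_wedge_def 1 interior_product_K[OF assms(1), abs_def]
    by (simp add: wedge_sum_right wedge_scale_right)
  then show ?thesis by (simp add: assms(2) wedge_zero_left wedge_zero_right)
qed

lemma metric_wedge_diff:
  "metric_wedge (\<lambda>vs. \<alpha> vs - \<alpha>' vs) \<beta> vs = metric_wedge \<alpha> \<beta> vs - metric_wedge \<alpha>' \<beta> vs"
  "metric_wedge \<alpha> (\<lambda>vs. \<beta> vs - \<beta>' vs) vs = metric_wedge \<alpha> \<beta> vs - metric_wedge \<alpha> \<beta>' vs"
  by (simp_all add: metric_wedge_def interior_product_def wedge_diff_left wedge_diff_right
      sum_subtractf algebra_simps)

lemma interior_product_K_quotient:
  assumes "alternating \<alpha>" "interior_product K \<alpha> = (\<lambda>vs. 0)"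
  shows "interior_product K (interior_product N \<alpha>) = (\<lambda>vs. 0)"
  unfolding interior_product_anticommute[OF assms(1), of K N] assms(2)
  by (simp add: interior_product_def)

text \<open>
  A multiple of \<open>\<kappa>\<close> in one factor contributes either a second \<open>\<kappa>\<close>, or, when its \<open>\<kappa>\<close> is the contracted
  index, the contraction of the other factor with the vector dual to \<open>\<kappa>\<close>. Both vanish.
\<close>

lemma bar_curlywedge_independent:
  assumes \<alpha>: "wedge \<kappa> \<alpha> = (\<lambda>vs. 0)" "alternating \<alpha>" "interior_product K \<alpha> = (\<lambda>vs. 0)"
    and \<beta>: "wedge \<kappa> \<beta> = (\<lambda>vs. 0)" "alternating \<beta>" "interior_product K \<beta> = (\<lambda>vs. 0)"
    and N: "\<kappa> [N] = 1" "\<kappa> [N'] = 1"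
  shows "metric_wedge (interior_product N' \<alpha>) (interior_product N' \<beta>) =
    metric_wedge (interior_product N \<alpha>) (interior_product N \<beta>)"
proof
  fix vs
  have l: "metric_wedge (interior_product N' \<alpha>) (interior_product N' \<beta>) vs =
      metric_wedge (interior_product N \<alpha>) (interior_product N' \<beta>) vs"
    unfolding interior_product_change[OF \<alpha>(1,2) N] metric_wedge_diff
    by (simp add: metric_wedge_null_left alternating_interior_product \<beta> interior_product_K_quotient)
  also have "\<dots> = metric_wedge (interior_product N \<alpha>) (interior_product N \<beta>) vs"
    unfolding interior_product_change[OF \<beta>(1,2) N] metric_wedge_diff
    by (simp add: metric_wedge_null_right alternating_interior_product \<alpha> interior_product_K_quotient)
  finally show "metric_wedge (interior_product N' \<alpha>) (interior_product N' \<beta>) vs =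
      metric_wedge (interior_product N \<alpha>) (interior_product N \<beta>) vs" .
qed

text \<open>
  A vector orthogonal to a timelike one is spacelike or zero, by the Cauchy-Schwarz inequality for the
  spatial components.
\<close>

lemma null_eval_timelike:
  assumes T: "h T T < 0" shows "\<kappa> [T] \<noteq> 0"
proof
  assume "\<kappa> [T] = 0"
  then have hTK: "h T K = 0" by (simp add: metric_K)
  obtain n where n: "DIM('e) = Suc n" using DIM_positive[where 'a='e] gr0_implies_Suc by blast
  let ?t = "\<lambda>i. h (E i) T" and ?k = "\<lambda>i. h (E i) K"
  have product: "h v w = - (h (E 0) v * h (E 0) w) + (\<Sum>i<n. h (E (Suc i)) v * h (E (Suc i)) w)" for v w
  proof -
    show ?thesis unfolding metric_expansion[of v w] n
      by (simp add: sum.lessThan_Suc_shift eta_def del: sum.lessThan_Suc)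
  qed
  let ?tt = "\<Sum>i<n. (?t (Suc i))\<^sup>2" and ?kk = "\<Sum>i<n. (?k (Suc i))\<^sup>2"
  have tt: "?tt < (?t 0)\<^sup>2" using T product[of T T] by (simp add: power2_eq_square)
  have kk: "?kk = (?k 0)\<^sup>2" using product[of K K] null by (simp add: power2_eq_square K_def)
  have "(\<Sum>i<n. ?t (Suc i) * ?k (Suc i)) = ?t 0 * ?k 0" using product[of T K] hTK by simp
  then have "(?t 0)\<^sup>2 * (?k 0)\<^sup>2 \<le> ?tt * ?kk"
    using Cauchy_Schwarz_ineq_sum[of "\<lambda>i. ?t (Suc i)" "\<lambda>i. ?k (Suc i)" "{..<n}"]
    by (simp add: power_mult_distrib)
  then have k0: "?k 0 = 0" using tt kk by (simp add: mult_le_cancel_right)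
  then have "?kk = 0" using kk by simp
  then have "?k (Suc i) = 0" if "i < n" for i using that by (simp add: sum_nonneg_eq_0_iff)
  with k0 have "?k i = 0" if "i < DIM('e)" for i using that n by (cases i) auto
  then show False using frame_expansion[of K] K_nonzero by simp
qed

end


section \<open>The local products in an adapted coframe\<close>

lemma sum_lists_length_Suc:
  "(\<Sum>is\<in>{is. length is = Suc l \<and> set is \<subseteq> I}. f is) =
     (\<Sum>i\<in>I. \<Sum>is\<in>{is. length is = l \<and> set is \<subseteq> I}. f (i # is))"
proof -
  let ?L = "{is. length is = l \<and> set is \<subseteq> I}"
  have "{is. length is = Suc l \<and> set is \<subseteq> I} = (\<lambda>(i, is). i # is) ` (I \<times> ?L)"
    by (auto simp: length_Suc_conv)
  then have "(\<Sum>is\<in>{is. length is = Suc l \<and> set is \<subseteq> I}. f is) = (\<Sum>(i, is)\<in>I \<times> ?L. f (i # is))"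
    by (simp add: sum.reindex inj_on_def case_prod_unfold)
  then show ?thesis by (simp add: sum.cartesian_product)
qed

text \<open>
  Expanding the first factor along the arguments, each argument, brought to the front, contributes
  the same amount; induction on the degree thus produces the factorial.
\<close>

lemma sum_wedge_list_eq_projection:
  assumes "\<And>i. i \<in> I \<Longrightarrow> has_degree 1 (\<theta> i)" "alternating \<alpha>"
  shows "(\<Sum>is\<in>{is. length is = length vs \<and> set is \<subseteq> I}. \<alpha> (map e is) * wedge_list (map \<theta> is) vs) =
    fact (length vs) * \<alpha> (map (\<lambda>v. \<Sum>i\<in>I. \<theta> i [v] *\<^sub>R e i) vs)"
  using assms(2)
proof (induction "length vs" arbitrary: \<alpha> vs)
  case 0
  then have "{is. length is = length vs \<and> set is \<subseteq> I} = {[]}" by auto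
  then show ?case using 0 by (simp add: wedge_list_def unit_form_def)
next
  case (Suc l)
  let ?P = "\<lambda>v. \<Sum>i\<in>I. \<theta> i [v] *\<^sub>R e i"
  let ?L = "{is. length is = l \<and> set is \<subseteq> I}"
  let ?del = "\<lambda>j. take j vs @ drop (Suc j) vs"
  have IH: "(\<Sum>is\<in>?L. \<alpha> (e i # map e is) * wedge_list (map \<theta> is) (?del j)) =
      fact l * \<alpha> (e i # map ?P (?del j))" if "j < Suc l" for i j
  proof -
    have l: "l = length (?del j)" using that Suc.hyps(2) by simp
    show ?thesis
      using Suc.hyps(1)[OF l alternating_interior_product[OF Suc.prems, of "e i"]] l
      by (simp add: interior_product_def)
  qed
  have front: "(- 1) ^ j * \<alpha> (?P (vs ! j) # map ?P (?del j)) = \<alpha> (map ?P vs)" if j: "j < Suc l" for j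
  proof -
    have "map ?P vs = map ?P (take j vs) @ ?P (vs ! j) # map ?P (drop (Suc j) vs)"
      using arg_cong[OF id_take_nth_drop[of j vs], of "map ?P"] j Suc.hyps(2)
      by (simp only: map_append list.map(2))
    then have "\<alpha> (map ?P vs) = (- 1) ^ j * \<alpha> (?P (vs ! j) # map ?P (?del j))"
      using alternating_move_to_front[OF Suc.prems, of "map ?P (take j vs)"] j Suc.hyps(2) by simp
    then show ?thesis by simp
  qed
  note lin = alternating_linear_head[OF Suc.prems]
  have "(\<Sum>is\<in>{is. length is = length vs \<and> set is \<subseteq> I}. \<alpha> (map e is) * wedge_list (map \<theta> is) vs) =
      (\<Sum>i\<in>I. \<Sum>is\<in>?L. \<alpha> (e i # map e is) * wedge (\<theta> i) (wedge_list (map \<theta> is)) vs)"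
    unfolding Suc.hyps(2)[symmetric] sum_lists_length_Suc by (simp add: wedge_list_def)
  also have "\<dots> = (\<Sum>i\<in>I. \<Sum>is\<in>?L. \<Sum>j<Suc l.
      \<alpha> (e i # map e is) * ((- 1) ^ j * \<theta> i [vs ! j] * wedge_list (map \<theta> is) (?del j)))"
    using assms(1) by (simp add: wedge_1form_expand Suc.hyps(2)[symmetric] sum_distrib_left del: sum.lessThan_Suc)
  also have "\<dots> = (\<Sum>i\<in>I. \<Sum>j<Suc l. \<Sum>is\<in>?L.
      \<alpha> (e i # map e is) * ((- 1) ^ j * \<theta> i [vs ! j] * wedge_list (map \<theta> is) (?del j)))"
    by (intro sum.cong[OF refl] sum.swap)
  also have "\<dots> = (\<Sum>j<Suc l. \<Sum>i\<in>I. \<Sum>is\<in>?L.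
      \<alpha> (e i # map e is) * ((- 1) ^ j * \<theta> i [vs ! j] * wedge_list (map \<theta> is) (?del j)))"
    by (rule sum.swap)
  also have "\<dots> = (\<Sum>j<Suc l. (- 1) ^ j * (\<Sum>i\<in>I. \<theta> i [vs ! j] *
      (\<Sum>is\<in>?L. \<alpha> (e i # map e is) * wedge_list (map \<theta> is) (?del j))))"
    by (simp add: sum_distrib_left mult.left_commute mult.assoc del: sum.lessThan_Suc)
  also have "\<dots> = (\<Sum>j<Suc l. fact l * ((- 1) ^ j * \<alpha> (?P (vs ! j) # map ?P (?del j))))"
  proof (rule sum.cong[OF refl])
    fix j assume "j \<in> {..<Suc l}"
    then have j: "j < Suc l" by simp
    have "\<alpha> (?P (vs ! j) # map ?P (?del j)) = (\<Sum>i\<in>I. \<theta> i [vs ! j] * \<alpha> (e i # map ?P (?del j)))"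
      by (simp add: linear_sum[OF lin] linear_scale[OF lin])
    then show "(- 1) ^ j * (\<Sum>i\<in>I. \<theta> i [vs ! j] *
        (\<Sum>is\<in>?L. \<alpha> (e i # map e is) * wedge_list (map \<theta> is) (?del j))) =
        fact l * ((- 1) ^ j * \<alpha> (?P (vs ! j) # map ?P (?del j)))"
      unfolding IH[OF j] by (simp add: sum_distrib_left mult.left_commute)
  qed
  also have "\<dots> = (\<Sum>j<Suc l. fact l * \<alpha> (map ?P vs))"
    by (rule sum.cong[OF refl]) (simp only: front lessThan_iff)
  also have "\<dots> = fact (length vs) * \<alpha> (map ?P vs)"
    unfolding Suc.hyps(2)[symmetric] by (simp add: algebra_simps)
  finally show ?case .
qed

text \<open>In dimension one the metric is negative definite and admits no nonzero null vector.\<close>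

lemma (in null_covector) two_le_DIM: "2 \<le> DIM('e)"
proof (rule ccontr)
  assume "\<not> 2 \<le> DIM('e)"
  then have D: "DIM('e) = 1" using DIM_positive[where 'a='e] by linarith
  have "h K K = - (h (E 0) K * h (E 0) K)"
    unfolding metric_expansion[of K K] D by (simp add: eta_def)
  then have "h (E 0) K = 0" using null by (simp add: K_def)
  then have "(\<Sum>i<DIM('e). (eta i i * h (E i) K) *\<^sub>R E i) = 0" by (simp add: D)
  then show False using frame_expansion[of K] K_nonzero by metis
qed

locale null_coframe = null_covector h E \<kappa>
  for h :: "'e::euclidean_space \<Rightarrow> 'e \<Rightarrow> real" and E :: "nat \<Rightarrow> 'e" and \<kappa> :: "'e form" +
  fixes ep :: "'e form" and et :: "nat \<Rightarrow> 'e form"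
  assumes alternating_ep: "alternating ep"
    and alternating_et: "i < DIM('e) - 2 \<Longrightarrow> alternating (et i)"
    and degree_et: "i < DIM('e) - 2 \<Longrightarrow> has_degree 1 (et i)"
    and metric_coframe:
      "h u v = \<kappa> [u] * ep [v] + ep [u] * \<kappa> [v] + (\<Sum>i<DIM('e) - 2. et i [u] * et i [v])"
begin

lemma coframe_separates:
  assumes "\<kappa> [u] = \<kappa> [v]" "ep [u] = ep [v]" "\<And>j. j < DIM('e) - 2 \<Longrightarrow> et j [u] = et j [v]"
  shows "u = v"
  by (rule nondegenerate) (simp add: metric_coframe assms)

text \<open>
  By nondegeneracy the covectors of the coframe have no common zero, and they are as many as the
  dimension. So they take arbitrary values on a suitable vector.
\<close>

lemma coframe_surjective:
  obtains v where "\<kappa> [v] = a" "ep [v] = b" "\<And>j. j < DIM('e) - 2 \<Longrightarrow> et j [v] = c j"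
proof -
  obtain ix where ix: "bij_betw ix (Basis :: 'e set) {0..<DIM('e)}"
    using ex_bij_betw_finite_nat[OF finite_Basis] by blast
  define co where "co i v = (if i = 0 then \<kappa> [v] else if i = 1 then ep [v] else et (i - 2) [v])" for i v
  define val where "val i = (if i = 0 then a else if i = 1 then b else c (i - 2))" for i :: nat
  define \<Phi> where "\<Phi> v = (\<Sum>b\<in>Basis. co (ix b) v *\<^sub>R b)" for v
  have lin_co: "linear (co i)" if "i < DIM('e)" for i
  proof (cases "i = 0 \<or> i = 1")
    case True
    then show ?thesis
      using linear_null alternating_linear_head[OF alternating_ep, of "[]"] by (auto simp: co_def[abs_def])
  next
    case False
    then have "i - 2 < DIM('e) - 2" using that by linarith
    then show ?thesis
      using False alternating_linear_head[OF alternating_et, of "i - 2" "[]"] by (simp add: co_def[abs_def])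
  qed
  have less: "ix b < DIM('e)" if "b \<in> Basis" for b using ix that by (auto dest: bij_betwE)
  have "linear \<Phi>"
    unfolding \<Phi>_def
    by (rule linearI) (simp_all add: linear_add[OF lin_co] linear_scale[OF lin_co] less scaleR_add_left
        sum.distrib scaleR_right.sum cong: sum.cong)
  have coord: "co i u = co i v" if eq: "\<Phi> u = \<Phi> v" and i: "i < DIM('e)" for u v i
  proof -
    obtain b where b: "b \<in> Basis" "i = ix b"
      using ix i by (metis atLeastLessThan_iff bij_betw_imp_surj_on imageE zero_le)
    have "\<Phi> w \<bullet> b = co (ix b) w" for w
      unfolding \<Phi>_def using b(1) by (simp add: inner_sum_left inner_Basis if_distrib cong: if_cong)
    then show ?thesis using eq b(2) by metis
  qed
  have "inj \<Phi>"
  proof (rule injI)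
    fix u v assume eq: "\<Phi> u = \<Phi> v"
    show "u = v"
    proof (rule coframe_separates)
      show "\<kappa> [u] = \<kappa> [v]" using coord[OF eq, of 0] two_le_DIM by (simp add: co_def)
      show "ep [u] = ep [v]" using coord[OF eq, of 1] two_le_DIM by (simp add: co_def)
      show "et j [u] = et j [v]" if "j < DIM('e) - 2" for j
        using coord[OF eq, of "j + 2"] that by (simp add: co_def)
    qed
  qed
  then have "surj \<Phi>" using \<open>linear \<Phi>\<close> linear_injective_imp_surjective by blast
  then obtain v where v: "\<Phi> v = (\<Sum>b\<in>Basis. val (ix b) *\<^sub>R b)" by (metis surjD)
  have val: "co i v = val i" if i: "i < DIM('e)" for i
  proof -
    obtain b where b: "b \<in> Basis" "i = ix b"
      using ix i by (metis atLeastLessThan_iff bij_betw_imp_surj_on imageE zero_le)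
    have "\<Phi> v \<bullet> b = co (ix b) v" "(\<Sum>b\<in>Basis. val (ix b) *\<^sub>R b) \<bullet> b = val (ix b)"
      unfolding \<Phi>_def using b(1) by (simp_all add: inner_sum_left inner_Basis if_distrib cong: if_cong)
    then show ?thesis using v b(2) by simp
  qed
  show thesis
  proof (rule that)
    show "\<kappa> [v] = a" using val[of 0] two_le_DIM by (simp add: co_def val_def)
    show "ep [v] = b" using val[of 1] two_le_DIM by (simp add: co_def val_def)
    show "et j [v] = c j" if "j < DIM('e) - 2" for j
      using val[of "j + 2"] that by (simp add: co_def val_def)
  qed
qed

definition e_minus where "e_minus = dual_minus \<kappa> ep et"
definition e_transverse where "e_transverse = dual_transverse \<kappa> ep et"

lemma dual_minus_props: "\<kappa> [e_minus] = 1" "ep [e_minus] = 0" "j < DIM('e) - 2 \<Longrightarrow> et j [e_minus] = 0"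
proof -
  have "\<exists>!v. \<kappa> [v] = 1 \<and> ep [v] = 0 \<and> (\<forall>j<DIM('e) - 2. et j [v] = 0)"
  proof (rule ex_ex1I)
    obtain v where "\<kappa> [v] = 1" "ep [v] = 0" "\<And>j. j < DIM('e) - 2 \<Longrightarrow> et j [v] = 0"
      using coframe_surjective[of 1 0 "\<lambda>j. 0"] by blast
    then show "\<exists>v. \<kappa> [v] = 1 \<and> ep [v] = 0 \<and> (\<forall>j<DIM('e) - 2. et j [v] = 0)" by blast
  qed (rule coframe_separates, simp_all)
  from theI'[OF this] show "\<kappa> [e_minus] = 1" "ep [e_minus] = 0" "j < DIM('e) - 2 \<Longrightarrow> et j [e_minus] = 0"
    unfolding e_minus_def dual_minus_def by auto
qed

lemma dual_transverse_props:
  "\<kappa> [e_transverse i] = 0" "ep [e_transverse i] = 0" "j < DIM('e) - 2 \<Longrightarrow> et j [e_transverse i] = (if j = i then 1 else 0)"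
proof -
  have "\<exists>!v. \<kappa> [v] = 0 \<and> ep [v] = 0 \<and> (\<forall>j<DIM('e) - 2. et j [v] = (if j = i then 1 else 0))"
  proof (rule ex_ex1I)
    obtain v where "\<kappa> [v] = 0" "ep [v] = 0" "\<And>j. j < DIM('e) - 2 \<Longrightarrow> et j [v] = (if j = i then 1 else 0)"
      using coframe_surjective[of 0 0 "\<lambda>j. if j = i then 1 else 0"] by blast
    then show "\<exists>v. \<kappa> [v] = 0 \<and> ep [v] = 0 \<and> (\<forall>j<DIM('e) - 2. et j [v] = (if j = i then 1 else 0))" by blast
  qed (rule coframe_separates, simp_all)
  from theI'[OF this] show "\<kappa> [e_transverse i] = 0" "ep [e_transverse i] = 0"
    "j < DIM('e) - 2 \<Longrightarrow> et j [e_transverse i] = (if j = i then 1 else 0)"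
    unfolding e_transverse_def dual_transverse_def by auto
qed

text \<open>The remaining vector of the dual frame, on which \<open>ep\<close> is 1, is the vector \<open>K\<close> dual to \<open>\<kappa>\<close>.\<close>

lemma dual_frame_expansion:
  "v = \<kappa> [v] *\<^sub>R e_minus + ep [v] *\<^sub>R K + (\<Sum>i<DIM('e) - 2. et i [v] *\<^sub>R e_transverse i)" (is "_ = ?w")
proof (rule nondegenerate)
  fix Y
  have e_minus: "h Y e_minus = ep [Y]" by (simp add: metric_coframe dual_minus_props)
  have e_transverse: "h Y (e_transverse i) = et i [Y]" if "i < DIM('e) - 2" for i
  proof -
    have "(\<Sum>j<DIM('e) - 2. et j [Y] * et j [e_transverse i]) = (\<Sum>j<DIM('e) - 2. if j = i then et j [Y] else 0)"
      by (intro sum.cong) (simp_all add: dual_transverse_props)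
    then show ?thesis using that by (simp add: metric_coframe dual_transverse_props)
  qed
  have "h Y ?w = \<kappa> [v] * ep [Y] + ep [v] * \<kappa> [Y] + (\<Sum>i<DIM('e) - 2. et i [v] * et i [Y])"
    by (simp add: linear_add[OF linear_right] linear_scale[OF linear_right] linear_sum[OF linear_right]
        e_minus e_transverse metric_K)
  then show "h Y v = h Y ?w" by (simp add: metric_coframe mult.commute)
qed

text \<open>
  Each argument differs from its transverse part by a combination of \<open>e_minus\<close> and \<open>K\<close>; brought to the
  front, these annihilate the form.
\<close>

lemma transverse_form_projection:
  assumes "alternating \<alpha>" "interior_product e_minus \<alpha> = (\<lambda>vs. 0)" "interior_product K \<alpha> = (\<lambda>vs. 0)"
  shows "\<alpha> (map (\<lambda>v. \<Sum>i<DIM('e) - 2. et i [v] *\<^sub>R e_transverse i) vs) = \<alpha> vs"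
proof -
  let ?P = "\<lambda>v. \<Sum>i<DIM('e) - 2. et i [v] *\<^sub>R e_transverse i"
  have "\<alpha> (us @ map ?P vs) = \<alpha> (us @ vs)" for us
  proof (induction vs arbitrary: us)
    case (Cons v vs)
    note lin = alternating_linear[OF assms(1), of us vs]
    have kill: "\<alpha> (us @ e_minus # vs) = 0" "\<alpha> (us @ K # vs) = 0"
      using fun_cong[OF assms(2), of "us @ vs"] fun_cong[OF assms(3), of "us @ vs"]
      by (simp_all add: alternating_move_to_front[OF assms(1)] interior_product_def)
    have "\<alpha> (us @ v # vs) = \<alpha> (us @ (\<kappa> [v] *\<^sub>R e_minus + ep [v] *\<^sub>R K + ?P v) # vs)"
      using dual_frame_expansion[of v] by simp
    also have "\<dots> = \<alpha> (us @ ?P v # vs)"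
      by (simp add: linear_add[OF lin] linear_scale[OF lin] kill)
    finally show ?case using Cons[of "us @ [?P v]"] by simp
  qed simp
  from this[of "[]"] show ?thesis by simp
qed

lemma breve_eq_interior_product:
  assumes "alternating \<alpha>" "interior_product K \<alpha> = (\<lambda>vs. 0)"
  shows "breve \<kappa> ep et \<alpha> = interior_product e_minus \<alpha>"
proof
  fix vs
  have "breve \<kappa> ep et \<alpha> vs = interior_product e_minus \<alpha> (map (\<lambda>v. \<Sum>i<DIM('e) - 2. et i [v] *\<^sub>R e_transverse i) vs)"
    unfolding breve_def e_minus_def[symmetric] e_transverse_def[symmetric] interior_product_apply[of e_minus \<alpha>, symmetric]
    by (subst sum_wedge_list_eq_projection)
      (simp_all add: degree_et alternating_interior_product assms(1) del: One_nat_def)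
  also have "\<dots> = interior_product e_minus \<alpha> vs"
    by (intro transverse_form_projection alternating_interior_product interior_product_twice
        interior_product_K_quotient assms)
  finally show "breve \<kappa> ep et \<alpha> vs = interior_product e_minus \<alpha> vs" .
qed

lemma local_products_eq:
  assumes "null_along h \<kappa> \<alpha>" "alternating \<alpha>" "null_along h \<kappa> \<beta>" "alternating \<beta>" "\<kappa> [N] = 1"
  shows "curlywedge_local \<kappa> ep et \<alpha> \<beta> = wedge \<alpha> (interior_product N \<beta>)"
    and "bar_curlywedge_local h \<kappa> ep et \<alpha> \<beta> =
      wedge \<kappa> (insertion (raise h (interior_product N \<alpha>)) (interior_product N \<beta>))"
proof -
  note \<alpha> = null_alongD[OF assms(1,2)] and \<beta> = null_alongD[OF assms(3,4)]
  show "curlywedge_local \<kappa> ep et \<alpha> \<beta> = wedge \<alpha> (interior_product N \<beta>)"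
    unfolding curlywedge_local_def breve_eq_interior_product[OF assms(4) \<beta>(2)]
    by (rule curlywedge_independent[OF \<alpha>(1) \<beta>(1) assms(4,5) dual_minus_props(1)])
  show "bar_curlywedge_local h \<kappa> ep et \<alpha> \<beta> =
      wedge \<kappa> (insertion (raise h (interior_product N \<alpha>)) (interior_product N \<beta>))"
    unfolding bar_curlywedge_local_def breve_eq_interior_product[OF assms(4) \<beta>(2)]
      breve_eq_interior_product[OF assms(2) \<alpha>(2)]
    by (simp only: wedge_null_insertion_raise alternating_interior_product assms(2,4)
        bar_curlywedge_independent[OF \<alpha>(1) assms(2) \<alpha>(2) \<beta>(1) assms(4) \<beta>(2) assms(5) dual_minus_props(1)])
qed

end


section \<open>Existence of adapted coframes\<close>

text \<open>
  The columns of the reflection exchanging the unit vectors \<open>s e\<^sub>1\<close> and \<open>u\<close> are an orthonormal basis,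
  whose first vector is \<open>u\<close> up to sign. The entries are rational functions of \<open>u\<close> with the only
  denominator \<open>1 - s u\<^sub>1\<close>, so they are smooth where it does not vanish.
\<close>

lemma reflection_identity:
  fixes u x y :: "nat \<Rightarrow> real"
  assumes u: "(u 1)\<^sup>2 + (\<Sum>j<k. (u (j + 2))\<^sup>2) = 1" and s: "s * s = 1" and m: "m * (1 - s * u 1) = 1"
    and \<theta>: "\<theta> = u 1 * x 1 + (\<Sum>j<k. u (j + 2) * x (j + 2))"
    and \<theta>': "\<theta>' = u 1 * y 1 + (\<Sum>j<k. u (j + 2) * y (j + 2))"
  shows "\<theta> * \<theta>' + (\<Sum>j<k. (x (j + 2) - u (j + 2) * m * (\<theta> - s * x 1)) *
      (y (j + 2) - u (j + 2) * m * (\<theta>' - s * y 1))) = x 1 * y 1 + (\<Sum>j<k. x (j + 2) * y (j + 2))"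
proof -
  define d where "d = (\<Sum>j<k. (u (j + 2))\<^sup>2)"
  define r where "r = (\<Sum>j<k. x (j + 2) * y (j + 2))"
  let ?a = "m * (\<theta> - s * x 1)" and ?b = "m * (\<theta>' - s * y 1)"
  have sx: "(\<Sum>j<k. u (j + 2) * x (j + 2)) = \<theta> - u 1 * x 1"
    and sy: "(\<Sum>j<k. u (j + 2) * y (j + 2)) = \<theta>' - u 1 * y 1" using \<theta> \<theta>' by auto
  have "(x (j + 2) - u (j + 2) * m * (\<theta> - s * x 1)) * (y (j + 2) - u (j + 2) * m * (\<theta>' - s * y 1)) =
      x (j + 2) * y (j + 2) - (u (j + 2) * x (j + 2)) * ?b - (u (j + 2) * y (j + 2)) * ?a +
      (u (j + 2))\<^sup>2 * (?a * ?b)" for j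
    by (simp add: algebra_simps power2_eq_square)
  then have sum: "(\<Sum>j<k. (x (j + 2) - u (j + 2) * m * (\<theta> - s * x 1)) *
      (y (j + 2) - u (j + 2) * m * (\<theta>' - s * y 1))) =
      r - (\<theta> - u 1 * x 1) * ?b - (\<theta>' - u 1 * y 1) * ?a + d * (?a * ?b)"
    by (simp only: sum.distrib sum_subtractf sum_distrib_right[symmetric] sx sy d_def r_def)
  have "d = (1 - s * u 1) * (1 + s * u 1)"
    using u s unfolding d_def[symmetric] by algebra
  then have "d * ?a = (1 + s * u 1) * (\<theta> - s * x 1)"
    using m by algebra
  then have dab: "d * (?a * ?b) = (1 + s * u 1) * (\<theta> - s * x 1) * ?b"
    by (simp only: mult.assoc[symmetric])
  have "\<theta> * \<theta>' - (\<theta> - u 1 * x 1) * ?b - (\<theta>' - u 1 * y 1) * ?a + (1 + s * u 1) * (\<theta> - s * x 1) * ?b =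
      x 1 * y 1"
    using s m by algebra
  then show ?thesis unfolding sum dab r_def[symmetric] by linarith
qed

context null_covector
begin

lemma null_eval_frame_0: "\<kappa> [E 0] \<noteq> 0"
  using null_eval_timelike[of "E 0"] orthonormal[of 0 0] DIM_positive by (simp add: eta_def)

lemma null_eval_expansion: "\<kappa> [v] = (\<Sum>i<DIM('e). eta i i * (\<kappa> [E i] * h (E i) v))"
proof -
  have "\<kappa> [v] = \<kappa> [\<Sum>i<DIM('e). (eta i i * h (E i) v) *\<^sub>R E i]" using frame_expansion[of v] by simp
  then show ?thesis
    by (simp add: linear_sum[OF linear_null] linear_scale[OF linear_null] algebra_simps)
qed

lemma null_metric_frame: "h (E i) K = \<kappa> [E i]"
  by (rule metric_K)

text \<open>
  In an orthonormal frame, \<open>\<kappa> = \<kappa>(E\<^sub>0) (E\<^sup>0 + u)\<close> with \<open>E\<^sup>0\<close> from the dual basis and a unit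
  covector \<open>u\<close> of the spatial part; the coframe consists of \<open>(u - E\<^sup>0) / (2 \<kappa>(E\<^sub>0))\<close> and of an orthonormal basis of the
  spatial covectors orthogonal to \<open>u\<close>, given by a reflection.
\<close>

lemma reflected_coframe:
  fixes s m :: real
  defines "u \<equiv> \<lambda>b. \<kappa> [E b] * inverse (\<kappa> [E 0])"
  defines "L \<equiv> \<Sum>b\<in>{1..<DIM('e)}. u b *\<^sub>R E b"
  assumes s: "s * s = 1" and m: "m * (1 - s * u 1) = 1"
  shows "h v w = \<kappa> [v] * h (inverse (2 * \<kappa> [E 0]) *\<^sub>R (L + E 0)) w +
      h (inverse (2 * \<kappa> [E 0]) *\<^sub>R (L + E 0)) v * \<kappa> [w] +
      (\<Sum>j<DIM('e) - 2. h (E (j + 2) + (- (u (j + 2) * m)) *\<^sub>R (L + (- s) *\<^sub>R E 1)) v *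
        h (E (j + 2) + (- (u (j + 2) * m)) *\<^sub>R (L + (- s) *\<^sub>R E 1)) w)"
proof -
  define k where "k = DIM('e) - 2"
  have D: "DIM('e) = Suc (Suc k)" using two_le_DIM by (simp add: k_def)
  let ?k0 = "\<kappa> [E 0]"
  let ?x = "\<lambda>v i. h (E i) v"
  define \<theta> where "\<theta> v = h L v" for v
  have spatial: "(\<Sum>b\<in>{1..<DIM('e)}. f b) = f 1 + (\<Sum>j<k. f (j + 2))" for f :: "nat \<Rightarrow> real"
  proof -
    have "(\<Sum>b\<in>{1..<DIM('e)}. f b) = f 1 + (\<Sum>b\<in>{0 + 2..<k + 2}. f b)"
      unfolding D by (simp add: sum.atLeast_Suc_lessThan numeral_2_eq_2 del: sum.op_ivl_Suc)
    then show ?thesis unfolding sum.shift_bounds_nat_ivl by (simp add: atLeast0LessThan)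
  qed
  have all: "(\<Sum>i<DIM('e). eta i i * f i) = - f 0 + (f 1 + (\<Sum>j<k. f (j + 2)))" for f :: "nat \<Rightarrow> real"
    unfolding D by (simp add: sum.lessThan_Suc_shift eta_def numeral_2_eq_2 del: sum.lessThan_Suc)
  have ku: "\<kappa> [E b] = ?k0 * u b" for b using null_eval_frame_0 by (simp add: u_def)
  have \<theta>: "\<theta> v = u 1 * ?x v 1 + (\<Sum>j<k. u (j + 2) * ?x v (j + 2))" for v
    unfolding \<theta>_def L_def linear_sum[OF linear_left] linear_scale[OF linear_left] real_scaleR_def by (rule spatial)
  have "\<kappa> [K] = - (?k0 * ?k0) + ((?k0 * u 1) * (?k0 * u 1) + (\<Sum>j<k. (?k0 * u (j + 2)) * (?k0 * u (j + 2))))"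
    unfolding null_eval_expansion[of K] all null_metric_frame by (simp add: ku[symmetric])
  also have "\<dots> = ?k0 * ?k0 * (- 1 + ((u 1)\<^sup>2 + (\<Sum>j<k. (u (j + 2))\<^sup>2)))"
    by (simp add: algebra_simps power2_eq_square sum_distrib_left)
  finally have unit: "(u 1)\<^sup>2 + (\<Sum>j<k. (u (j + 2))\<^sup>2) = 1"
    using null_eval_K null_eval_frame_0 by simp
  have \<kappa>: "\<kappa> [v] = ?k0 * (\<theta> v - ?x v 0)" for v
  proof -
    have "\<kappa> [v] = - (?k0 * ?x v 0) + (?k0 * u 1 * ?x v 1 + (\<Sum>j<k. ?k0 * u (j + 2) * ?x v (j + 2)))"
      unfolding null_eval_expansion[of v] all by (simp add: ku[symmetric])
    then show ?thesis unfolding \<theta> by (simp add: algebra_simps sum_distrib_left)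
  qed
  have ep: "h (inverse (2 * ?k0) *\<^sub>R (L + E 0)) v = inverse (2 * ?k0) * (\<theta> v + ?x v 0)" for v
    by (simp add: \<theta>_def linear_scale[OF linear_left] linear_add[OF linear_left])
  have et: "h (E (j + 2) + (- (u (j + 2) * m)) *\<^sub>R (L + (- s) *\<^sub>R E 1)) v =
      ?x v (j + 2) - u (j + 2) * m * (\<theta> v - s * ?x v 1)" for v j
    by (simp only: \<theta>_def linear_scale[OF linear_left] linear_add[OF linear_left]) (simp add: algebra_simps)
  have "\<kappa> [v] * (inverse (2 * ?k0) * (\<theta> w + ?x w 0)) + inverse (2 * ?k0) * (\<theta> v + ?x v 0) * \<kappa> [w] =
      \<theta> v * \<theta> w - ?x v 0 * ?x w 0"
    unfolding \<kappa>[of v] \<kappa>[of w] using null_eval_frame_0 by (simp add: field_simps)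
  moreover have "h v w = - (?x v 0 * ?x w 0) + (?x v 1 * ?x w 1 + (\<Sum>j<k. ?x v (j + 2) * ?x w (j + 2)))"
    unfolding metric_expansion[of v w] all ..
  ultimately show ?thesis
    unfolding ep et k_def[symmetric] using reflection_identity[OF unit s m \<theta>[of v] \<theta>[of w]] by linarith
qed

end

definition lower_index :: "('m \<Rightarrow> 'e \<Rightarrow> 'e \<Rightarrow> real) \<Rightarrow> ('m \<Rightarrow> 'e) \<Rightarrow> 'm \<Rightarrow> 'e form" where
  "lower_index g X q vs = (if length vs = 1 then g q (X q) (hd vs) else 0)"

lemma alternating_lower_index:
  assumes "linear (g q (X q))" shows "alternating (lower_index g X q)"
proof -
  have "linear (\<lambda>v. lower_index g X q (us @ v # ws))" for us ws
    by (cases "us = [] \<and> ws = []") (use assms in \<open>auto simp: lower_index_def linear_iff\<close>)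
  then show ?thesis by (simp add: alternating_iff_adjacent lower_index_def)
qed

context manifold_atlas
begin

lemma smooth_lower_index:
  assumes g: "lorentzian_metric A g" and "open U" and X: "\<And>c. c \<in> A \<Longrightarrow> chart_smooth_field A c U X"
  shows "smooth_form_deg A U 1 (lower_index g X)"
  unfolding smooth_form_deg_def
proof (intro conjI smooth_formI ballI)
  show "alternating (lower_index g X p)" for p
    using g by (intro alternating_lower_index) (simp add: lorentzian_metric_def lorentzian_product_def bilinear_def)
  show "has_degree 1 (lower_index g X p)" for p by (simp add: has_degree_def lower_index_def)
  fix c assume c: "c \<in> A"
  show "chart_smooth_form A c U (lower_index g X)"
    unfolding chart_smooth_form_def
  proof (intro allI impI)
    fix Ys assume Ys: "\<forall>Y\<in>set Ys. chart_smooth_field A c U Y"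
    show "chart_smooth c U (\<lambda>q. lower_index g X q (map (\<lambda>X. X q) Ys))"
    proof (cases "length Ys = 1")
      case True
      then obtain Y where "Ys = [Y]" by (auto simp: length_Suc_conv)
      then show ?thesis
        using chart_smooth_metric[OF g c \<open>open U\<close> X[OF c], of Y] Ys by (simp add: lower_index_def)
    next
      case False
      then show ?thesis by (simp add: lower_index_def chart_smooth_const)
    qed
  qed
qed fact

lemma frame_null_covector:
  assumes g: "lorentzian_metric A g" and \<kappa>: "nowhere_vanishing_null_1form A g \<kappa>"
    and E: "oriented_orthonormal_frame A g vol T V E" and q: "q \<in> V"
  shows "null_covector (g q) (\<lambda>i. E i q) (\<kappa> q)"
proof
  show "bilinear (g q)" "\<And>u v. g q u v = g q v u"
    using g unfolding lorentzian_metric_def lorentzian_product_def by blast+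
  show "\<And>i j. i < DIM('e) \<Longrightarrow> j < DIM('e) \<Longrightarrow> g q (E i q) (E j q) = eta i j"
    using E q unfolding oriented_orthonormal_frame_def by blast
  show "alternating (\<kappa> q)" "has_degree 1 (\<kappa> q)" "\<kappa> q \<noteq> (\<lambda>_. 0)"
    "g q (raise (g q) (\<kappa> q) []) (raise (g q) (\<kappa> q) []) = 0"
    using \<kappa> unfolding nowhere_vanishing_null_1form_def smooth_form_deg_def smooth_form_def by blast+
qed

lemma adapted_coframe_exists:
  assumes g: "lorentzian_metric A g" and \<kappa>: "nowhere_vanishing_null_1form A g \<kappa>"
    and E: "oriented_orthonormal_frame A g vol T V E" and p: "p \<in> V"
  obtains U ep et where "p \<in> U" "adapted_coframe A g \<kappa> U ep et"
proof -
  note frame = frame_null_covector[OF g \<kappa> E]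
  have V: "open V" using E by (simp add: oriented_orthonormal_frame_def)
  have two: "2 \<le> DIM('e)" using null_covector.two_le_DIM[OF frame[OF p]] .
  have E_smooth: "chart_smooth_field A c V (E i)" if "c \<in> A" "i < DIM('e)" for c i
    using E that by (simp add: oriented_orthonormal_frame_def smooth_vector_field_iff_chart_smooth_field)
  have \<kappa>E_smooth: "chart_smooth c V (\<lambda>q. \<kappa> q [E i q])" if "c \<in> A" "i < DIM('e)" for c i
  proof -
    have "smooth_form A V \<kappa>"
      by (rule smooth_form_subset[of A UNIV])
        (use \<kappa> in \<open>auto simp: nowhere_vanishing_null_1form_def smooth_form_deg_def\<close>)
    then have "chart_smooth_form A c V \<kappa>"
      by (rule smooth_form_imp_chart_smooth_form) (use that V in auto)
    from chart_smooth_form_apply[OF this, of "[E i]"] show ?thesis using E_smooth[OF that] by simp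
  qed
  have \<kappa>E0: "\<kappa> q [E 0 q] \<noteq> 0" if "q \<in> V" for q
    using null_covector.null_eval_frame_0[OF frame[OF that]] .
  define u where "u b q = \<kappa> q [E b q] * inverse (\<kappa> q [E 0 q])" for b q
  have u_smooth: "chart_smooth c V (u b)" if "c \<in> A" "b < DIM('e)" for c b
    unfolding u_def[abs_def]
    by (intro chart_smooth_mult chart_smooth_inverse \<kappa>E_smooth \<kappa>E0 that DIM_positive)
  \<comment> \<open>The sign is chosen such that the denominator of the reflection does not vanish at the point.\<close>
  define s where "s = (if u 1 p = 1 then - 1 else 1 :: real)"
  have s: "s * s = 1" by (simp add: s_def)
  define den where "den q = 1 + (- s) * u 1 q" for q
  have den_smooth: "chart_smooth c V den" if "c \<in> A" for c
    unfolding den_def[abs_def]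
    using two that by (intro chart_smooth_add chart_smooth_mult chart_smooth_const u_smooth) auto
  have "den p \<noteq> 0" by (simp add: den_def s_def)
  then obtain U where U: "open U" "p \<in> U" "U \<subseteq> V" and den: "\<And>q. q \<in> U \<Longrightarrow> den q \<noteq> 0"
    using chart_smooth_nonzero_near[OF chart_at_props(1) V den_smooth[OF chart_at_props(1)] p chart_at_props(2)]
    by metis
  have onU: "chart_smooth_field A c U (E i)" "chart_smooth c U (u i)" "chart_smooth c U (\<lambda>q. \<kappa> q [E i q])" if "c \<in> A" "i < DIM('e)" for c i
    using E_smooth \<kappa>E_smooth u_smooth chart_smooth_subset chart_smooth_field_subset U(3) that by blast+
  have den_smooth_U: "chart_smooth c U den" if "c \<in> A" for c
    using den_smooth[OF that] U(3) by (rule chart_smooth_subset)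
  define L where "L q = (\<Sum>b\<in>{1..<DIM('e)}. u b q *\<^sub>R E b q)" for q
  define P where "P q = inverse (2 * \<kappa> q [E 0 q]) *\<^sub>R (L q + E 0 q)" for q
  define X where "X j q = E (j + 2) q + ((- 1) * (u (j + 2) q * inverse (den q))) *\<^sub>R (L q + (- s) *\<^sub>R E 1 q)" for j q
  have L_smooth: "chart_smooth_field A c U L" if "c \<in> A" for c
    unfolding L_def[abs_def]
    by (intro chart_smooth_field_sum chart_smooth_field_scaleR onU U that) auto
  have P_smooth: "chart_smooth_field A c U P" if "c \<in> A" for c
    unfolding P_def[abs_def]
    by (intro chart_smooth_field_scaleR chart_smooth_field_add chart_smooth_inverse chart_smooth_mult
        chart_smooth_const L_smooth onU U that DIM_positive) (use \<kappa>E0 U in auto)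
  have X_smooth: "chart_smooth_field A c U (X j)" if "c \<in> A" "j < DIM('e) - 2" for c j
    unfolding X_def[abs_def]
    using that by (intro chart_smooth_field_scaleR chart_smooth_field_add chart_smooth_inverse chart_smooth_mult
        chart_smooth_const L_smooth onU U den den_smooth_U) auto
  have "adapted_coframe A g \<kappa> U (lower_index g P) (\<lambda>j. lower_index g (X j))"
    unfolding adapted_coframe_def
  proof (intro conjI allI impI ballI)
    show "open U" by fact
    show "smooth_form_deg A U 1 (lower_index g P)"
      by (intro smooth_lower_index g U P_smooth)
    show "smooth_form_deg A U 1 (lower_index g (X j))" if "j < DIM('e) - 2" for j
      by (intro smooth_lower_index g U X_smooth that)
    fix q v w assume q: "q \<in> U"
    interpret null_covector "g q" "\<lambda>i. E i q" "\<kappa> q" by (rule frame) (use q U in auto)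
    have "inverse (den q) * (1 - s * (\<kappa> q [E 1 q] * inverse (\<kappa> q [E 0 q]))) = 1"
      using den[OF q] by (simp add: den_def u_def)
    from reflected_coframe[OF s this, of v w]
    show "g q v w = \<kappa> q [v] * lower_index g P q [w] + lower_index g P q [v] * \<kappa> q [w] +
        (\<Sum>j<DIM('e) - 2. lower_index g (X j) q [v] * lower_index g (X j) q [w])"
      by (simp add: lower_index_def P_def X_def L_def u_def)
  qed
  with U(2) that show thesis by blast
qed

end


section \<open>First-order contact and parallel forms\<close>

definition contact :: "(real \<Rightarrow> real) \<Rightarrow> (real \<Rightarrow> real) \<Rightarrow> bool" where
  "contact F G \<longleftrightarrow>
     F 0 = G 0 \<and> (\<exists>d. (F has_real_derivative d) (at 0) \<and> (G has_real_derivative d) (at 0))"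

lemma contact_const: "contact (\<lambda>t. a) (\<lambda>t. a)"
  unfolding contact_def by (auto intro!: exI[of _ 0])

lemma contact_add: "contact F G \<Longrightarrow> contact F' G' \<Longrightarrow> contact (\<lambda>t. F t + F' t) (\<lambda>t. G t + G' t)"
  unfolding contact_def by (auto intro: DERIV_add)

lemma contact_mult:
  assumes "contact F G" "contact F' G'" shows "contact (\<lambda>t. F t * F' t) (\<lambda>t. G t * G' t)"
proof -
  obtain d d' where d: "(F has_real_derivative d) (at 0)" "(G has_real_derivative d) (at 0)"
    "(F' has_real_derivative d') (at 0)" "(G' has_real_derivative d') (at 0)" "F 0 = G 0" "F' 0 = G' 0"
    using assms unfolding contact_def by blast
  have "((\<lambda>t. F t * F' t) has_real_derivative d * F' 0 + d' * F 0) (at 0)"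
    "((\<lambda>t. G t * G' t) has_real_derivative d * G' 0 + d' * G 0) (at 0)"
    using DERIV_mult[OF d(1,3)] DERIV_mult[OF d(2,4)] by simp_all
  then show ?thesis using d(5,6) unfolding contact_def by auto
qed

lemma contact_sum:
  "(\<And>i. i \<in> I \<Longrightarrow> contact (F i) (G i)) \<Longrightarrow> contact (\<lambda>t. \<Sum>i\<in>I. F i t) (\<lambda>t. \<Sum>i\<in>I. G i t)"
  by (induction I rule: infinite_finite_induct) (simp_all add: contact_const contact_add)

lemma contact_trans: "contact F G \<Longrightarrow> contact G H \<Longrightarrow> contact F H"
  unfolding contact_def by (metis DERIV_unique)

lemma contact_cong_left:
  assumes "contact F G" "eventually (\<lambda>t. F t = F' t) (nhds 0)" shows "contact F' G"
proof -
  have "F 0 = F' 0" using assms(2) by (rule eventually_nhds_x_imp_x)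
  then show ?thesis
    using assms(1) DERIV_cong_ev[OF refl assms(2) refl] unfolding contact_def by auto
qed

text \<open>
  Contact of two paths of forms, evaluated along the paths \<open>P\<close> and \<open>Q\<close> of vectors that are attached to
  each element of \<open>Y\<close>. It is used for moving vector fields against their
  first-order expansion at a point, and for affine paths against themselves.
\<close>

definition form_contact ::
    "(real \<Rightarrow> 'y \<Rightarrow> 'e) \<Rightarrow> (real \<Rightarrow> 'y \<Rightarrow> 'e) \<Rightarrow> 'y set \<Rightarrow> (real \<Rightarrow> 'e form) \<Rightarrow> (real \<Rightarrow> 'e form) \<Rightarrow> bool" where
  "form_contact P Q Y \<alpha> \<beta> \<longleftrightarrow>
     (\<forall>Xs. set Xs \<subseteq> Y \<longrightarrow> contact (\<lambda>t. \<alpha> t (map (P t) Xs)) (\<lambda>t. \<beta> t (map (Q t) Xs)))"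

lemma form_contactD:
  "form_contact P Q Y \<alpha> \<beta> \<Longrightarrow> set Xs \<subseteq> Y \<Longrightarrow> contact (\<lambda>t. \<alpha> t (map (P t) Xs)) (\<lambda>t. \<beta> t (map (Q t) Xs))"
  unfolding form_contact_def by blast

lemma form_contact_wedge:
  assumes "form_contact P Q Y \<alpha> \<beta>" "form_contact P Q Y \<alpha>' \<beta>'"
  shows "form_contact P Q Y (\<lambda>t. wedge (\<alpha> t) (\<alpha>' t)) (\<lambda>t. wedge (\<beta> t) (\<beta>' t))"
  unfolding form_contact_def wedge_def nths_map length_map
proof (intro allI impI contact_sum contact_mult contact_const form_contactD[OF assms(1)] form_contactD[OF assms(2)])
  fix Xs S assume "set Xs \<subseteq> Y"
  then show "set (nths Xs S) \<subseteq> Y" "set (nths Xs (- S)) \<subseteq> Y" by (auto dest: in_set_nthsD)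
qed

lemma form_contact_interior_product:
  assumes "form_contact P Q Y \<alpha> \<beta>" "X \<in> Y"
  shows "form_contact P Q Y (\<lambda>t. interior_product (P t X) (\<alpha> t)) (\<lambda>t. interior_product (Q t X) (\<beta> t))"
  unfolding form_contact_def interior_product_apply
proof (intro allI impI)
  fix Xs assume "set Xs \<subseteq> Y"
  then have "set (X # Xs) \<subseteq> Y" using assms(2) by simp
  from form_contactD[OF assms(1) this]
  show "contact (\<lambda>t. \<alpha> t (P t X # map (P t) Xs)) (\<lambda>t. \<beta> t (Q t X # map (Q t) Xs))" by simp
qed

lemma form_contact_sum:
  assumes "\<And>i. i \<in> I \<Longrightarrow> form_contact P Q Y (\<alpha> i) (\<beta> i)"
  shows "form_contact P Q Y (\<lambda>t vs. \<Sum>i\<in>I. r i * \<alpha> i t vs) (\<lambda>t vs. \<Sum>i\<in>I. r i * \<beta> i t vs)"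
  unfolding form_contact_def
  by (intro allI impI contact_sum contact_mult contact_const form_contactD[OF assms])

text \<open>The induction puts the value or the velocity of each path it has treated into the fixed arguments \<open>us\<close>.\<close>

lemma alternating_has_real_derivative:
  assumes "alternating \<omega>"
  shows "((\<lambda>t. \<omega> (us @ map (\<lambda>(a, b). a + t *\<^sub>R b) ps)) has_real_derivative
      (\<Sum>i<length ps. \<omega> (us @ (map fst ps)[i := snd (ps ! i)]))) (at 0)"
proof (induction ps arbitrary: us)
  case Nil
  then show ?case by simp
next
  case (Cons x ps)
  obtain a b where x: "x = (a, b)" by force
  let ?tail = "\<lambda>t. map (\<lambda>(a, b). a + t *\<^sub>R b) ps"
  have split: "\<omega> (us @ map (\<lambda>(a, b). a + t *\<^sub>R b) (x # ps)) =
      \<omega> ((us @ [a]) @ ?tail t) + t * \<omega> ((us @ [b]) @ ?tail t)" for t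
    using linear_add[OF alternating_linear[OF assms], of us a "t *\<^sub>R b" "?tail t"]
      linear_scale[OF alternating_linear[OF assms], of us t b "?tail t"] by (simp add: x)
  have tail0: "?tail 0 = map fst ps" by (simp add: case_prod_unfold)
  from DERIV_add[OF Cons[of "us @ [a]"] DERIV_mult[OF DERIV_ident Cons[of "us @ [b]"]]]
  have "((\<lambda>t. \<omega> ((us @ [a]) @ ?tail t) + t * \<omega> ((us @ [b]) @ ?tail t)) has_real_derivative
      (\<Sum>i<length ps. \<omega> ((us @ [a]) @ (map fst ps)[i := snd (ps ! i)])) + \<omega> (us @ b # map fst ps)) (at 0)"
    unfolding tail0 by simp
  then show ?case
    unfolding split by (simp add: x sum.lessThan_Suc_shift add.commute del: sum.lessThan_Suc)
qed

context manifold_atlas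
begin

definition chart_line :: "'m \<Rightarrow> 'e \<Rightarrow> real \<Rightarrow> 'm" where
  "chart_line p v t = inv_chart (chart_at A p) (snd (chart_at A p) p + t *\<^sub>R v)"

lemma chart_line_0: "chart_line p v 0 = p"
  by (simp add: chart_line_def inv_chart_chart chart_at_props)

lemma eventually_chart_line:
  assumes "open U" "p \<in> U" shows "eventually (\<lambda>t. chart_line p v t \<in> U) (nhds 0)"
proof -
  let ?c = "chart_at A p"
  have "((\<lambda>t. snd ?c p + t *\<^sub>R v) \<longlongrightarrow> snd ?c p + 0 *\<^sub>R v) (nhds 0)"
    by (intro tendsto_intros filterlim_ident)
  moreover have "open (snd ?c ` (U \<inter> fst ?c))" "snd ?c p + 0 *\<^sub>R v \<in> snd ?c ` (U \<inter> fst ?c)"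
    using open_chart_image[OF chart_at_props(1) assms(1)] assms(2) chart_at_props(2) by auto
  ultimately have "eventually (\<lambda>t. snd ?c p + t *\<^sub>R v \<in> snd ?c ` (U \<inter> fst ?c)) (nhds 0)"
    by (rule topological_tendstoD)
  then show ?thesis
  proof (rule eventually_mono)
    show "chart_line p v t \<in> U" if t: "snd ?c p + t *\<^sub>R v \<in> snd ?c ` (U \<inter> fst ?c)" for t
    proof -
      obtain q where "snd ?c p + t *\<^sub>R v = snd ?c q" "q \<in> U" "q \<in> fst ?c" using t by blast
      then show ?thesis by (simp add: chart_line_def inv_chart_chart chart_at_props(1))
    qed
  qed
qed

lemma has_real_derivative_chart_line:
  assumes "chart_smooth (chart_at A p) U f" "p \<in> U"
  shows "((\<lambda>t. f (chart_line p v t)) has_real_derivative directional_derivative A p v f) (at 0)"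
proof -
  let ?c = "chart_at A p"
  let ?f = "f \<circ> inv_chart ?c" and ?x = "snd ?c p"
  have f: "(?f has_derivative frechet_derivative ?f (at ?x)) (at (?x + 0 *\<^sub>R v))"
    using chart_smooth_imp_differentiable[OF assms chart_at_props(2)]
    by (simp add: frechet_derivative_works[symmetric])
  have "((\<lambda>t. ?x + t *\<^sub>R v) has_derivative (\<lambda>t. t *\<^sub>R v)) (at 0)"
    by (auto intro!: derivative_eq_intros)
  from diff_chain_at[OF this f]
  have "(?f \<circ> (\<lambda>t. ?x + t *\<^sub>R v) has_derivative (\<lambda>t. frechet_derivative ?f (at ?x) (t *\<^sub>R v))) (at 0)"
    by (simp add: comp_def)
  moreover have "frechet_derivative ?f (at ?x) (t *\<^sub>R v) = t *\<^sub>R directional_derivative A p v f" for t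
    unfolding directional_derivative_def
    by (rule linear_scale, rule linear_frechet_derivative,
        rule chart_smooth_imp_differentiable[OF assms chart_at_props(2)])
  ultimately show ?thesis
    by (simp add: has_field_derivative_def comp_def chart_line_def mult_commute_abs)
qed

lemma directional_derivative_locally_const:
  assumes "chart_smooth (chart_at A p) U f" "p \<in> U" "open U" "\<And>q. q \<in> U \<Longrightarrow> f q = a"
  shows "directional_derivative A p v f = 0"
proof -
  have "eventually (\<lambda>t. f (chart_line p v t) = a) (nhds 0)"
    using eventually_chart_line[OF assms(3,2), of v] by (rule eventually_mono) (rule assms(4))
  from DERIV_cong_ev[OF refl this refl] has_real_derivative_chart_line[OF assms(1,2), of v]
  have "((\<lambda>t. a) has_real_derivative directional_derivative A p v f) (at 0)" by simp
  then show ?thesis using DERIV_const DERIV_unique by blast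
qed

text \<open>
  By multilinearity the correction terms of the covariant derivative are the derivative of the form at
  the fixed point along the affine paths \<open>Y p + t D\<^sub>v Y\<close>.
\<close>

lemma cov_derivative_form_eq_0_iff_contact:
  assumes \<omega>: "smooth_form A UNIV \<omega>" and U: "open U" "p \<in> U"
    and Ys: "\<And>Y. Y \<in> set Ys \<Longrightarrow> smooth_vector_field A U Y"
  shows "cov_derivative_form A D \<omega> p v Ys = 0 \<longleftrightarrow>
    contact (\<lambda>t. \<omega> (chart_line p v t) (map (\<lambda>Y. Y (chart_line p v t)) Ys))
      (\<lambda>t. \<omega> p (map (\<lambda>Y. Y p + t *\<^sub>R D p v Y) Ys))"
proof -
  let ?F = "\<lambda>t. \<omega> (chart_line p v t) (map (\<lambda>Y. Y (chart_line p v t)) Ys)"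
    and ?G = "\<lambda>t. \<omega> p (map (\<lambda>Y. Y p + t *\<^sub>R D p v Y) Ys)"
  let ?d = "directional_derivative A p v (\<lambda>q. \<omega> q (map (\<lambda>Y. Y q) Ys))"
    and ?s = "\<Sum>i<length Ys. \<omega> p ((map (\<lambda>Y. Y p) Ys)[i := D p v (Ys ! i)])"
  have "chart_smooth (chart_at A p) U (\<lambda>q. \<omega> q (map (\<lambda>Y. Y q) Ys))"
  proof (rule chart_smooth_form_apply)
    show "chart_smooth_form A (chart_at A p) U \<omega>"
      using smooth_form_subset[OF \<omega>] U(1) chart_at_props(1)
      by (intro smooth_form_imp_chart_smooth_form) auto
  qed (use Ys chart_at_props(1) in \<open>auto simp: smooth_vector_field_iff_chart_smooth_field\<close>)
  from has_real_derivative_chart_line[OF this U(2), of v]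
  have F: "(?F has_real_derivative ?d) (at 0)" .
  have "alternating (\<omega> p)" using \<omega> by (simp add: smooth_form_def)
  from alternating_has_real_derivative[OF this, of "[]" "map (\<lambda>Y. (Y p, D p v Y)) Ys"]
  have G: "(?G has_real_derivative ?s) (at 0)"
    by (simp add: comp_def)
  have "?d = ?s" if c: "contact ?F ?G"
  proof -
    obtain d where "(?F has_real_derivative d) (at 0)" "(?G has_real_derivative d) (at 0)"
      using c unfolding contact_def by blast
    then show ?thesis using DERIV_unique[OF F] DERIV_unique[OF G] by simp
  qed
  moreover have "contact ?F ?G" if "?d = ?s"
    using F G that unfolding contact_def by (auto simp: chart_line_0)
  ultimately have "contact ?F ?G \<longleftrightarrow> ?d = ?s" by blast
  then show ?thesis by (simp add: cov_derivative_form_def)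
qed

lemma form_contact_parallel:
  assumes "smooth_form A UNIV \<omega>" "covariantly_constant A D \<omega>" "open U" "p \<in> U"
  shows "form_contact (\<lambda>t X. X (chart_line p v t)) (\<lambda>t X. X p + t *\<^sub>R D p v X)
    {X. smooth_vector_field A U X} (\<lambda>t. \<omega> (chart_line p v t)) (\<lambda>t. \<omega> p)"
  unfolding form_contact_def
proof (intro allI impI)
  fix Xs assume Xs: "set Xs \<subseteq> {X. smooth_vector_field A U X}"
  then have "cov_derivative_form A D \<omega> p v Xs = 0"
    using assms(2-4) unfolding covariantly_constant_def by blast
  then show "contact (\<lambda>t. \<omega> (chart_line p v t) (map (\<lambda>X. X (chart_line p v t)) Xs))
      (\<lambda>t. \<omega> p (map (\<lambda>X. X p + t *\<^sub>R D p v X) Xs))"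
    using cov_derivative_form_eq_0_iff_contact[OF assms(1,3,4), of Xs] Xs by blast
qed

end

lemma form_contact_affine:
  assumes "alternating \<omega>"
  shows "form_contact (\<lambda>t (a, b). a + t *\<^sub>R b) (\<lambda>t (a, b). a + t *\<^sub>R b) UNIV (\<lambda>t. \<omega>) (\<lambda>t. \<omega>)"
  unfolding form_contact_def contact_def
  using alternating_has_real_derivative[OF assms, of "[]"] by auto


section \<open>The global products\<close>

text \<open>
  The smooth orthonormal frames are those over which a spin structure is given; they make the contraction with
  the inverse metric explicit, and adapted coframes are built from them.
\<close>

locale null_manifold = manifold_atlas A
  for A :: "('m::{t2_space,second_countable_topology}, 'e::euclidean_space) chart set" +
  fixes g :: "'m \<Rightarrow> 'e \<Rightarrow> 'e \<Rightarrow> real" and vol :: "'m \<Rightarrow> 'e form" and T :: "'m \<Rightarrow> 'e"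
    and \<kappa> :: "'m \<Rightarrow> 'e form"
  assumes metric: "lorentzian_metric A g" and null_form: "nowhere_vanishing_null_1form A g \<kappa>"
    and time: "time_orientation A g T"
    and frames: "\<exists>V E. p \<in> V \<and> oriented_orthonormal_frame A g vol T V E"
begin

lemmas frame_covector = frame_null_covector[OF metric null_form]

text \<open>A timelike field is never orthogonal to the null direction, so it can be normalised against \<open>\<kappa>\<close>.\<close>

definition N :: "'m \<Rightarrow> 'e" where
  "N q = inverse (\<kappa> q [T q]) *\<^sub>R T q"

definition curlywedge :: "('m \<Rightarrow> 'e form) \<Rightarrow> ('m \<Rightarrow> 'e form) \<Rightarrow> 'm \<Rightarrow> 'e form" where
  "curlywedge \<alpha> \<beta> q = wedge (\<alpha> q) (interior_product (N q) (\<beta> q))"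

definition bar_curlywedge :: "('m \<Rightarrow> 'e form) \<Rightarrow> ('m \<Rightarrow> 'e form) \<Rightarrow> 'm \<Rightarrow> 'e form" where
  "bar_curlywedge \<alpha> \<beta> q = wedge (\<kappa> q)
     (insertion (raise (g q) (interior_product (N q) (\<alpha> q))) (interior_product (N q) (\<beta> q)))"

lemma smooth_null_form: "smooth_form A UNIV \<kappa>"
  using null_form by (simp add: nowhere_vanishing_null_1form_def smooth_form_deg_def)

lemma null_eval_time_nonzero: "\<kappa> q [T q] \<noteq> 0"
proof -
  obtain V E where "q \<in> V" "oriented_orthonormal_frame A g vol T V E" using frames by blast
  then interpret null_covector "g q" "\<lambda>i. E i q" "\<kappa> q" using frame_covector by blast
  show ?thesis using null_eval_timelike time by (simp add: time_orientation_def)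
qed

lemma null_eval_N: "\<kappa> q [N q] = 1"
proof -
  have "alternating (\<kappa> q)" using smooth_null_form by (simp add: smooth_form_def)
  from linear_scale[OF alternating_linear_head[OF this]] show ?thesis
    by (simp add: N_def null_eval_time_nonzero)
qed

lemma chart_smooth_null_form: "c \<in> A \<Longrightarrow> open U \<Longrightarrow> chart_smooth_form A c U \<kappa>"
  using smooth_form_subset[OF smooth_null_form] by (intro smooth_form_imp_chart_smooth_form) auto

lemma smooth_N: "smooth_vector_field A UNIV N"
  unfolding smooth_vector_field_iff_chart_smooth_field
proof
  fix c assume c: "c \<in> A"
  have T: "chart_smooth_field A c UNIV T"
    using time c by (simp add: time_orientation_def smooth_vector_field_iff_chart_smooth_field)
  then have "chart_smooth c UNIV (\<lambda>q. \<kappa> q [T q])"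
    using chart_smooth_form_apply[OF chart_smooth_null_form[OF c open_UNIV], of "[T]"] by simp
  then show "chart_smooth_field A c UNIV N"
    unfolding N_def[abs_def]
    by (intro chart_smooth_field_scaleR chart_smooth_inverse c T null_eval_time_nonzero) auto
qed

lemma null_formsD:
  assumes "\<alpha> \<in> null_forms A g \<kappa>"
  shows "smooth_form A UNIV \<alpha>" "null_along (g p) (\<kappa> p) (\<alpha> p)" "alternating (\<alpha> p)"
  using assms by (auto simp: null_forms_def smooth_form_def)

lemma products_local:
  assumes \<alpha>: "\<alpha> \<in> null_forms A g \<kappa>" and \<beta>: "\<beta> \<in> null_forms A g \<kappa>"
    and co: "adapted_coframe A g \<kappa> U ep et" and p: "p \<in> U"
  shows "curlywedge \<alpha> \<beta> p = curlywedge_local (\<kappa> p) (ep p) (\<lambda>i. et i p) (\<alpha> p) (\<beta> p)"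
    and "bar_curlywedge \<alpha> \<beta> p = bar_curlywedge_local (g p) (\<kappa> p) (ep p) (\<lambda>i. et i p) (\<alpha> p) (\<beta> p)"
proof -
  obtain V E where "p \<in> V" "oriented_orthonormal_frame A g vol T V E" using frames by blast
  then interpret null_covector "g p" "\<lambda>i. E i p" "\<kappa> p" using frame_covector by blast
  interpret null_coframe "g p" "\<lambda>i. E i p" "\<kappa> p" "ep p" "\<lambda>i. et i p"
    by unfold_locales
      (use co p in \<open>auto simp: adapted_coframe_def smooth_form_deg_def smooth_form_def\<close>)
  note eq = local_products_eq[OF null_formsD(2,3)[OF \<alpha>] null_formsD(2,3)[OF \<beta>] null_eval_N]
  show "curlywedge \<alpha> \<beta> p = curlywedge_local (\<kappa> p) (ep p) (\<lambda>i. et i p) (\<alpha> p) (\<beta> p)"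
    unfolding curlywedge_def by (rule eq(1)[symmetric])
  show "bar_curlywedge \<alpha> \<beta> p = bar_curlywedge_local (g p) (\<kappa> p) (ep p) (\<lambda>i. et i p) (\<alpha> p) (\<beta> p)"
    unfolding bar_curlywedge_def by (rule eq(2)[symmetric])
qed

text \<open>
  The second product with the metric contraction written out in a local frame, a combination of exterior
  and interior products only, which can be differentiated directly.
\<close>

definition framed_bar_curlywedge ::
    "(nat \<Rightarrow> 'm \<Rightarrow> 'e) \<Rightarrow> ('m \<Rightarrow> 'e form) \<Rightarrow> ('m \<Rightarrow> 'e form) \<Rightarrow> 'm \<Rightarrow> 'e form" where
  "framed_bar_curlywedge E \<alpha> \<beta> q vs = (\<Sum>i<DIM('e). eta i i *
     wedge (\<kappa> q) (wedge (interior_product (E i q) (interior_product (N q) (\<alpha> q)))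
       (interior_product (E i q) (interior_product (N q) (\<beta> q)))) vs)"

lemma bar_curlywedge_in_frame:
  assumes "oriented_orthonormal_frame A g vol T V E" "q \<in> V" "alternating (\<alpha> q)" "alternating (\<beta> q)"
  shows "bar_curlywedge \<alpha> \<beta> q = framed_bar_curlywedge E \<alpha> \<beta> q"
proof -
  interpret null_covector "g q" "\<lambda>i. E i q" "\<kappa> q" using assms frame_covector by blast
  show ?thesis
    unfolding bar_curlywedge_def
    by (simp add: wedge_null_insertion_raise alternating_interior_product assms(3,4)
        metric_wedge_def framed_bar_curlywedge_def fun_eq_iff)
qed

lemma smooth_curlywedge:
  assumes "smooth_form A UNIV \<alpha>" "smooth_form A UNIV \<beta>"
  shows "smooth_form A UNIV (curlywedge \<alpha> \<beta>)"
proof (rule smooth_formI)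
  show "alternating (curlywedge \<alpha> \<beta> p)" for p
    using assms unfolding curlywedge_def
    by (intro alternating_wedge alternating_interior_product) (simp_all add: smooth_form_def)
  show "chart_smooth_form A c UNIV (curlywedge \<alpha> \<beta>)" if c: "c \<in> A" for c
    unfolding curlywedge_def[abs_def] using c smooth_N assms
    by (intro chart_smooth_form_wedge chart_smooth_form_interior_product smooth_form_imp_chart_smooth_form)
      (auto simp: smooth_vector_field_iff_chart_smooth_field)
qed simp

lemma smooth_bar_curlywedge:
  assumes \<alpha>: "smooth_form A UNIV \<alpha>" and \<beta>: "smooth_form A UNIV \<beta>"
  shows "smooth_form A UNIV (bar_curlywedge \<alpha> \<beta>)"
proof (rule smooth_formI)
  have alt: "alternating (\<alpha> p)" "alternating (\<beta> p)" "alternating (\<kappa> p)" for p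
    using \<alpha> \<beta> smooth_null_form by (simp_all add: smooth_form_def)
  show "alternating (bar_curlywedge \<alpha> \<beta> p)" for p
  proof -
    obtain V E where "p \<in> V" "oriented_orthonormal_frame A g vol T V E" using frames by blast
    then interpret null_covector "g p" "\<lambda>i. E i p" "\<kappa> p" using frame_covector by blast
    show ?thesis
      unfolding bar_curlywedge_def
      by (intro alternating_wedge alternating_insertion_raise alternating_interior_product alt)
  qed
  fix c assume c: "c \<in> A"
  show "chart_smooth_form A c UNIV (bar_curlywedge \<alpha> \<beta>)"
    unfolding chart_smooth_form_def
  proof (intro allI impI chart_smooth_locally[OF c open_UNIV])
    fix Xs p assume Xs: "\<forall>X\<in>set Xs. chart_smooth_field A c UNIV X"
    obtain V E where p: "p \<in> V" and E: "oriented_orthonormal_frame A g vol T V E" using frames by blast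
    then have V: "open V" by (simp add: oriented_orthonormal_frame_def)
    have "chart_smooth_form A c V \<omega>" if "smooth_form A UNIV \<omega>" for \<omega>
      using smooth_form_subset[OF that] c V by (intro smooth_form_imp_chart_smooth_form) auto
    moreover have "chart_smooth_field A c V (E i)" if "i < DIM('e)" for i
      using E c that by (simp add: oriented_orthonormal_frame_def smooth_vector_field_iff_chart_smooth_field)
    moreover have "chart_smooth_field A c V N"
      using smooth_vector_field_subset[OF smooth_N subset_UNIV] c
      by (simp add: smooth_vector_field_iff_chart_smooth_field)
    ultimately have "chart_smooth_form A c V (framed_bar_curlywedge E \<alpha> \<beta>)"
      unfolding framed_bar_curlywedge_def[abs_def] using \<alpha> \<beta> smooth_null_form
      by (intro chart_smooth_form_sum chart_smooth_form_wedge chart_smooth_form_interior_product) auto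
    then have "chart_smooth c V (\<lambda>q. framed_bar_curlywedge E \<alpha> \<beta> q (map (\<lambda>X. X q) Xs))"
      by (rule chart_smooth_form_apply) (use Xs chart_smooth_field_subset[OF _ subset_UNIV] in blast)
    then have "chart_smooth c V (\<lambda>q. bar_curlywedge \<alpha> \<beta> q (map (\<lambda>X. X q) Xs))"
      by (rule chart_smooth_cong[OF c V]) (simp add: bar_curlywedge_in_frame[OF E] alt)
    then show "\<exists>W. open W \<and> p \<in> W \<and>
        chart_smooth c (UNIV \<inter> W) (\<lambda>q. bar_curlywedge \<alpha> \<beta> q (map (\<lambda>X. X q) Xs))"
      using V p by auto
  qed
qed simp

lemma adapted_coframe_near:
  obtains U ep et where "p \<in> U" "adapted_coframe A g \<kappa> U ep et"
proof -
  obtain V E where "p \<in> V" "oriented_orthonormal_frame A g vol T V E" using frames by blast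
  then show thesis using adapted_coframe_exists[OF metric null_form] that by metis
qed

lemma is_curlywedge_iff:
  assumes "\<alpha> \<in> null_forms A g \<kappa>" "\<beta> \<in> null_forms A g \<kappa>"
  shows "is_curlywedge A g \<kappa> \<alpha> \<beta> \<psi> \<longleftrightarrow> \<psi> = curlywedge \<alpha> \<beta>"
proof
  assume \<psi>: "is_curlywedge A g \<kappa> \<alpha> \<beta> \<psi>"
  show "\<psi> = curlywedge \<alpha> \<beta>"
  proof
    fix p
    obtain U ep et where co: "p \<in> U" "adapted_coframe A g \<kappa> U ep et" by (rule adapted_coframe_near)
    have "\<psi> p = curlywedge_local (\<kappa> p) (ep p) (\<lambda>i. et i p) (\<alpha> p) (\<beta> p)"
      using \<psi> co unfolding is_curlywedge_def by blast
    then show "\<psi> p = curlywedge \<alpha> \<beta> p"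
      by (simp add: products_local(1)[OF assms co(2,1)])
  qed
next
  assume \<psi>: "\<psi> = curlywedge \<alpha> \<beta>"
  show "is_curlywedge A g \<kappa> \<alpha> \<beta> \<psi>"
    unfolding \<psi> is_curlywedge_def
    by (intro conjI allI impI ballI smooth_curlywedge null_formsD(1) assms products_local(1))
qed

lemma is_bar_curlywedge_iff:
  assumes "\<alpha> \<in> null_forms A g \<kappa>" "\<beta> \<in> null_forms A g \<kappa>"
  shows "is_bar_curlywedge A g \<kappa> \<alpha> \<beta> \<psi> \<longleftrightarrow> \<psi> = bar_curlywedge \<alpha> \<beta>"
proof
  assume \<psi>: "is_bar_curlywedge A g \<kappa> \<alpha> \<beta> \<psi>"
  show "\<psi> = bar_curlywedge \<alpha> \<beta>"
  proof
    fix p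
    obtain U ep et where co: "p \<in> U" "adapted_coframe A g \<kappa> U ep et" by (rule adapted_coframe_near)
    have "\<psi> p = bar_curlywedge_local (g p) (\<kappa> p) (ep p) (\<lambda>i. et i p) (\<alpha> p) (\<beta> p)"
      using \<psi> co unfolding is_bar_curlywedge_def by blast
    then show "\<psi> p = bar_curlywedge \<alpha> \<beta> p"
      by (simp add: products_local(2)[OF assms co(2,1)])
  qed
next
  assume \<psi>: "\<psi> = bar_curlywedge \<alpha> \<beta>"
  show "is_bar_curlywedge A g \<kappa> \<alpha> \<beta> \<psi>"
    unfolding \<psi> is_bar_curlywedge_def
    by (intro conjI allI impI ballI smooth_bar_curlywedge null_formsD(1) assms products_local(2))
qed

lemma null_eval_N_moved:
  assumes "covariantly_constant A D \<kappa>" shows "\<kappa> p [N p + t *\<^sub>R D p v N] = 1"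
proof -
  have "cov_derivative_form A D \<kappa> p v [N] = 0"
    using assms[unfolded covariantly_constant_def, rule_format, of UNIV "[N]" p v] smooth_N by simp
  moreover have "directional_derivative A p v (\<lambda>q. \<kappa> q [N q]) = 0"
    unfolding null_eval_N
    by (rule directional_derivative_locally_const[OF chart_smooth_const, of p UNIV]) auto
  ultimately have "\<kappa> p [D p v N] = 0" by (simp add: cov_derivative_form_def)
  moreover have "alternating (\<kappa> p)" using smooth_null_form by (simp add: smooth_form_def)
  from linear_add[OF alternating_linear_head[OF this]] linear_scale[OF alternating_linear_head[OF this]]
  have "\<kappa> p [N p + t *\<^sub>R D p v N] = \<kappa> p [N p] + t * \<kappa> p [D p v N]" by simp
  ultimately show ?thesis by (simp add: null_eval_N)
qed

text \<open>
  To first order, \<open>N\<close> moves through vectors on which \<open>\<kappa>\<close> is 1, and the product does not depend on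
  which of them is used.
\<close>

lemma covariantly_constant_curlywedge:
  assumes \<alpha>: "\<alpha> \<in> null_forms A g \<kappa>" and \<beta>: "\<beta> \<in> null_forms A g \<kappa>"
    and par: "covariantly_constant A D \<kappa>" "covariantly_constant A D \<alpha>" "covariantly_constant A D \<beta>"
  shows "covariantly_constant A D (curlywedge \<alpha> \<beta>)"
  unfolding covariantly_constant_def
proof (intro allI impI ballI)
  fix U Ys p v
  assume UY: "open U \<and> (\<forall>Y\<in>set Ys. smooth_vector_field A U Y)" and p: "p \<in> U"
  let ?P = "\<lambda>t X. X (chart_line p v t)" and ?Q = "\<lambda>t X. X p + t *\<^sub>R D p v X"
  let ?Y = "{X. smooth_vector_field A U X}"
  have "N \<in> ?Y" using smooth_vector_field_subset[OF smooth_N] by simp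
  then have "form_contact ?P ?Q ?Y (\<lambda>t. wedge (\<alpha> (chart_line p v t)) (interior_product (?P t N) (\<beta> (chart_line p v t))))
      (\<lambda>t. wedge (\<alpha> p) (interior_product (?Q t N) (\<beta> p)))"
    using UY p by (intro form_contact_wedge form_contact_interior_product form_contact_parallel
        null_formsD(1)[OF \<alpha>] null_formsD(1)[OF \<beta>] par) auto
  moreover have "wedge (\<alpha> p) (interior_product (?Q t N) (\<beta> p)) = curlywedge \<alpha> \<beta> p" for t
  proof -
    obtain V E where "p \<in> V" "oriented_orthonormal_frame A g vol T V E" using frames by blast
    then interpret null_covector "g p" "\<lambda>i. E i p" "\<kappa> p" using frame_covector by blast
    show ?thesis
      unfolding curlywedge_def
      using null_alongD(1)[OF null_formsD(2,3)[OF \<alpha>]] null_alongD(1)[OF null_formsD(2,3)[OF \<beta>]]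
      by (intro curlywedge_independent null_formsD(3)[OF \<beta>] null_eval_N null_eval_N_moved[OF par(1)])
  qed
  ultimately have "form_contact ?P ?Q ?Y (\<lambda>t. curlywedge \<alpha> \<beta> (chart_line p v t)) (\<lambda>t. curlywedge \<alpha> \<beta> p)"
    by (simp add: curlywedge_def)
  from form_contactD[OF this, of Ys] show "cov_derivative_form A D (curlywedge \<alpha> \<beta>) p v Ys = 0"
    using UY p cov_derivative_form_eq_0_iff_contact[OF smooth_curlywedge, of \<alpha> \<beta> U p Ys]
      null_formsD(1)[OF \<alpha>] null_formsD(1)[OF \<beta>] by auto
qed

lemma metric_connection_frame_skew:
  assumes D: "metric_connection A g D" and E: "oriented_orthonormal_frame A g vol T V E" and p: "p \<in> V"
    and ij: "i < DIM('e)" "j < DIM('e)"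
  shows "g p (D p v (E i)) (E j p) + g p (E i p) (D p v (E j)) = 0"
proof -
  have V: "open V" and smooth: "smooth_vector_field A V (E i)" "smooth_vector_field A V (E j)"
    using E ij by (simp_all add: oriented_orthonormal_frame_def)
  have "directional_derivative A p v (\<lambda>q. g q (E i q) (E j q)) = 0"
  proof (rule directional_derivative_locally_const[OF _ p V])
    show "chart_smooth (chart_at A p) V (\<lambda>q. g q (E i q) (E j q))"
      using smooth chart_at_props(1)
      by (intro chart_smooth_metric[OF metric _ V]) (auto simp: smooth_vector_field_iff_chart_smooth_field)
    show "g q (E i q) (E j q) = eta i j" if "q \<in> V" for q
      using E ij that by (simp add: oriented_orthonormal_frame_def)
  qed
  moreover have "directional_derivative A p v (\<lambda>q. g q (E i q) (E j q)) =
      g p (D p v (E i)) (E j p) + g p (E i p) (D p v (E j))"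
    using D V smooth p unfolding metric_connection_def by blast
  ultimately show ?thesis by simp
qed

text \<open>
  Here the orthonormal frame which contracts the two factors moves as well; as the connection is metric,
  it stays orthonormal up to terms of second order, which the derivative does not see.
\<close>

lemma covariantly_constant_bar_curlywedge:
  assumes D: "metric_connection A g D" and \<alpha>: "\<alpha> \<in> null_forms A g \<kappa>" and \<beta>: "\<beta> \<in> null_forms A g \<kappa>"
    and par: "covariantly_constant A D \<kappa>" "covariantly_constant A D \<alpha>" "covariantly_constant A D \<beta>"
  shows "covariantly_constant A D (bar_curlywedge \<alpha> \<beta>)"
  unfolding covariantly_constant_def
proof (intro allI impI ballI)
  fix U Ys p v
  assume UY: "open U \<and> (\<forall>Y\<in>set Ys. smooth_vector_field A U Y)" and p: "p \<in> U"
  obtain V E where pV: "p \<in> V" and E: "oriented_orthonormal_frame A g vol T V E" using frames by blast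
  interpret null_covector "g p" "\<lambda>i. E i p" "\<kappa> p" using frame_covector[OF E pV] .
  define W where "W = U \<inter> V"
  have W: "open W" "p \<in> W" using UY p pV E by (auto simp: W_def oriented_orthonormal_frame_def)
  let ?P = "\<lambda>t X. X (chart_line p v t)" and ?Q = "\<lambda>t X. X p + t *\<^sub>R D p v X"
  let ?Y = "{X. smooth_vector_field A W X}"
  let ?F = "\<lambda>i. D p v (E i)" and ?N = "\<lambda>t. ?Q t N"
  have Y: "N \<in> ?Y" "set Ys \<subseteq> ?Y" "\<And>i. i < DIM('e) \<Longrightarrow> E i \<in> ?Y"
    using smooth_vector_field_subset[OF smooth_N, of W] smooth_vector_field_subset[of A U _ W] UY
      smooth_vector_field_subset[of A V _ W] E by (auto simp: W_def oriented_orthonormal_frame_def)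
  have alt: "alternating (\<alpha> q)" "alternating (\<beta> q)" for q
    using null_formsD(3) \<alpha> \<beta> by auto
  define B where "B t a b = wedge (\<kappa> p) (wedge (interior_product a (interior_product (?N t) (\<alpha> p)))
      (interior_product b (interior_product (?N t) (\<beta> p))))" for t a b
  define C where "C t G vs = (\<Sum>i<DIM('e). eta i i * B t (G i) (G i) vs)" for t G vs
  \<comment> \<open>The product near \<open>p\<close> is in contact with the product formed with the moved vectors at \<open>p\<close>.\<close>
  have "form_contact ?P ?Q ?Y (\<lambda>t. framed_bar_curlywedge E \<alpha> \<beta> (chart_line p v t))
      (\<lambda>t. C t (\<lambda>i. ?Q t (E i)))"
    unfolding framed_bar_curlywedge_def[abs_def] C_def[abs_def] B_def
    using W Y by (intro form_contact_sum form_contact_wedge form_contact_interior_product form_contact_parallel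
        smooth_null_form null_formsD(1)[OF \<alpha>] null_formsD(1)[OF \<beta>] par) auto
  from form_contactD[OF this Y(2)]
  have "contact (\<lambda>t. framed_bar_curlywedge E \<alpha> \<beta> (chart_line p v t) (map (?P t) Ys))
      (\<lambda>t. C t (\<lambda>i. ?Q t (E i)) (map (?Q t) Ys))" .
  moreover have "eventually (\<lambda>t. framed_bar_curlywedge E \<alpha> \<beta> (chart_line p v t) (map (?P t) Ys) =
      bar_curlywedge \<alpha> \<beta> (chart_line p v t) (map (?P t) Ys)) (nhds 0)"
    using eventually_chart_line[OF W, of v]
    by (rule eventually_mono) (simp add: bar_curlywedge_in_frame[OF E] alt W_def)
  ultimately have near: "contact (\<lambda>t. bar_curlywedge \<alpha> \<beta> (chart_line p v t) (map (?P t) Ys))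
      (\<lambda>t. C t (\<lambda>i. ?Q t (E i)) (map (?Q t) Ys))"
    by (rule contact_cong_left)
  \<comment> \<open>The first-order effect of moving the frame at \<open>p\<close> cancels.\<close>
  have BL: "linear (\<lambda>a. B t a b zs)" "linear (\<lambda>b. B t a b zs)" for t a b zs
  proof -
    note alt' = alternating_interior_product[OF alt(1), of "?N t"] alternating_interior_product[OF alt(2), of "?N t"]
    show "linear (\<lambda>a. B t a b zs)" "linear (\<lambda>b. B t a b zs)"
      unfolding B_def
      by (rule linearI; simp only: interior_product_linear[OF alt'(1)] interior_product_linear[OF alt'(2)]
          wedge_add_left wedge_add_right wedge_scale_left wedge_scale_right real_scaleR_def)+
  qed
  have expand: "C t (\<lambda>i. ?Q t (E i)) zs = C t (\<lambda>i. E i p) zs + t\<^sup>2 * C t ?F zs" for t zs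
  proof -
    have "(\<Sum>i<DIM('e). eta i i * (B t (E i p) (?F i) zs + B t (?F i) (E i p) zs)) = 0"
      by (rule frame_contraction_infinitesimally_invariant[of ?F "\<lambda>a b. B t a b zs"])
        (simp_all add: metric_connection_frame_skew[OF D E pV] BL)
    moreover have "B t (?Q t (E i)) (?Q t (E i)) zs = B t (E i p) (E i p) zs +
        t * (B t (E i p) (?F i) zs + B t (?F i) (E i p) zs) + t\<^sup>2 * B t (?F i) (?F i) zs" for i
      by (simp add: linear_add[OF BL(1)] linear_add[OF BL(2)] linear_scale[OF BL(1)] linear_scale[OF BL(2)]
          algebra_simps power2_eq_square)
    then have "C t (\<lambda>i. ?Q t (E i)) zs = C t (\<lambda>i. E i p) zs +
        t * (\<Sum>i<DIM('e). eta i i * (B t (E i p) (?F i) zs + B t (?F i) (E i p) zs)) + t\<^sup>2 * C t ?F zs"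
      unfolding C_def by (simp add: sum_distrib_left sum.distrib[symmetric] algebra_simps)
    ultimately show ?thesis by simp
  qed
  have fixed: "C t (\<lambda>i. E i p) = bar_curlywedge \<alpha> \<beta> p" for t
  proof -
    have "C t (\<lambda>i. E i p) = metric_wedge (interior_product (?N t) (\<alpha> p)) (interior_product (?N t) (\<beta> p))"
      by (simp add: C_def[abs_def] B_def metric_wedge_def fun_eq_iff)
    also have "\<dots> = metric_wedge (interior_product (N p) (\<alpha> p)) (interior_product (N p) (\<beta> p))"
      using null_alongD[OF null_formsD(2,3)[OF \<alpha>]] null_alongD[OF null_formsD(2,3)[OF \<beta>]]
      by (intro bar_curlywedge_independent alt null_eval_N null_eval_N_moved[OF par(1)])
    finally show ?thesis
      by (simp add: bar_curlywedge_in_frame[OF E pV] alt framed_bar_curlywedge_def metric_wedge_def fun_eq_iff)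
  qed
  \<comment> \<open>A path of vectors is encoded as the pair of its value and its velocity.\<close>
  let ?A = "\<lambda>t (a, b). a + t *\<^sub>R b :: 'e"
  have affine: "form_contact ?A ?A UNIV (\<lambda>t. \<omega>) (\<lambda>t. \<omega>)" if "alternating \<omega>" for \<omega> :: "'e form"
    using form_contact_affine[OF that] .
  have "form_contact ?A ?A UNIV (\<lambda>t. C t (\<lambda>i. ?A t (?F i, 0))) (\<lambda>t. C t (\<lambda>i. ?A t (?F i, 0)))"
  proof -
    have "form_contact ?A ?A UNIV (\<lambda>t. interior_product (?A t (N p, D p v N)) \<omega>)
        (\<lambda>t. interior_product (?A t (N p, D p v N)) \<omega>)" if "alternating \<omega>" for \<omega>
      using that by (intro form_contact_interior_product affine) auto
    then have moved: "form_contact ?A ?A UNIV (\<lambda>t. interior_product (?N t) \<omega>) (\<lambda>t. interior_product (?N t) \<omega>)"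
      if "alternating \<omega>" for \<omega> using that by simp
    then show ?thesis
      unfolding C_def[abs_def] B_def
      by (intro form_contact_sum form_contact_wedge form_contact_interior_product
          moved[OF alt(1)] moved[OF alt(2)] affine[OF alternating_null] UNIV_I)
  qed
  from form_contactD[OF this, of "map (\<lambda>Y. (Y p, D p v Y)) Ys"]
  have C_contact: "contact (\<lambda>t. C t ?F (map (?Q t) Ys)) (\<lambda>t. C t ?F (map (?Q t) Ys))"
    by (simp add: comp_def)
  have fixed_contact: "contact (\<lambda>t. bar_curlywedge \<alpha> \<beta> p (map (?Q t) Ys))
      (\<lambda>t. bar_curlywedge \<alpha> \<beta> p (map (?Q t) Ys))"
  proof -
    have "alternating (bar_curlywedge \<alpha> \<beta> p)"
      using smooth_bar_curlywedge null_formsD(1) \<alpha> \<beta> by (auto simp: smooth_form_def)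
    from form_contactD[OF affine[OF this], of "map (\<lambda>Y. (Y p, D p v Y)) Ys"]
    show ?thesis by (simp add: comp_def)
  qed
  have square: "contact (\<lambda>t. t\<^sup>2) (\<lambda>t. 0)"
    unfolding contact_def by (auto intro!: exI[of _ 0] derivative_eq_intros)
  have "contact (\<lambda>t. C t (\<lambda>i. ?Q t (E i)) (map (?Q t) Ys)) (\<lambda>t. bar_curlywedge \<alpha> \<beta> p (map (?Q t) Ys))"
    unfolding expand fixed using contact_add[OF fixed_contact contact_mult[OF square C_contact]] by simp
  from contact_trans[OF near this]
  show "cov_derivative_form A D (bar_curlywedge \<alpha> \<beta>) p v Ys = 0"
    using UY p cov_derivative_form_eq_0_iff_contact[OF smooth_bar_curlywedge, of \<alpha> \<beta> U p Ys]
      null_formsD(1)[OF \<alpha>] null_formsD(1)[OF \<beta>] by auto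
qed

end

theorem theorem2p1:
  fixes A :: "('m::{t2_space,second_countable_topology}, 'e::euclidean_space) chart set"
    and g :: "'m \<Rightarrow> 'e \<Rightarrow> 'e \<Rightarrow> real"
    and vol :: "'m \<Rightarrow> 'e form"
    and T :: "'m \<Rightarrow> 'e"
    and \<kappa> lam \<phi> :: "'m \<Rightarrow> 'e form"
  assumes "lorentzian_spin_manifold A g vol T"
    and "nowhere_vanishing_null_1form A g \<kappa>"
    and "lam \<in> null_forms A g \<kappa>"
    and "\<phi> \<in> null_forms A g \<kappa>"
  shows "(\<exists>!\<psi>. is_bar_curlywedge A g \<kappa> lam \<phi> \<psi>) \<and>
         (\<exists>!\<psi>. is_curlywedge A g \<kappa> lam \<phi> \<psi>) \<and>
         (\<forall>D. metric_connection A g D \<and> covariantly_constant A D \<kappa> \<and>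
              covariantly_constant A D lam \<and> covariantly_constant A D \<phi> \<longrightarrow>
            (\<forall>\<psi>. is_curlywedge A g \<kappa> lam \<phi> \<psi> \<longrightarrow> covariantly_constant A D \<psi>) \<and>
            (\<forall>\<psi>. is_bar_curlywedge A g \<kappa> lam \<phi> \<psi> \<longrightarrow> covariantly_constant A D \<psi>))"
proof -
  interpret null_manifold A g vol T \<kappa>
  proof
    show "smooth_atlas A" "lorentzian_metric A g" "time_orientation A g T"
      using assms(1) by (simp_all add: lorentzian_spin_manifold_def)
    show "nowhere_vanishing_null_1form A g \<kappa>" by fact
    fix p
    \<comment> \<open>The spin structure is given over a cover by orthonormal frames.\<close>
    have "spin_manifold A g vol T" using assms(1) by (simp add: lorentzian_spin_manifold_def)
    then obtain F :: "('m set \<times> (nat \<Rightarrow> 'm \<Rightarrow> 'e)) set"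
      where F: "\<forall>(V, E) \<in> F. oriented_orthonormal_frame A g vol T V E" "(\<Union>(V, E) \<in> F. V) = UNIV"
      unfolding spin_manifold_def by (elim exE conjE) (rule that)
    have "p \<in> (\<Union>(V, E) \<in> F. V)" unfolding F(2) by simp
    then obtain V E where "(V, E) \<in> F" "p \<in> V" by auto
    then show "\<exists>V E. p \<in> V \<and> oriented_orthonormal_frame A g vol T V E" using F(1) by blast
  qed
  show ?thesis
    unfolding is_curlywedge_iff[OF assms(3,4)] is_bar_curlywedge_iff[OF assms(3,4)]
    using covariantly_constant_curlywedge[OF assms(3,4)] covariantly_constant_bar_curlywedge[OF _ assms(3,4)]
    by blast
qed

end
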